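(* With the notation of the context, the following identities hold: $$f_{\mathscr N_1}(x,q)=F_7(x,q)=S_{0,0,0,0}(x,q),$$ $$f_{\mathscr N_2}(x,q)=F_3(x,q)=S_{0,-2,-2,-1}(x,q)-S_{0,0,0,0}(x,q)+S_{2,2,1,0}(x,q),$$ $$f_{\mathscr N_3}(x,q)=F_4(x,q)=\frac{q^2}{x^2}S_{-8,-12,-8,-4}(x,q)-\frac1x S_{-2,-4,-3,-2}(x,q)-\frac1{q^2}S_{0,0,0,0}(x,q)-\frac{q^2}{x^2}S_{-4,-8,-6,-3}(x,q).$$ Moreover, writing $$Q(i,j,k,\ell)=4i^2+12ij+8ik+4i\ell+12j^2+16jk+8j\ell+6k^2+6k\ell+2\ell^2,$$ one has $$\sum_{i,j,k,\ell\ge0}\frac{q^{Q(i,j,k,\ell)}}{(q^2;q^2)_i(q^2;q^2)_j(q;q)_k(q;q)_\ell}=\frac1{\theta(q^2,q^3,q^4;q^{14})},$$ $$\sum_{i,j,k,\ell\ge0}\frac{q^{Q(i,j,k,\ell)}}{(q^2;q^2)_i(q^2;q^2)_j(q;q)_k(q;q)_\ell}\left(q^{2i+2j+k}+q^{-2j-2k-\ell}-1\right)=\frac1{\theta(q,q^4,q^6;q^{14})},$$ $$\sum_{i,j,k,\ell\ge0}\frac{q^{Q(i,j,k,\ell)}}{(q^2;q^2)_i(q^2;q^2)_j(q;q)_k(q;q)_\ell}\left(q^{-8i-12j-8k-4\ell+2}-q^{-2i-4j-3k-2\ell}-q^{-4i-8j-6k-3\ell+2}-q^{-2}\right)=\f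rac1{\theta(q^2,q^5,q^6;q^{14})}.$$
   Context: All series are formal (where negative powers of $q$ or $x$ occur, identities are read among formal Laurent series in $q$ and $x$). For $n\in\mathbb Z_{\ge0}\cup\{\infty\}$, $(a;q)_n=\prod_{0\le t<n}(1-aq^t)$. Also $\theta(a;q)=(a;q)_\infty(q/a;q)_\infty$ and $\theta(a_1,\dots,a_r;q)=\theta(a_1;q)\cdots\theta(a_r;q)$. Quadruple sums: for integers $A,B,C,D$, $$S_{A,B,C,D}(x,q)=\sum_{i,j,k,\ell\ge0}\frac{x^{2i+3j+2k+\ell}\,q^{4i^2+12ij+8ik+4i\ell+12j^2+16jk+8j\ell+6k^2+6k\ell+2\ell^2+Ai+Bj+Ck+D\ell}}{(q^2;q^2)_i(q^2;q^2)_j(q;q)_k(q;q)_\ell}.$$ Partitions: a partition $\lambda=\lambda_1+\cdots+\lambda_j$ is written in weakly decreasing order of its (positive) parts; $\mathrm{wt}(\lambda)$ is the sum of its parts, $\ell(\lambda)=j$ the number of parts, and $m_i(\lambda)$ the multiplicity of $i$ in $\lambda$. A sub-partition of $\lambda$ means a contiguous subsequence $\lambda_s+\cdots+\lambda_t$. A partition $\lambda=\lambda_1+\cdots+\lambda_j$ satisfies the difference condition $[d_1,\dots,d_{j-1}]$ if $\lambda_i-\lambda_{i+1}=d_i$ for all $1\le i\le j-1$. For a set $\mathscr C$ of partitions, $f_{\mathscr C}(x,q)=\sum_{\lambda\in\mathscr C}x^{\ell(\lambda)}q^{\mathrm{wt}(\lambda)}$. Let $\mathscr N$ be the set of partitions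 $\lambda$ such that: (1) no sub-partition of $\lambda$ satisfies the difference conditions $[1]$, $[0,0]$, $[0,2]$, $[2,0]$ or $[0,3]$; and (2) no sub-partition of $\lambda$ with odd weight satisfies the difference conditions $[3,0]$, $[0,4]$, $[4,0]$ or $[3,2*,3,0]$, where $2*$ indicates zero or more occurrences of $2$. Define $\mathscr N_1=\{\lambda\in\mathscr N: m_1(\lambda)=0\}$; $\mathscr N_2=\{\lambda\in\mathscr N: m_1(\lambda),m_2(\lambda),m_3(\lambda)\le1\}$; $\mathscr N_3=\{\lambda\in\mathscr N: m_1(\lambda)=m_3(\lambda)=0,\ m_2(\lambda)\le1$, and $\lambda$ has no sub-partition of the form $(2k+3)+2k+(2k-2)+\cdots+4+2$ with $k\ge1\}$. Let $\mathscr S\subset\mathbb Z[[x,q]]$ be the set of series $f$ with $f(0,q)=f(x,0)=1$. The series $F_0,F_1,F_2,F_3,F_4,F_5,F_7\in\mathscr S$ are the solution in $\mathscr S$ of the system (all functions on the right evaluated at $(xq^2,q)$, all on the left at $(x,q)$): $F_0=F_0+xq^2F_1+x^2q^4F_2+xqF_3+x^2q^2F_4$; $F_1=xq^2F_1+F_5$; $F_2=F_7$; $F_3=xq^2F_1+xqF_3+F_5$; $F_4=xq^2F_4+F_7$; $F_5=F_0+xq^2F_1+x^2q^4F_2+xqF_3$; $F_7=F_0+xq^2F_1+x^2q^4F_2$. *)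

theory Defs
  imports
    "HOL-Analysis.Analysis"
    "HOL-Computational_Algebra.Formal_Laurent_Series"
    "HOL-Library.Sublist"
begin

section \<open>Rings of formal series\<close>

text \<open>
  \<open>\<int>[[x,q]]\<close> is rendered as \<open>int fps fps\<close>: the outer variable is \<open>x\<close>, the inner one is \<open>q\<close>.
  Identities with negative powers of \<open>x\<close> or \<open>q\<close> live in the field \<open>\<rat>((q))((x))\<close>, rendered as
  \<open>rat fls fls\<close>; rational coefficients are used because the library provides division of
  Laurent series over fields only. Identities in \<open>q\<close> alone live in \<open>\<rat>((q))\<close>, i.e. \<open>rat fls\<close>.
\<close>

abbreviation x_ps :: "int fps fps" where "x_ps \<equiv> fps_X"
abbreviation q_ps :: "int fps fps" where "q_ps \<equiv> fps_const fps_X"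

abbreviation x_ls :: "rat fls fls" where "x_ls \<equiv> fls_X"
abbreviation q_ls :: "rat fls fls" where "q_ls \<equiv> fls_const fls_X"

abbreviation q_uni :: "rat fls" where "q_uni \<equiv> fls_X"

text \<open>The inclusion of \<open>\<int>[[x,q]]\<close> into \<open>\<rat>((q))((x))\<close>.\<close>

definition to_laurent :: "int fps fps \<Rightarrow> rat fls fls" where
  "to_laurent f =
     fps_to_fls (Abs_fps (\<lambda>m. fps_to_fls (Abs_fps (\<lambda>n. of_int (fps_nth (fps_nth f m) n)))))"

section \<open>Pochhammer symbols and theta functions\<close>

definition qpoch :: "'a::comm_ring_1 \<Rightarrow> 'a \<Rightarrow> nat \<Rightarrow> 'a" where
  "qpoch a q n = (\<Prod>t<n. 1 - a * q ^ t)"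

text \<open>Infinite products and sums refer to the library's metric on Laurent series: a sequence
  converges iff for every \<open>N\<close> its coefficients of index at most \<open>N\<close> are eventually constant.\<close>

definition qpoch_inf :: "rat fls \<Rightarrow> rat fls \<Rightarrow> rat fls" where
  "qpoch_inf a q = (\<Prod>t. 1 - a * q ^ t)"

definition theta :: "rat fls \<Rightarrow> rat fls \<Rightarrow> rat fls" where
  "theta a q = qpoch_inf a q * qpoch_inf (q / a) q"

definition thetas :: "rat fls list \<Rightarrow> rat fls \<Rightarrow> rat fls" where
  "thetas as q = prod_list (map (\<lambda>a. theta a q) as)"

section \<open>Quadruple sums\<close>

definition Qform :: "nat \<Rightarrow> nat \<Rightarrow> nat \<Rightarrow> nat \<Rightarrow> nat" where
  "Qform i j k l = 4 * i^2 + 12 * i * j + 8 * i * k + 4 * i * l + 12 * j^2 + 16 * j * k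
     + 8 * j * l + 6 * k^2 + 6 * k * l + 2 * l^2"

definition quad_denom :: "'a::comm_ring_1 \<Rightarrow> nat \<Rightarrow> nat \<Rightarrow> nat \<Rightarrow> nat \<Rightarrow> 'a" where
  "quad_denom q i j k l =
     qpoch (q^2) (q^2) i * qpoch (q^2) (q^2) j * qpoch q q k * qpoch q q l"

text \<open>The sum converges \<open>x\<close>-adically: only finitely many quadruples contribute to a given
  power of \<open>x\<close>.\<close>

definition S_series :: "int \<Rightarrow> int \<Rightarrow> int \<Rightarrow> int \<Rightarrow> rat fls fls" where
  "S_series A B C D =
     (\<Sum>\<^sub>\<infinity>(i, j, k, l)\<in>UNIV. x_ls ^ (2 * i + 3 * j + 2 * k + l)
        * q_ls powi (int (Qform i j k l) + A * int i + B * int j + C * int k + D * int l)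
        / quad_denom q_ls i j k l)"

section \<open>Partitions\<close>

definition is_partition :: "nat list \<Rightarrow> bool" where
  "is_partition p \<longleftrightarrow> sorted_wrt (\<ge>) p \<and> 0 \<notin> set p"

definition diff_cond :: "nat list \<Rightarrow> nat list \<Rightarrow> bool" where
  "diff_cond ds p \<longleftrightarrow>
     length p = Suc (length ds) \<and> (\<forall>i<length ds. p ! i = p ! Suc i + ds ! i)"

definition N_set :: "nat list set" where
  "N_set = {p. is_partition p
     \<and> (\<forall>s. sublist s p \<longrightarrow> (\<forall>ds \<in> {[1], [0,0], [0,2], [2,0], [0,3]}. \<not> diff_cond ds s))
     \<and> (\<forall>s. sublist s p \<and> odd (sum_list s) \<longrightarrow>
          (\<forall>ds \<in> {[3,0], [0,4], [4,0]} \<union> {3 # replicate n 2 @ [3,0] | n. True}.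
             \<not> diff_cond ds s))}"

definition N1_set :: "nat list set" where
  "N1_set = {p \<in> N_set. count_list p 1 = 0}"

definition N2_set :: "nat list set" where
  "N2_set = {p \<in> N_set. count_list p 1 \<le> 1 \<and> count_list p 2 \<le> 1 \<and> count_list p 3 \<le> 1}"

definition N3_set :: "nat list set" where
  "N3_set = {p \<in> N_set. count_list p 1 = 0 \<and> count_list p 3 = 0 \<and> count_list p 2 \<le> 1
     \<and> (\<forall>k\<ge>1. \<not> sublist ((2 * k + 3) # rev (map (\<lambda>i. 2 * i) [1..<Suc k])) p)}"

text \<open>The sum over all partitions in \<open>C\<close> of \<open>x\<close> to the number of parts times \<open>q\<close> to the weight,
  given by its coefficients (each of the sets below is finite if \<open>C\<close> consists of partitions).\<close>

definition gen_series :: "nat list set \<Rightarrow> int fps fps" where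
  "gen_series C =
     Abs_fps (\<lambda>m. Abs_fps (\<lambda>n. int (card {p \<in> C. length p = m \<and> sum_list p = n})))"

section \<open>The system of functional equations\<close>

text \<open>Series with \<open>f(0,q) = 1\<close> and \<open>f(x,0) = 1\<close>.\<close>

definition S_space :: "int fps fps set" where
  "S_space = {f. fps_nth f 0 = 1 \<and> Abs_fps (\<lambda>m. fps_nth (fps_nth f m) 0) = 1}"

text \<open>The substitution of \<open>x q\<^sup>2\<close> for \<open>x\<close>.\<close>

definition subst_xq2 :: "int fps fps \<Rightarrow> int fps fps" where
  "subst_xq2 f = f oo (q_ps^2 * x_ps)"

definition F_system :: "(nat \<Rightarrow> int fps fps) \<Rightarrow> bool" where
  "F_system F \<longleftrightarrow>
     (let x = x_ps; q = q_ps; G = (\<lambda>i. subst_xq2 (F i)) in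
        F 0 = G 0 + x * q^2 * G 1 + x^2 * q^4 * G 2 + x * q * G 3 + x^2 * q^2 * G 4
      \<and> F 1 = x * q^2 * G 1 + G 5
      \<and> F 2 = G 7
      \<and> F 3 = x * q^2 * G 1 + x * q * G 3 + G 5
      \<and> F 4 = x * q^2 * G 4 + G 7
      \<and> F 5 = G 0 + x * q^2 * G 1 + x^2 * q^4 * G 2 + x * q * G 3
      \<and> F 7 = G 0 + x * q^2 * G 1 + x^2 * q^4 * G 2)"

text \<open>The extensional function space pins down the irrelevant values outside the index set, so
  that the solution is unique as a function on \<open>nat\<close>.\<close>

definition F_series :: "nat \<Rightarrow> int fps fps" where
  "F_series = (THE F. F \<in> {0, 1, 2, 3, 4, 5, 7} \<rightarrow>\<^sub>E S_space \<and> F_system F)"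

end

theory Submission
  imports Defs
begin

unbundle fps_syntax

text \<open>
  Deleting the parts 1 and 2 of a partition in \<open>N_set\<close> and subtracting 2 from the others leaves a
  partition in \<open>N_set\<close>. Hence the generating functions solve the system for the \<open>F\<^sub>i\<close>, whose solution is
  unique because it determines the coefficients of \<open>x\<^sup>n\<close> recursively. Eliminating the other series leaves
  three functional equations for \<open>F\<^sub>7\<close>, \<open>F\<^sub>3\<close>, \<open>F\<^sub>4\<close>, and the quadruple sums satisfy them as a consequence of
  their contiguity relations.

  At \<open>x = 1\<close> the sum of all coefficients of a series \<open>f\<close> is the limit of \<open>(q\<^sup>2;q\<^sup>2)\<^sub>m\<close> times the \<open>m\<close>-th
  coefficient of \<open>f / (x; q\<^sup>2)\<^sub>\<infinity>\<close>. These coefficients satisfy recurrences with explicit solutions, and so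
  \<open>F\<^sub>7\<close> becomes \<open>\<Sum>\<^sub>n (-1)\<^sup>n q\<^bsup>n\<^sup>2\<^esup> (q;q\<^sup>2)\<^sub>n / (q\<^sup>2;q\<^sup>2)\<^bsub>2n\<^esub>\<close> divided by \<open>(q;q\<^sup>2)\<^sub>\<infinity>\<close>, with similar sums for
  \<open>F\<^sub>3\<close> and \<open>F\<^sub>4\<close>. Bailey's lemma turns these sums into bilateral theta series, which the quintuple product
  identity in base \<open>q\<^bsup>14\<^esup>\<close> evaluates.
\<close>

section \<open>Convergence of formal Laurent series\<close>

text \<open>The modulus 14 arises as follows. The Bailey pair lives in base q^2 and its bilateral
  alpha_j sits on j = 3k and j = 3k + 1 with leading exponent 12 k^2; the conjugate pair contributes
  j^2, that is 9 k^2. The total 21 k^2 is the exponent 3 k^2 / 2 of the quintuple product in base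
  q^14, and the specialisations x = q^3, q, q^5 match the three linear terms. The prefactor 1 /
  (q;q^2)_inf cancels against the constant (q;q^2)_inf / (q^2;q^2)_inf of the conjugate pair, and
  the remaining (q^2;q^2)_inf splits by residues modulo 14.

  The obstacle before that is the third functional equation, which has degree two in x.
  Multiplication by 1 / (x;q^2)_inf exposes a common factor 1 - q^2 x in it; once this is cancelled,
  all three equations have degree one in x, so that coefficients with consecutive indices determine
  each other. The explicit solution is then verified through the term ratio of the sums in
  question.\<close>

definition ord_ge :: "int \<Rightarrow> 'a::zero fls \<Rightarrow> bool" where
  "ord_ge N a \<longleftrightarrow> (\<forall>n<N. fls_nth a n = 0)"

lemma ord_ge_0 [simp]: "ord_ge N 0"
  by (simp add: ord_ge_def)

lemma ord_ge_mono: "ord_ge M a \<Longrightarrow> N \<le> M \<Longrightarrow> ord_ge N a"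
  by (auto simp: ord_ge_def)

lemma ord_ge_add: "ord_ge N a \<Longrightarrow> ord_ge N b \<Longrightarrow> ord_ge N (a + b :: 'a::monoid_add fls)"
  by (auto simp: ord_ge_def)

lemma ord_ge_uminus: "ord_ge N a \<Longrightarrow> ord_ge N (- a :: 'a::group_add fls)"
  by (auto simp: ord_ge_def)

lemma ord_ge_diff: "ord_ge N a \<Longrightarrow> ord_ge N b \<Longrightarrow> ord_ge N (a - b :: 'a::group_add fls)"
  by (auto simp: ord_ge_def)

lemma ord_ge_sum:
  "(\<And>x. x \<in> A \<Longrightarrow> ord_ge N (f x)) \<Longrightarrow> ord_ge N (\<Sum>x\<in>A. f x :: 'a::comm_monoid_add fls)"
  by (induction A rule: infinite_finite_induct) (auto intro: ord_ge_add)

lemma ord_ge_subdegree: "ord_ge (fls_subdegree a) a"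
  by (simp add: ord_ge_def)

text \<open>The disjunct a = 0 is the reason for working with \<open>ord_ge\<close>: the subdegree
  of the zero series is 0 by convention, although it vanishes to every order.\<close>

lemma ord_ge_iff_subdegree: "ord_ge N a \<longleftrightarrow> a = 0 \<or> N \<le> fls_subdegree a"
  by (metis linorder_not_less nth_fls_subdegree_nonzero ord_ge_0 ord_ge_def ord_ge_mono
      ord_ge_subdegree)

lemma ord_ge_mult:
  "ord_ge M a \<Longrightarrow> ord_ge N b \<Longrightarrow> ord_ge (M + N) (a * b :: 'a::idom fls)"
  unfolding ord_ge_iff_subdegree by (cases "a = 0"; cases "b = 0") (auto simp: fls_subdegree_mult)

lemma ord_ge_1 [simp]: "ord_ge 0 (1 :: 'a::zero_neq_one fls)"
  by (simp add: ord_ge_iff_subdegree)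

lemma ord_ge_X_power: "ord_ge (int n) (fls_X ^ n :: 'a::idom fls)"
  by (simp add: ord_ge_iff_subdegree)

lemma ord_ge_X_powi: "ord_ge n (fls_X powi n :: 'a::field fls)"
  by (simp add: ord_ge_iff_subdegree)

lemma ord_ge_imp_dist_lt:
  fixes a b :: "'a::group_add fls"
  assumes "ord_ge (int N) (a - b)"
  shows "dist a b \<le> inverse (2 ^ N)"
proof (cases "a = b")
  case False
  then have "int N \<le> fls_subdegree (a - b)" using assms by (auto simp: ord_ge_iff_subdegree)
  then show ?thesis using False
    by (auto simp: dist_fls_def intro!: le_imp_inverse_le power_increasing)
qed auto

lemma dist_lt_imp_ord_ge:
  fixes a b :: "'a::group_add fls"
  assumes "dist a b < inverse (2 ^ N)"
  shows "ord_ge (int N) (a - b)"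
proof (cases "a = b")
  case False
  have "int N \<le> fls_subdegree (a - b)"
  proof (rule ccontr)
    assume *: "\<not> int N \<le> fls_subdegree (a - b)"
    show False
    proof (cases "fls_subdegree (a - b) \<ge> 0")
      case True
      then have "inverse (2 ^ N) \<le> (inverse (2 ^ nat (fls_subdegree (a - b))) :: real)"
        using * by (intro le_imp_inverse_le power_increasing) auto
      then show ?thesis using assms False True by (simp add: dist_fls_def)
    next
      case F: False
      have "inverse (2 ^ N) \<le> (1::real)" by (simp add: inverse_le_1_iff)
      also have "1 \<le> (2::real) ^ nat (- fls_subdegree (a - b))" by simp
      finally show ?thesis using assms False F by (simp add: dist_fls_def)
    qed
  qed
  then show ?thesis by (simp add: ord_ge_iff_subdegree)
qed auto

text \<open>The distance is 2 to the power minus the order of the difference, so the balls around l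
  are the sets cut out by \<open>ord_ge\<close>. Every limit below is handled as a congruence modulo
  order N.\<close>

lemma tendsto_fls_iff:
  fixes l :: "'a::group_add fls"
  shows "(f \<longlongrightarrow> l) F \<longleftrightarrow> (\<forall>N. eventually (\<lambda>x. ord_ge N (f x - l)) F)"
proof safe
  fix N assume lim: "(f \<longlongrightarrow> l) F"
  have "eventually (\<lambda>x. dist (f x) l < inverse (2 ^ nat N)) F"
    using lim by (rule tendstoD) simp
  then show "eventually (\<lambda>x. ord_ge N (f x - l)) F"
    by eventually_elim (auto dest!: dist_lt_imp_ord_ge elim!: ord_ge_mono)
next
  assume *: "\<forall>N. eventually (\<lambda>x. ord_ge N (f x - l)) F"
  show "(f \<longlongrightarrow> l) F"
  proof (rule tendstoI)
    fix e :: real assume "e > 0"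
    then obtain N where N: "inverse (2 ^ N) < e"
      using real_arch_pow_inv[of e "1/2"] by (auto simp: power_one_over inverse_eq_divide)
    have "eventually (\<lambda>x. ord_ge (int N) (f x - l)) F" using * by blast
    then show "eventually (\<lambda>x. dist (f x) l < e) F"
      by eventually_elim (use N ord_ge_imp_dist_lt in \<open>force intro: le_less_trans\<close>)
  qed
qed

lemma eventually_ord_ge_diff:
  fixes f :: "_ \<Rightarrow> 'a::group_add fls"
  shows "(f \<longlongrightarrow> l) F \<Longrightarrow> eventually (\<lambda>x. ord_ge N (f x - l)) F"
  by (simp add: tendsto_fls_iff)

section \<open>Continuity of the ring operations\<close>

instance fls :: (ab_group_add) topological_ab_group_add
proof
  fix a b :: "'a fls"
  show "((\<lambda>x. fst x + snd x) \<longlongrightarrow> a + b) (nhds a \<times>\<^sub>F nhds b)"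
    unfolding tendsto_fls_iff
  proof
    fix N
    have "eventually (\<lambda>x. ord_ge N (x - a)) (nhds a)" "eventually (\<lambda>x. ord_ge N (x - b)) (nhds b)"
      by (rule eventually_ord_ge_diff, simp add: filterlim_ident)+
    then have "eventually (\<lambda>x. ord_ge N (fst x - a) \<and> ord_ge N (snd x - b)) (nhds a \<times>\<^sub>F nhds b)"
      unfolding eventually_prod_filter by fastforce
    then show "eventually (\<lambda>x. ord_ge N (fst x + snd x - (a + b))) (nhds a \<times>\<^sub>F nhds b)"
      by eventually_elim (metis (no_types, lifting) add_diff_add ord_ge_add)
  qed
  show "(uminus \<longlongrightarrow> - a) (nhds a)"
    unfolding tendsto_fls_iff
  proof
    fix N
    have "eventually (\<lambda>x. ord_ge N (x - a)) (nhds a)"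
      by (rule eventually_ord_ge_diff) (simp add: filterlim_ident)
    then show "eventually (\<lambda>x. ord_ge N (- x - - a)) (nhds a)"
      by eventually_elim (auto simp: ord_ge_def)
  qed
qed

instance fls :: (idom) topological_semigroup_mult
proof
  fix a b :: "'a fls"
  show "((\<lambda>x. fst x * snd x) \<longlongrightarrow> a * b) (nhds a \<times>\<^sub>F nhds b)"
    unfolding tendsto_fls_iff
  proof
    fix N
    define A B where "A = fls_subdegree a" and "B = fls_subdegree b"
    \<comment> \<open>The precision must grow with the pole orders of a and b, by which the errors
      get multiplied; M nonnegative and at least N keeps the product of the two errors at order
      N.\<close>
    define M where "M = max (max (N - B) (N - A)) (max N 0)"
    have "eventually (\<lambda>x. ord_ge M (x - a)) (nhds a)" "eventually (\<lambda>x. ord_ge M (x - b)) (nhds b)"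
      by (rule eventually_ord_ge_diff, simp add: filterlim_ident)+
    then have "eventually (\<lambda>x. ord_ge M (fst x - a) \<and> ord_ge M (snd x - b)) (nhds a \<times>\<^sub>F nhds b)"
      unfolding eventually_prod_filter by fastforce
    then show "eventually (\<lambda>x. ord_ge N (fst x * snd x - a * b)) (nhds a \<times>\<^sub>F nhds b)"
    proof eventually_elim
      case (elim x)
      have eq: "fst x * snd x - a * b = (fst x - a) * (snd x - b) + ((fst x - a) * b + a * (snd x - b))"
        by (simp add: algebra_simps)
      have "ord_ge (M + M) ((fst x - a) * (snd x - b))"
        using elim by (intro ord_ge_mult) auto
      moreover have "ord_ge (M + B) ((fst x - a) * b)"
        "ord_ge (A + M) (a * (snd x - b))"
        using elim by (auto intro!: ord_ge_mult simp: A_def B_def ord_ge_subdegree)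
      moreover have "N \<le> M" "0 \<le> M" "N \<le> M + B" "N \<le> A + M" unfolding M_def by linarith+
      then have "N \<le> M + M" "N \<le> M + B" "N \<le> A + M" by linarith+
      ultimately show ?case unfolding eq by (intro ord_ge_add) (auto elim: ord_ge_mono)
    qed
  qed
qed

section \<open>Infinite sums of Laurent series\<close>

lemma fls_nth_sum: "fls_nth (\<Sum>x\<in>A. f x) n = (\<Sum>x\<in>A. fls_nth (f x :: 'a::comm_monoid_add fls) n)"
  by (induction A rule: infinite_finite_induct) auto

definition null_family :: "('b \<Rightarrow> 'a::zero fls) \<Rightarrow> bool" where
  "null_family f \<longleftrightarrow> (\<forall>N. finite {k. \<not> ord_ge N (f k)})"

text \<open>The topology is non-archimedean: modulo order N all but finitely many members vanish, so
  each coefficient of the sum is a finite sum.\<close>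

lemma null_family_summable:
  fixes f :: "'b \<Rightarrow> 'a::ab_group_add fls"
  assumes "null_family f"
  shows "f summable_on A"
proof -
  define K where "K N = {k \<in> A. \<not> ord_ge N (f k)}" for N
  have fin: "finite (K N)" for N
    using assms by (auto simp: null_family_def K_def intro: finite_subset[rotated])
  have mono: "K M \<subseteq> K N" if "M \<le> N" for M N
    using that by (auto simp: K_def dest: ord_ge_mono)
  \<comment> \<open>All members with a pole lie in the finite set \<open>K 0\<close> and are added
    as Laurent series; the others are power series, whose coefficient at n receives contributions
    from \<open>K (n + 1)\<close> only.\<close>
  define L where "L = (\<Sum>k\<in>K 0. f k) + fps_to_fls (Abs_fps (\<lambda>n. \<Sum>k\<in>K (int n + 1) - K 0. fls_nth (f k) (int n)))"
  have L: "fls_nth L n = (\<Sum>k\<in>K (n + 1) \<union> K 0. fls_nth (f k) n)" for n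
  proof (cases "n \<ge> 0")
    case True
    have "K (n + 1) \<union> K 0 = K 0 \<union> (K (n + 1) - K 0)" by auto
    then have "(\<Sum>k\<in>K (n + 1) \<union> K 0. fls_nth (f k) n) =
       (\<Sum>k\<in>K 0. fls_nth (f k) n) + (\<Sum>k\<in>K (n + 1) - K 0. fls_nth (f k) n)"
      by (metis Diff_disjoint fin finite_Diff sum.union_disjoint)
    then show ?thesis using True by (simp add: L_def fls_nth_sum)
  next
    case False
    then have "K (n + 1) \<union> K 0 = K 0" using mono[of "n + 1" 0] by auto
    then show ?thesis using False by (simp add: L_def fls_nth_sum)
  qed
  have "(f has_sum L) A"
    unfolding has_sum_def tendsto_fls_iff
  proof
    fix N :: int
    show "eventually (\<lambda>F. ord_ge N (sum f F - L)) (finite_subsets_at_top A)"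
      unfolding eventually_finite_subsets_at_top
    proof (intro exI[of _ "K (max N 0)"] conjI allI impI)
      fix F assume F: "finite F \<and> K (max N 0) \<subseteq> F \<and> F \<subseteq> A"
      have "fls_nth (sum f F) n = fls_nth L n" if "n < N" for n
      proof -
        have "K (n + 1) \<subseteq> K (max N 0)" "K 0 \<subseteq> K (max N 0)" by (rule mono; use that in simp)+
        then have "K (n + 1) \<subseteq> F" "K 0 \<subseteq> F" using F by blast+
        then have "(\<Sum>k\<in>K (n + 1) \<union> K 0. fls_nth (f k) n) = (\<Sum>k\<in>F. fls_nth (f k) n)"
          using F by (intro sum.mono_neutral_left) (auto simp: K_def ord_ge_def)
        then show ?thesis by (simp add: L fls_nth_sum)
      qed
      then show "ord_ge N (sum f F - L)" by (simp add: ord_ge_def)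
    qed (use fin in \<open>auto simp: K_def\<close>)
  qed
  then show ?thesis by (auto simp: summable_on_def)
qed

text \<open>Dominated convergence: modulo order N only a finite index set matters, the same for all
  m, and over a finite set limit and sum commute.\<close>

lemma tannery_has_sum:
  fixes f :: "nat \<Rightarrow> 'b \<Rightarrow> 'a::ab_group_add fls"
  assumes fin: "\<And>N. finite {k. \<exists>m. \<not> ord_ge N (f m k)}"
    and sums: "\<And>m. (f m has_sum s m) UNIV"
    and lim: "\<And>k. (\<lambda>m. f m k) \<longlonglongrightarrow> g k"
  shows "\<exists>S. (g has_sum S) UNIV \<and> s \<longlonglongrightarrow> S"
proof -
  have ordg: "ord_ge N (g k)" if "\<And>m. ord_ge N (f m k)" for N k
  proof -
    have "eventually (\<lambda>m. ord_ge N (f m k - g k)) sequentially"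
      by (rule eventually_ord_ge_diff[OF lim])
    then obtain m where "ord_ge N (f m k - g k)" by (auto simp: eventually_sequentially)
    from ord_ge_diff[OF that[of m] this] show ?thesis by simp
  qed
  have "null_family g"
    unfolding null_family_def
  proof
    fix N
    show "finite {k. \<not> ord_ge N (g k)}"
      by (rule finite_subset[OF _ fin[of N]]) (use ordg in blast)
  qed
  then have "g summable_on UNIV" by (rule null_family_summable)
  then obtain S where S: "(g has_sum S) UNIV" by (auto simp: summable_on_def)
  have "s \<longlonglongrightarrow> S"
    unfolding tendsto_fls_iff
  proof
    fix N
    define K where "K = {k. \<exists>m. \<not> ord_ge N (f m k)}"
    have K: "finite K" using fin by (simp add: K_def)
    have "(\<lambda>m. \<Sum>k\<in>K. f m k) \<longlonglongrightarrow> (\<Sum>k\<in>K. g k)" by (intro tendsto_sum lim)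
    then have "eventually (\<lambda>m. ord_ge N ((\<Sum>k\<in>K. f m k) - (\<Sum>k\<in>K. g k))) sequentially"
      by (rule eventually_ord_ge_diff)
    then show "eventually (\<lambda>m. ord_ge N (s m - S)) sequentially"
    proof eventually_elim
      case (elim m)
      have rest: "ord_ge N (t - (\<Sum>k\<in>K. h k))"
        if "(h has_sum t) UNIV" "\<And>k. k \<notin> K \<Longrightarrow> ord_ge N (h k)" for h and t :: "'a fls"
      proof -
        have "eventually (\<lambda>F. ord_ge N (sum h F - t)) (finite_subsets_at_top UNIV)"
          using that(1) unfolding has_sum_def by (rule eventually_ord_ge_diff)
        moreover have "eventually (\<lambda>F. finite F \<and> K \<subseteq> F) (finite_subsets_at_top UNIV)"
          using K by (auto simp: eventually_finite_subsets_at_top)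
        ultimately have "eventually (\<lambda>F. ord_ge N (sum h F - t) \<and> finite F \<and> K \<subseteq> F)
            (finite_subsets_at_top UNIV)" by eventually_elim auto
        then obtain F where F: "ord_ge N (sum h F - t)" "finite F" "K \<subseteq> F"
          using eventually_happens finite_subsets_at_top_neq_bot by blast
        have "ord_ge N (sum h (F - K))" using that(2) by (intro ord_ge_sum) auto
        moreover have "sum h (F - K) = sum h F - sum h K" using F by (intro sum_diff)
        moreover have "t - sum h K = (sum h F - sum h K) - (sum h F - t)" by simp
        ultimately show ?thesis using F(1) by (metis ord_ge_diff)
      qed
      have 1: "ord_ge N (s m - (\<Sum>k\<in>K. f m k))" by (rule rest[OF sums]) (auto simp: K_def)
      have 2: "ord_ge N (S - (\<Sum>k\<in>K. g k))" by (rule rest[OF S]) (use ordg in \<open>auto simp: K_def\<close>)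
      have "s m - S = (s m - (\<Sum>k\<in>K. f m k)) - (S - (\<Sum>k\<in>K. g k)) + ((\<Sum>k\<in>K. f m k) - (\<Sum>k\<in>K. g k))"
        by (simp add: algebra_simps)
      then show ?case using 1 2 elim by (metis ord_ge_add ord_ge_diff)
    qed
  qed
  then show ?thesis using S by blast
qed

section \<open>Quadruple sums\<close>

lemma fls_nth_has_sum:
  fixes f :: "'b \<Rightarrow> 'a::ab_group_add fls"
  assumes "(f has_sum s) A" "finite K" "K \<subseteq> A" "\<And>k. k \<in> A - K \<Longrightarrow> fls_nth (f k) n = 0"
  shows "fls_nth s n = (\<Sum>k\<in>K. fls_nth (f k) n)"
proof -
  have "eventually (\<lambda>F. ord_ge (n + 1) (sum f F - s)) (finite_subsets_at_top A)"
    using assms(1) unfolding has_sum_def by (rule eventually_ord_ge_diff)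
  moreover have "eventually (\<lambda>F. finite F \<and> K \<subseteq> F \<and> F \<subseteq> A) (finite_subsets_at_top A)"
    using assms(2,3) by (auto simp: eventually_finite_subsets_at_top)
  ultimately have "eventually (\<lambda>F. ord_ge (n + 1) (sum f F - s) \<and> finite F \<and> K \<subseteq> F \<and> F \<subseteq> A)
      (finite_subsets_at_top A)" by eventually_elim auto
  then obtain F where F: "ord_ge (n + 1) (sum f F - s)" "finite F" "K \<subseteq> F" "F \<subseteq> A"
    using eventually_happens finite_subsets_at_top_neq_bot by blast
  have "fls_nth s n = (\<Sum>k\<in>F. fls_nth (f k) n)"
    using F(1) by (simp add: ord_ge_def fls_nth_sum)
  also have "\<dots> = (\<Sum>k\<in>K. fls_nth (f k) n)"
    by (rule sum.mono_neutral_right) (use F assms(4) in auto)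
  finally show ?thesis .
qed

lemma has_sum_flsI:
  fixes f :: "'b \<Rightarrow> 'a::ab_group_add fls"
  assumes "null_family f"
    and "\<And>n. \<exists>K. finite K \<and> K \<subseteq> A \<and> (\<forall>k \<in> A - K. fls_nth (f k) n = 0) \<and>
      fls_nth s n = (\<Sum>k\<in>K. fls_nth (f k) n)"
  shows "(f has_sum s) A"
proof -
  obtain L where L: "(f has_sum L) A"
    using null_family_summable[OF assms(1)] by (auto simp: summable_on_def)
  have "L = s"
  proof (rule fls_eqI)
    fix n
    from assms(2)[of n] obtain K where K: "finite K" "K \<subseteq> A" "\<forall>k \<in> A - K. fls_nth (f k) n = 0"
      "fls_nth s n = (\<Sum>k\<in>K. fls_nth (f k) n)" by blast
    have "fls_nth L n = (\<Sum>k\<in>K. fls_nth (f k) n)"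
      by (rule fls_nth_has_sum[OF L K(1,2)]) (use K(3) in auto)
    then show "fls_nth L n = fls_nth s n" using K(4) by simp
  qed
  then show ?thesis using L by simp
qed

definition qpow :: "int \<Rightarrow> rat fls" where
  "qpow e = fls_X powi e"

lemma qpow_add: "qpow (a + b) = qpow a * qpow b"
  unfolding qpow_def by (rule power_int_add) simp

lemma qpow_of_nat: "qpow (int n) = fls_X ^ n"
  unfolding qpow_def by (rule power_int_of_nat)

lemma qpow_0 [simp]: "qpow 0 = 1"
  by (simp add: qpow_def)

lemma qpow_neq_0 [simp]: "qpow e \<noteq> 0"
  unfolding qpow_def by (rule power_int_not_zero) simp

section \<open>The quadruple sum as a power series in x\<close>

definition quads :: "nat \<Rightarrow> (nat \<times> nat \<times> nat \<times> nat) set" where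
  "quads m = {(i, j, k, l). 2 * i + 3 * j + 2 * k + l = m}"

lemma quads_iff [simp]: "(i, j, k, l) \<in> quads m \<longleftrightarrow> 2 * i + 3 * j + 2 * k + l = m"
  by (simp add: quads_def)

lemma finite_quads [simp]: "finite (quads m)"
  by (rule finite_subset[of _ "{..m} \<times> {..m} \<times> {..m} \<times> {..m}"]) (auto simp: quads_def)

definition quad_term :: "int \<Rightarrow> int \<Rightarrow> int \<Rightarrow> int \<Rightarrow> nat \<times> nat \<times> nat \<times> nat \<Rightarrow> rat fls" where
  "quad_term A B C D = (\<lambda>(i, j, k, l).
     qpow (int (Qform i j k l) + A * int i + B * int j + C * int k + D * int l) / quad_denom fls_X i j k l)"

definition S_fps :: "int \<Rightarrow> int \<Rightarrow> int \<Rightarrow> int \<Rightarrow> rat fls fps" where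
  "S_fps A B C D = Abs_fps (\<lambda>m. \<Sum>z\<in>quads m. quad_term A B C D z)"

lemma fls_const_diff: "fls_const a - fls_const b = fls_const (a - b :: 'a::ab_group_add)"
  by (rule fls_eqI) simp

lemma qpoch_const: "qpoch (fls_const a) (fls_const q) n = fls_const (qpoch a q n)"
proof (induction n)
  case (Suc n)
  have "1 - fls_const a * fls_const q ^ n = fls_const (1 - a * q ^ n)"
    by (simp add: fls_const_power[symmetric] fls_const_diff[symmetric])
  then show ?case using Suc by (simp add: qpoch_def)
qed (simp add: qpoch_def)

lemma quad_denom_const: "quad_denom (fls_const q) i j k l = fls_const (quad_denom q i j k l)"
  by (simp add: quad_denom_def fls_const_power[symmetric] qpoch_const)

lemma S_series_eq: "S_series A B C D = fps_to_fls (S_fps A B C D)"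
proof -
  define t where "t = (\<lambda>(i, j, k, l). x_ls ^ (2 * i + 3 * j + 2 * k + l)
        * q_ls powi (int (Qform i j k l) + A * int i + B * int j + C * int k + D * int l)
        / quad_denom q_ls i j k l)"
  define d where "d = (\<lambda>(i::nat, j::nat, k::nat, l::nat). 2 * i + 3 * j + 2 * k + l)"
  have t: "t z = x_ls ^ d z * fls_const (quad_term A B C D z)" for z
  proof -
    obtain i j k l where z: "z = (i, j, k, l)" by (cases z)
    show ?thesis
      unfolding t_def z quad_term_def d_def prod.case qpow_def
      by (simp only: quad_denom_const fls_const_power_int[symmetric] times_divide_eq_right[symmetric]
          fls_const_divide_const)
  qed
  have nth: "fls_nth (t z) n = (if n = int (d z) then quad_term A B C D z else 0)" for z n
    unfolding t by simp
  have fin: "finite {z. d z = m}" for m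
    using finite_quads[of m] by (simp add: quads_def d_def case_prod_unfold)
  have quads: "quads m = {z. d z = m}" for m by (auto simp: quads_def d_def)
  have "null_family t"
    unfolding null_family_def
  proof
    fix N :: int
    have "{z. \<not> ord_ge N (t z)} \<subseteq> (\<Union>m\<le>nat N. {z. d z = m})"
      by (auto simp: ord_ge_def nth split: if_splits)
    then show "finite {z. \<not> ord_ge N (t z)}" by (rule finite_subset) (use fin in blast)
  qed
  then have "(t has_sum fps_to_fls (S_fps A B C D)) UNIV"
  proof (rule has_sum_flsI)
    fix n
    show "\<exists>K. finite K \<and> K \<subseteq> UNIV \<and> (\<forall>k\<in>UNIV - K. fls_nth (t k) n = 0) \<and>
      fls_nth (fps_to_fls (S_fps A B C D)) n = (\<Sum>k\<in>K. fls_nth (t k) n)"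
    proof (cases "n \<ge> 0")
      case True
      have "(\<Sum>z\<in>quads (nat n). quad_term A B C D z) = (\<Sum>z\<in>quads (nat n). fls_nth (t z) n)"
        by (rule sum.cong) (use True in \<open>auto simp: nth quads\<close>)
      then show ?thesis using True
        by (intro exI[of _ "quads (nat n)"]) (auto simp: S_fps_def nth quads fin)
    next
      case False
      then show ?thesis by (intro exI[of _ "{}"]) (auto simp: nth)
    qed
  qed
  then show ?thesis unfolding S_series_def t_def by (rule infsumI)
qed

text \<open>The substitution x -> c x, given by its effect on coefficients; with c = q^2 it becomes
  the operator \<open>E\<close> of the functional equations.\<close>

definition xscale :: "'a::comm_semiring_1 \<Rightarrow> 'a fps \<Rightarrow> 'a fps" where
  "xscale c f = Abs_fps (\<lambda>n. c ^ n * fps_nth f n)"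

lemma xscale_nth [simp]: "fps_nth (xscale c f) n = c ^ n * fps_nth f n"
  by (simp add: xscale_def)

lemma xscale_add: "xscale c (f + g) = xscale c f + xscale c g"
  by (simp add: fps_eq_iff algebra_simps)

lemma xscale_diff: "xscale (c :: 'a::comm_ring_1) (f - g) = xscale c f - xscale c g"
  by (simp add: fps_eq_iff algebra_simps)

lemma xscale_mult: "xscale c (f * g) = xscale c f * xscale c g"
  by (auto simp: fps_eq_iff fps_mult_nth sum_distrib_left power_add[symmetric] mult_ac
      intro!: sum.cong)

lemma xscale_const: "xscale c (fps_const a) = fps_const a"
  by (auto simp: fps_eq_iff)

lemma xscale_X: "xscale c fps_X = fps_const c * fps_X"
  by (auto simp: fps_eq_iff fps_X_def)

lemma xscale_power: "xscale c (f ^ n) = xscale c f ^ n"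
  by (induction n) (auto simp: xscale_mult, auto simp: fps_eq_iff)

text \<open>The x-exponent is 2i + 3j + 2k + l, so x -> x q^2 adds twice these weights to the linear
  form in the exponent of q.\<close>

lemma xscale_S_fps:
  "xscale (fls_X ^ 2) (S_fps A B C D) = S_fps (A + 4) (B + 6) (C + 4) (D + 2)"
proof (intro fps_ext)
  fix m
  have "(fls_X ^ 2) ^ m * quad_term A B C D z = quad_term (A + 4) (B + 6) (C + 4) (D + 2) z"
    if "z \<in> quads m" for z
  proof -
    obtain i j k l where z: "z = (i, j, k, l)" by (cases z)
    have m: "(fls_X ^ 2) ^ m = qpow (int (2 * m))" by (simp only: qpow_of_nat power_mult)
    have "int (2 * m) + (int (Qform i j k l) + A * int i + B * int j + C * int k + D * int l) =
       int (Qform i j k l) + (A + 4) * int i + (B + 6) * int j + (C + 4) * int k + (D + 2) * int l"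
      using that by (auto simp: z algebra_simps)
    then show ?thesis
      unfolding quad_term_def z prod.case m by (metis qpow_add times_divide_eq_right)
  qed
  then show "fps_nth (xscale (fls_X ^ 2) (S_fps A B C D)) m = fps_nth (S_fps (A + 4) (B + 6) (C + 4) (D + 2)) m"
    by (simp add: S_fps_def sum_distrib_left)
qed

section \<open>Contiguity relations\<close>

lemma qpoch_Suc: "qpoch a q (Suc n) = qpoch a q n * (1 - a * q ^ n)"
  by (simp add: qpoch_def)

lemma one_minus_X_power_neq_0: "n > 0 \<Longrightarrow> 1 - fls_X ^ n \<noteq> (0 :: rat fls)"
proof
  assume "n > 0" "1 - fls_X ^ n = (0 :: rat fls)"
  then have "fls_nth (1 - fls_X ^ n :: rat fls) 0 = fls_nth 0 0" by (simp only:)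
  with \<open>n > 0\<close> show False by simp
qed

lemma qpoch_X_neq_0:
  assumes "a > 0"
  shows "qpoch (fls_X ^ a) (fls_X ^ d) n \<noteq> (0 :: rat fls)"
proof -
  have "1 - fls_X ^ a * (fls_X ^ d) ^ t \<noteq> (0 :: rat fls)" for t
    using one_minus_X_power_neq_0[of "a + d * t"] assms by (simp add: power_add power_mult)
  then show ?thesis unfolding qpoch_def by simp
qed

lemma quads_sum_shift:
  fixes w :: "nat \<times> nat \<times> nat \<times> nat \<Rightarrow> rat fls"
  assumes "inj sh" "\<And>z. z \<notin> range sh \<Longrightarrow> w z = 0" "\<And>z n. sh z \<in> quads n \<longleftrightarrow> n \<ge> d \<and> z \<in> quads (n - d)"
  shows "(\<Sum>z\<in>quads m. w z) = (if m < d then 0 else \<Sum>z\<in>quads (m - d). w (sh z))"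
proof (cases "m < d")
  case True
  then have "w z = 0" if "z \<in> quads m" for z
    using assms(2)[of z] assms(3)[of _ m] that by (metis imageE linorder_not_less)
  then show ?thesis using True by simp
next
  case False
  have "(\<Sum>z\<in>quads (m - d). w (sh z)) = sum w (sh ` quads (m - d))"
    by (subst sum.reindex) (use assms(1) in \<open>auto intro: inj_on_subset\<close>)
  also have "\<dots> = (\<Sum>z\<in>quads m. w z)"
  proof (rule sum.mono_neutral_left)
    show "sh ` quads (m - d) \<subseteq> quads m"
    proof (rule image_subsetI)
      fix z assume "z \<in> quads (m - d)"
      then show "sh z \<in> quads m" using assms(3)[of z m] False by simp
    qed
    show "\<forall>z\<in>quads m - sh ` quads (m - d). w z = 0"
    proof
      fix z assume z: "z \<in> quads m - sh ` quads (m - d)"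
      have "z \<notin> range sh"
      proof
        assume "z \<in> range sh"
        then obtain y where "z = sh y" by blast
        then show False using z assms(3)[of y m] by blast
      qed
      then show "w z = 0" by (rule assms(2))
    qed
  qed simp
  finally show ?thesis using False by simp
qed

text \<open>The common pattern of the four relations below: \<open>sh\<close> raises one index by
  one. Terms where that index is 0 cancel in the difference; in the others the factor 1 - q^r
  produced by the difference cancels the last factor of the Pochhammer symbol, which lowers the
  index.\<close>

lemma S_fps_shift:
  assumes "inj sh" "\<And>z n. sh z \<in> quads n \<longleftrightarrow> n \<ge> d \<and> z \<in> quads (n - d)"
    and "\<And>z. z \<notin> range sh \<Longrightarrow> quad_term A B C D z = quad_term A' B' C' D' z"
    and "\<And>z. quad_term A B C D (sh z) - quad_term A' B' C' D' (sh z) = qpow e * quad_term A'' B'' C'' D'' z"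
  shows "S_fps A B C D - S_fps A' B' C' D' = fps_X ^ d * fps_const (qpow e) * S_fps A'' B'' C'' D''"
proof (intro fps_ext)
  fix m
  have "fps_nth (S_fps A B C D - S_fps A' B' C' D') m =
    (\<Sum>z\<in>quads m. quad_term A B C D z - quad_term A' B' C' D' z)"
    by (simp add: S_fps_def sum_subtractf)
  also have "\<dots> = (if m < d then 0 else \<Sum>z\<in>quads (m - d). qpow e * quad_term A'' B'' C'' D'' z)"
    by (subst quads_sum_shift[OF assms(1) _ assms(2)]) (use assms(3,4) in simp_all)
  also have "\<dots> = fps_nth (fps_X ^ d * (fps_const (qpow e) * S_fps A'' B'' C'' D'')) m"
    by (simp add: fps_X_power_mult_nth S_fps_def sum_distrib_left)
  finally show "fps_nth (S_fps A B C D - S_fps A' B' C' D') m =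
      fps_nth (fps_X ^ d * fps_const (qpow e) * S_fps A'' B'' C'' D'') m"
    by (simp only: mult.assoc)
qed

lemma quad_denom_neq_0: "quad_denom (fls_X :: rat fls) i j k l \<noteq> 0"
  using qpoch_X_neq_0[of 2 2] qpoch_X_neq_0[of 1 1] by (simp add: quad_denom_def)

lemma diff_frac:
  fixes u v a c :: "'a::field"
  assumes "c \<noteq> 0" "1 - r \<noteq> 0" "u = a" "v = a * r"
  shows "u / (c * (1 - r)) - v / (c * (1 - r)) = a / c"
proof -
  have "u / (c * (1 - r)) - v / (c * (1 - r)) = a * (1 - r) / (c * (1 - r))"
    using assms by (simp add: diff_divide_distrib[symmetric] right_diff_distrib)
  then show ?thesis using assms by simp
qed

text \<open>The new parameters are the increment of the quadratic form: raising i by one adds 4 + 8i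
  + 12j + 8k + 4l to it. The relations for j, k and l arise from the corresponding
  increments.\<close>

lemma S_fps_rel_i:
  "S_fps A B C D - S_fps (A + 2) B C D =
    fps_X ^ 2 * fps_const (qpow (4 + A)) * S_fps (A + 8) (B + 12) (C + 8) (D + 4)"
proof (rule S_fps_shift[where sh = "\<lambda>(i, j, k, l). (Suc i, j, k, l)"])
  show "inj (\<lambda>(i, j, k, l). (Suc i, j, k, l))" by (auto simp: inj_def)
  show "quad_term A B C D z = quad_term (A + 2) B C D z"
    if "z \<notin> range (\<lambda>(i, j, k, l). (Suc i, j, k, l))" for z
  proof -
    obtain i j k l where z: "z = (i, j, k, l)" by (cases z)
    have "i = 0" using that by (cases i) (auto simp: z image_iff)
    then show ?thesis by (simp add: quad_term_def z)
  qed
  fix z :: "nat \<times> nat \<times> nat \<times> nat"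
  obtain i j k l where z: "z = (i, j, k, l)" by (cases z)
  have q: "quad_denom fls_X (Suc i) j k l = quad_denom fls_X i j k l * (1 - fls_X ^ (2 * Suc i) :: rat fls)"
    by (simp add: quad_denom_def qpoch_Suc power_mult[symmetric] power_add[symmetric] mult_ac)
  show "quad_term A B C D (case z of (i, j, k, l) \<Rightarrow> (Suc i, j, k, l)) -
      quad_term (A + 2) B C D (case z of (i, j, k, l) \<Rightarrow> (Suc i, j, k, l)) =
    qpow (4 + A) * quad_term (A + 8) (B + 12) (C + 8) (D + 4) z"
    unfolding quad_term_def z prod.case q times_divide_eq_right
    by (rule diff_frac[OF quad_denom_neq_0 one_minus_X_power_neq_0])
      (simp_all del: power_Suc of_nat_Suc flip: qpow_of_nat qpow_add,
       simp_all add: Qform_def algebra_simps power2_eq_square)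
qed (auto simp: quads_def)

lemma S_fps_rel_j:
  "S_fps A B C D - S_fps A (B + 2) C D =
    fps_X ^ 3 * fps_const (qpow (12 + B)) * S_fps (A + 12) (B + 24) (C + 16) (D + 8)"
proof (rule S_fps_shift[where sh = "\<lambda>(i, j, k, l). (i, Suc j, k, l)"])
  show "inj (\<lambda>(i, j, k, l). (i, Suc j, k, l))" by (auto simp: inj_def)
  show "quad_term A B C D z = quad_term A (B + 2) C D z"
    if "z \<notin> range (\<lambda>(i, j, k, l). (i, Suc j, k, l))" for z
  proof -
    obtain i j k l where z: "z = (i, j, k, l)" by (cases z)
    have "j = 0" using that by (cases j) (auto simp: z image_iff)
    then show ?thesis by (simp add: quad_term_def z)
  qed
  fix z :: "nat \<times> nat \<times> nat \<times> nat"
  obtain i j k l where z: "z = (i, j, k, l)" by (cases z)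
  have q: "quad_denom fls_X i (Suc j) k l = quad_denom fls_X i j k l * (1 - fls_X ^ (2 * Suc j) :: rat fls)"
    by (simp add: quad_denom_def qpoch_Suc power_mult[symmetric] power_add[symmetric] mult_ac)
  show "quad_term A B C D (case z of (i, j, k, l) \<Rightarrow> (i, Suc j, k, l)) -
      quad_term A (B + 2) C D (case z of (i, j, k, l) \<Rightarrow> (i, Suc j, k, l)) =
    qpow (12 + B) * quad_term (A + 12) (B + 24) (C + 16) (D + 8) z"
    unfolding quad_term_def z prod.case q times_divide_eq_right
    by (rule diff_frac[OF quad_denom_neq_0 one_minus_X_power_neq_0])
      (simp_all del: power_Suc of_nat_Suc flip: qpow_of_nat qpow_add,
       simp_all add: Qform_def algebra_simps power2_eq_square)
qed (auto simp: quads_def)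

lemma S_fps_rel_k:
  "S_fps A B C D - S_fps A B (C + 1) D =
    fps_X ^ 2 * fps_const (qpow (6 + C)) * S_fps (A + 8) (B + 16) (C + 12) (D + 6)"
proof (rule S_fps_shift[where sh = "\<lambda>(i, j, k, l). (i, j, Suc k, l)"])
  show "inj (\<lambda>(i, j, k, l). (i, j, Suc k, l))" by (auto simp: inj_def)
  show "quad_term A B C D z = quad_term A B (C + 1) D z"
    if "z \<notin> range (\<lambda>(i, j, k, l). (i, j, Suc k, l))" for z
  proof -
    obtain i j k l where z: "z = (i, j, k, l)" by (cases z)
    have "k = 0" using that by (cases k) (auto simp: z image_iff)
    then show ?thesis by (simp add: quad_term_def z)
  qed
  fix z :: "nat \<times> nat \<times> nat \<times> nat"
  obtain i j k l where z: "z = (i, j, k, l)" by (cases z)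
  have q: "quad_denom fls_X i j (Suc k) l = quad_denom fls_X i j k l * (1 - fls_X ^ (Suc k) :: rat fls)"
    by (simp add: quad_denom_def qpoch_Suc mult_ac)
  show "quad_term A B C D (case z of (i, j, k, l) \<Rightarrow> (i, j, Suc k, l)) -
      quad_term A B (C + 1) D (case z of (i, j, k, l) \<Rightarrow> (i, j, Suc k, l)) =
    qpow (6 + C) * quad_term (A + 8) (B + 16) (C + 12) (D + 6) z"
    unfolding quad_term_def z prod.case q times_divide_eq_right
    by (rule diff_frac[OF quad_denom_neq_0 one_minus_X_power_neq_0])
      (simp_all del: power_Suc of_nat_Suc flip: qpow_of_nat qpow_add,
       simp_all add: Qform_def algebra_simps power2_eq_square)
qed (auto simp: quads_def)

lemma S_fps_rel_l:
  "S_fps A B C D - S_fps A B C (D + 1) =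
    fps_X * fps_const (qpow (2 + D)) * S_fps (A + 4) (B + 8) (C + 6) (D + 4)"
proof -
  have "S_fps A B C D - S_fps A B C (D + 1) =
    fps_X ^ 1 * fps_const (qpow (2 + D)) * S_fps (A + 4) (B + 8) (C + 6) (D + 4)"
  proof (rule S_fps_shift[where sh = "\<lambda>(i, j, k, l). (i, j, k, Suc l)"])
    show "inj (\<lambda>(i, j, k, l). (i, j, k, Suc l))" by (auto simp: inj_def)
    show "quad_term A B C D z = quad_term A B C (D + 1) z"
      if "z \<notin> range (\<lambda>(i, j, k, l). (i, j, k, Suc l))" for z
    proof -
      obtain i j k l where z: "z = (i, j, k, l)" by (cases z)
      have "l = 0" using that by (cases l) (auto simp: z image_iff)
      then show ?thesis by (simp add: quad_term_def z)
    qed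
    fix z :: "nat \<times> nat \<times> nat \<times> nat"
    obtain i j k l where z: "z = (i, j, k, l)" by (cases z)
    have q: "quad_denom fls_X i j k (Suc l) = quad_denom fls_X i j k l * (1 - fls_X ^ (Suc l) :: rat fls)"
      by (simp add: quad_denom_def qpoch_Suc mult_ac)
    show "quad_term A B C D (case z of (i, j, k, l) \<Rightarrow> (i, j, k, Suc l)) -
        quad_term A B C (D + 1) (case z of (i, j, k, l) \<Rightarrow> (i, j, k, Suc l)) =
      qpow (2 + D) * quad_term (A + 4) (B + 8) (C + 6) (D + 4) z"
      unfolding quad_term_def z prod.case q times_divide_eq_right
      by (rule diff_frac[OF quad_denom_neq_0 one_minus_X_power_neq_0])
        (simp_all del: power_Suc of_nat_Suc flip: qpow_of_nat qpow_add,
         simp_all add: Qform_def algebra_simps power2_eq_square)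
  qed (auto simp: quads_def)
  then show ?thesis by simp
qed

text \<open>The certificates below write the three functional equations for the quadruple sums as linear
  combinations of the contiguity relations \<open>S_fps_rel_i\<close>, ..., \<open>S_fps_rel_l\<close>; they were found by solving
  a linear system. The variable \<open>s_m8_m12_m8_m4\<close> stands for \<open>S_fps (- 8) (- 12) (- 8) (- 4)\<close>.\<close>

lemma quad_cert_1:
  fixes x q :: "'a::idom"
  assumes "q \<noteq> 0" "x \<noteq> 0"
    and r0: "q^4 * (s_m8_m12_m8_m4 - s_m6_m12_m8_m4) = x^2 * s_0_0_0_0"
    and r1: "q^2 * (s_m6_m10_m8_m4 - s_m4_m10_m8_m4) = x^2 * s_2_2_0_0"
    and r2: "(s_m4_m6_m4_m2 - s_m2_m6_m4_m2) = x^2 * s_4_6_4_2"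
    and r3: "(s_m2_m2_m2_m1 - s_0_m2_m2_m1) = x^2 * q^2 * s_6_10_6_3"
    and r4: "(s_m6_m12_m8_m4 - s_m6_m10_m8_m4) = x^3 * s_6_12_8_4"
    and r5: "(s_m4_m10_m6_m3 - s_m4_m8_m6_m3) = x^3 * q^2 * s_8_14_10_5"
    and r6: "(s_m2_m6_m4_m2 - s_m2_m4_m4_m2) = x^3 * q^6 * s_10_18_12_6"
    and r7: "(s_m2_m4_m2_m1 - s_m2_m2_m2_m1) = x^3 * q^8 * s_10_20_14_7"
    and r8: "(s_2_2_2_1 - s_2_4_2_1) = x^3 * q^14 * s_14_26_18_9"
    and r9: "q^2 * (s_m4_m10_m8_m4 - s_m4_m10_m7_m4) = x^2 * s_4_6_4_2"
    and r10: "q * (s_m4_m10_m7_m3 - s_m4_m10_m6_m3) = x^2 * s_4_6_5_3"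
    and r11: "(s_m2_m4_m4_m2 - s_m2_m4_m3_m2) = x^2 * q^2 * s_6_12_8_4"
    and r12: "(s_m2_m4_m3_m1 - s_m2_m4_m2_m1) = x^2 * q^3 * s_6_12_9_5"
    and r13: "(s_0_m2_m2_m1 - s_0_m2_m1_m1) = x^2 * q^4 * s_8_14_10_5"
    and r14: "(s_2_2_0_0 - s_2_2_1_0) = x^2 * q^6 * s_10_18_12_6"
    and r15: "(s_2_2_1_1 - s_2_2_2_1) = x^2 * q^7 * s_10_18_13_7"
    and r16: "(s_2_4_2_1 - s_2_4_3_1) = x^2 * q^8 * s_10_20_14_7"
    and r17: "(s_6_10_6_3 - s_6_10_7_3) = x^2 * q^12 * s_14_26_18_9"
    and r18: "q^2 * (s_m4_m10_m7_m4 - s_m4_m10_m7_m3) = x * s_0_m2_m1_0"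
    and r19: "(s_m2_m4_m3_m2 - s_m2_m4_m3_m1) = x * s_2_4_3_2"
    and r20: "(s_0_m2_m1_m1 - s_0_m2_m1_0) = x * q * s_4_6_5_3"
    and r21: "(s_2_2_1_0 - s_2_2_1_1) = x * q^2 * s_6_10_7_4"
    and r22: "(s_2_4_3_1 - s_2_4_3_2) = x * q^3 * s_6_12_9_5"
    and r23: "(s_6_10_7_3 - s_6_10_7_4) = x * q^5 * s_10_18_13_7"
  shows "q^2 * (q^4 * s_m8_m12_m8_m4 - x * q^2 * s_m2_m4_m3_m2 - x^2 * s_0_0_0_0 - q^4 * s_m4_m8_m6_m3) = x * (q^4 * s_m4_m6_m4_m2 - x * q^4 * s_2_2_1_0 - x^2 * q^4 * s_4_6_4_2 - q^4 * s_0_m2_m2_m1) + x^2 * q^4 * s_4_6_4_2"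
proof -
  have "((q^2 * (q^4 * s_m8_m12_m8_m4 - x * q^2 * s_m2_m4_m3_m2 - x^2 * s_0_0_0_0 - q^4 * s_m4_m8_m6_m3)) - (x * (q^4 * s_m4_m6_m4_m2 - x * q^4 * s_2_2_1_0 - x^2 * q^4 * s_4_6_4_2 - q^4 * s_0_m2_m2_m1) + x^2 * q^4 * s_4_6_4_2)) =
    (q^2) * (q^4 * (s_m8_m12_m8_m4 - s_m6_m12_m8_m4) - x^2 * s_0_0_0_0) +
    (q^4) * (q^2 * (s_m6_m10_m8_m4 - s_m4_m10_m8_m4) - x^2 * s_2_2_0_0) +
    (0 - x * q^4) * ((s_m4_m6_m4_m2 - s_m2_m6_m4_m2) - x^2 * s_4_6_4_2) +
    (0 - x * q^4 - x * q^4) * ((s_m2_m2_m2_m1 - s_0_m2_m2_m1) - x^2 * q^2 * s_6_10_6_3) +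
    (q^6) * ((s_m6_m12_m8_m4 - s_m6_m10_m8_m4) - x^3 * s_6_12_8_4) +
    (q^6) * ((s_m4_m10_m6_m3 - s_m4_m8_m6_m3) - x^3 * q^2 * s_8_14_10_5) +
    (0 - x * q^4) * ((s_m2_m6_m4_m2 - s_m2_m4_m4_m2) - x^3 * q^6 * s_10_18_12_6) +
    (0 - x * q^4 - x * q^4) * ((s_m2_m4_m2_m1 - s_m2_m2_m2_m1) - x^3 * q^8 * s_10_20_14_7) +
    (x^2 * q^4 + x^2 * q^4) * ((s_2_2_2_1 - s_2_4_2_1) - x^3 * q^14 * s_14_26_18_9) +
    (q^4) * (q^2 * (s_m4_m10_m8_m4 - s_m4_m10_m7_m4) - x^2 * s_4_6_4_2) +
    (q^5) * (q * (s_m4_m10_m7_m3 - s_m4_m10_m6_m3) - x^2 * s_4_6_5_3) +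
    (0 - x * q^4) * ((s_m2_m4_m4_m2 - s_m2_m4_m3_m2) - x^2 * q^2 * s_6_12_8_4) +
    (0 - x * q^4 - x * q^4) * ((s_m2_m4_m3_m1 - s_m2_m4_m2_m1) - x^2 * q^3 * s_6_12_9_5) +
    (0 - x * q^4) * ((s_0_m2_m2_m1 - s_0_m2_m1_m1) - x^2 * q^4 * s_8_14_10_5) +
    (x^2 * q^4) * ((s_2_2_0_0 - s_2_2_1_0) - x^2 * q^6 * s_10_18_12_6) +
    (x^2 * q^4 + x^2 * q^4) * ((s_2_2_1_1 - s_2_2_2_1) - x^2 * q^7 * s_10_18_13_7) +
    (x^2 * q^4 + x^2 * q^4) * ((s_2_4_2_1 - s_2_4_3_1) - x^2 * q^8 * s_10_20_14_7) +
    (0 - x^3 * q^6 - x^3 * q^6) * ((s_6_10_6_3 - s_6_10_7_3) - x^2 * q^12 * s_14_26_18_9) +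
    (q^4) * (q^2 * (s_m4_m10_m7_m4 - s_m4_m10_m7_m3) - x * s_0_m2_m1_0) +
    (0 - x * q^4 - x * q^4) * ((s_m2_m4_m3_m2 - s_m2_m4_m3_m1) - x * s_2_4_3_2) +
    (0 - x * q^4) * ((s_0_m2_m1_m1 - s_0_m2_m1_0) - x * q * s_4_6_5_3) +
    (x^2 * q^4 + x^2 * q^4) * ((s_2_2_1_0 - s_2_2_1_1) - x * q^2 * s_6_10_7_4) +
    (x^2 * q^4 + x^2 * q^4) * ((s_2_4_3_1 - s_2_4_3_2) - x * q^3 * s_6_12_9_5) +
    (0 - x^3 * q^6 - x^3 * q^6) * ((s_6_10_7_3 - s_6_10_7_4) - x * q^5 * s_10_18_13_7)"
    by algebra
  also have "\<dots> = 0"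
    unfolding r0 r1 r2 r3 r4 r5 r6 r7 r8 r9 r10 r11 r12 r13 r14 r15 r16 r17 r18 r19 r20 r21 r22 r23 by simp
  finally show ?thesis using assms(1,2) by simp
qed

lemma quad_cert_2:
  fixes x q :: "'a::idom"
  assumes "q \<noteq> 0" "x \<noteq> 0"
    and r0: "(s_0_m2_m2_m1 - s_2_m2_m2_m1) = x^2 * q^4 * s_8_10_6_3"
    and r1: "(s_0_0_m1_m1 - s_2_0_m1_m1) = x^2 * q^4 * s_8_12_7_3"
    and r2: "(s_0_0_0_0 - s_2_0_0_0) = x^2 * q^4 * s_8_12_8_4"
    and r3: "(s_2_4_2_1 - s_4_4_2_1) = x^2 * q^6 * s_10_16_10_5"
    and r4: "(s_0_m2_m1_m1 - s_0_0_m1_m1) = x^3 * q^10 * s_12_22_15_7"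
    and r5: "(s_2_m2_m1_m1 - s_2_0_m1_m1) = x^3 * q^10 * s_14_22_15_7"
    and r6: "(s_2_2_2_1 - s_2_4_2_1) = x^3 * q^14 * s_14_26_18_9"
    and r7: "(s_4_4_3_1 - s_4_6_3_1) = x^3 * q^16 * s_16_28_19_9"
    and r8: "(s_6_8_6_3 - s_6_10_6_3) = x^3 * q^20 * s_18_32_22_11"
    and r9: "(s_0_m2_m2_m1 - s_0_m2_m1_m1) = x^2 * q^4 * s_8_14_10_5"
    and r10: "(s_2_m2_m2_m1 - s_2_m2_m1_m1) = x^2 * q^4 * s_10_14_10_5"
    and r11: "(s_2_0_m1_m1 - s_2_0_0_m1) = x^2 * q^5 * s_10_16_11_5"
    and r12: "(s_2_2_1_1 - s_2_2_2_1) = x^2 * q^7 * s_10_18_13_7"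
    and r13: "(s_4_4_2_1 - s_4_4_3_1) = x^2 * q^8 * s_12_20_14_7"
    and r14: "(s_4_6_3_1 - s_4_6_4_1) = x^2 * q^9 * s_12_22_15_7"
    and r15: "(s_6_8_5_3 - s_6_8_6_3) = x^2 * q^11 * s_14_24_17_9"
    and r16: "(s_6_10_6_3 - s_6_10_7_3) = x^2 * q^12 * s_14_26_18_9"
    and r17: "(s_8_12_7_3 - s_8_12_8_3) = x^2 * q^13 * s_16_28_19_9"
    and r18: "(s_10_14_9_5 - s_10_14_10_5) = x^2 * q^15 * s_18_30_21_11"
    and r19: "(s_10_16_10_5 - s_10_16_11_5) = x^2 * q^16 * s_18_32_22_11"
    and r20: "(s_2_0_0_m1 - s_2_0_0_0) = x * q * s_6_8_6_3"
    and r21: "(s_2_2_1_0 - s_2_2_1_1) = x * q^2 * s_6_10_7_4"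
    and r22: "(s_4_6_4_1 - s_4_6_4_2) = x * q^3 * s_8_14_10_5"
    and r23: "(s_6_8_5_2 - s_6_8_5_3) = x * q^4 * s_10_16_11_6"
    and r24: "(s_6_10_7_3 - s_6_10_7_4) = x * q^5 * s_10_18_13_7"
    and r25: "(s_8_12_8_3 - s_8_12_8_4) = x * q^5 * s_12_20_14_7"
    and r26: "(s_10_14_9_4 - s_10_14_9_5) = x * q^6 * s_14_22_15_8"
    and r27: "(s_10_16_11_5 - s_10_16_11_6) = x * q^7 * s_14_24_17_9"
    and r28: "(s_14_22_15_7 - s_14_22_15_8) = x * q^9 * s_18_30_21_11"
  shows "(s_0_m2_m2_m1 - s_0_0_0_0 + s_2_2_1_0) = (x * q + x * q^2) * (s_4_4_2_1 - s_4_6_4_2 + s_6_8_5_2) + x * q^3 * (1 - x * q^2) * (s_8_10_6_3 - s_8_12_8_4 + s_10_14_9_4) + s_4_6_4_2"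
proof -
  \<comment> \<open>The combination produces q x times the difference of the two sides, and q x is
    cancelled at the end.\<close>
  have "q * x * (((s_0_m2_m2_m1 - s_0_0_0_0 + s_2_2_1_0)) - ((x * q + x * q^2) * (s_4_4_2_1 - s_4_6_4_2 + s_6_8_5_2) + x * q^3 * (1 - x * q^2) * (s_8_10_6_3 - s_8_12_8_4 + s_10_14_9_4) + s_4_6_4_2)) =
    (1 - x * q^2) * ((s_0_m2_m2_m1 - s_2_m2_m2_m1) - x^2 * q^4 * s_8_10_6_3) +
    (0 - 1 + x * q + x * q^2) * ((s_0_0_m1_m1 - s_2_0_m1_m1) - x^2 * q^4 * s_8_12_7_3) +
    (0 - x * q) * ((s_0_0_0_0 - s_2_0_0_0) - x^2 * q^4 * s_8_12_8_4) +
    (x * q) * ((s_2_4_2_1 - s_4_4_2_1) - x^2 * q^6 * s_10_16_10_5) +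
    (0 - 1 + x * q + x * q^2) * ((s_0_m2_m1_m1 - s_0_0_m1_m1) - x^3 * q^10 * s_12_22_15_7) +
    (1 - x * q^2) * ((s_2_m2_m1_m1 - s_2_0_m1_m1) - x^3 * q^10 * s_14_22_15_7) +
    (x * q) * ((s_2_2_2_1 - s_2_4_2_1) - x^3 * q^14 * s_14_26_18_9) +
    (x * q - x^2 * q^2 - x^2 * q^3) * ((s_4_4_3_1 - s_4_6_3_1) - x^3 * q^16 * s_16_28_19_9) +
    (0 - x^2 * q^3) * ((s_6_8_6_3 - s_6_10_6_3) - x^3 * q^20 * s_18_32_22_11) +
    (0 - 1 + x * q + x * q^2) * ((s_0_m2_m2_m1 - s_0_m2_m1_m1) - x^2 * q^4 * s_8_14_10_5) +
    (1 - x * q^2) * ((s_2_m2_m2_m1 - s_2_m2_m1_m1) - x^2 * q^4 * s_10_14_10_5) +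
    (x * q) * ((s_2_0_m1_m1 - s_2_0_0_m1) - x^2 * q^5 * s_10_16_11_5) +
    (x * q) * ((s_2_2_1_1 - s_2_2_2_1) - x^2 * q^7 * s_10_18_13_7) +
    (x * q - x^2 * q^2 - x^2 * q^3) * ((s_4_4_2_1 - s_4_4_3_1) - x^2 * q^8 * s_12_20_14_7) +
    (x * q - x^2 * q^2 - x^2 * q^3) * ((s_4_6_3_1 - s_4_6_4_1) - x^2 * q^9 * s_12_22_15_7) +
    (0 - x^2 * q^2 - x^2 * q^3) * ((s_6_8_5_3 - s_6_8_6_3) - x^2 * q^11 * s_14_24_17_9) +
    (0 - x^2 * q^3) * ((s_6_10_6_3 - s_6_10_7_3) - x^2 * q^12 * s_14_26_18_9) +
    (0 - x^2 * q^4 + x^3 * q^5 + x^3 * q^6) * ((s_8_12_7_3 - s_8_12_8_3) - x^2 * q^13 * s_16_28_19_9) +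
    (0 - x^2 * q^4 + x^3 * q^6) * ((s_10_14_9_5 - s_10_14_10_5) - x^2 * q^15 * s_18_30_21_11) +
    (x^3 * q^7) * ((s_10_16_10_5 - s_10_16_11_5) - x^2 * q^16 * s_18_32_22_11) +
    (x * q) * ((s_2_0_0_m1 - s_2_0_0_0) - x * q * s_6_8_6_3) +
    (x * q) * ((s_2_2_1_0 - s_2_2_1_1) - x * q^2 * s_6_10_7_4) +
    (x * q - x^2 * q^2 - x^2 * q^3) * ((s_4_6_4_1 - s_4_6_4_2) - x * q^3 * s_8_14_10_5) +
    (0 - x^2 * q^2 - x^2 * q^3) * ((s_6_8_5_2 - s_6_8_5_3) - x * q^4 * s_10_16_11_6) +
    (0 - x^2 * q^3) * ((s_6_10_7_3 - s_6_10_7_4) - x * q^5 * s_10_18_13_7) +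
    (0 - x^2 * q^4 + x^3 * q^5 + x^3 * q^6) * ((s_8_12_8_3 - s_8_12_8_4) - x * q^5 * s_12_20_14_7) +
    (0 - x^2 * q^4 + x^3 * q^6) * ((s_10_14_9_4 - s_10_14_9_5) - x * q^6 * s_14_22_15_8) +
    (x^3 * q^6 + x^3 * q^7) * ((s_10_16_11_5 - s_10_16_11_6) - x * q^7 * s_14_24_17_9) +
    (x^3 * q^10 - x^4 * q^12) * ((s_14_22_15_7 - s_14_22_15_8) - x * q^9 * s_18_30_21_11)"
    by algebra
  also have "\<dots> = 0"
    unfolding r0 r1 r2 r3 r4 r5 r6 r7 r8 r9 r10 r11 r12 r13 r14 r15 r16 r17 r18 r19 r20 r21 r22 r23 r24 r25 r26 r27 r28 by simp
  finally show ?thesis using assms(1,2) by simp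
qed

lemma quad_cert_3:
  fixes x q :: "'a::idom"
  assumes "q \<noteq> 0" "x \<noteq> 0"
    and r0: "(s_8_14_9_5 - s_10_14_9_5) = x^2 * q^12 * s_16_26_17_9"
    and r1: "(s_12_22_15_8 - s_14_22_15_8) = x^2 * q^16 * s_20_34_23_12"
    and r2: "(s_4_4_3_1 - s_4_6_3_1) = x^3 * q^16 * s_16_28_19_9"
    and r3: "(s_8_10_7_3 - s_8_12_7_3) = x^3 * q^22 * s_20_34_23_11"
    and r4: "(s_4_4_2_1 - s_4_4_3_1) = x^2 * q^8 * s_12_20_14_7"
    and r5: "(s_4_6_3_2 - s_4_6_4_2) = x^2 * q^9 * s_12_22_15_8"
    and r6: "(s_8_10_6_3 - s_8_10_7_3) = x^2 * q^12 * s_16_26_18_9"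
    and r7: "(s_8_12_7_3 - s_8_12_8_3) = x^2 * q^13 * s_16_28_19_9"
    and r8: "(s_16_26_17_9 - s_16_26_18_9) = x^2 * q^23 * s_24_42_29_15"
    and r9: "(s_4_6_3_1 - s_4_6_3_2) = x * q^3 * s_8_14_9_5"
    and r10: "(s_8_12_8_3 - s_8_12_8_4) = x * q^5 * s_12_20_14_7"
    and r11: "(s_10_14_9_4 - s_10_14_9_5) = x * q^6 * s_14_22_15_8"
    and r12: "(s_20_34_23_11 - s_20_34_23_12) = x * q^13 * s_24_42_29_15"
  shows "q^4 * (s_0_0_0_0 - s_4_6_4_2 - x * q^2 * ((s_4_4_2_1 - s_4_6_4_2 + s_6_8_5_2) - x * q^3 * (s_8_10_6_3 - s_8_12_8_4 + s_10_14_9_4)) - x^2 * q^4 * s_8_12_8_4 - x * q^3 * (s_8_10_6_3 - s_8_12_8_4 + s_10_14_9_4)) = (q^4 * s_0_0_0_0 - x * q^6 * s_6_8_5_2 - x^2 * q^8 * s_8_12_8_4 - q^4 * s_4_4_2_1)"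
proof -
  have "((q^4 * (s_0_0_0_0 - s_4_6_4_2 - x * q^2 * ((s_4_4_2_1 - s_4_6_4_2 + s_6_8_5_2) - x * q^3 * (s_8_10_6_3 - s_8_12_8_4 + s_10_14_9_4)) - x^2 * q^4 * s_8_12_8_4 - x * q^3 * (s_8_10_6_3 - s_8_12_8_4 + s_10_14_9_4))) - ((q^4 * s_0_0_0_0 - x * q^6 * s_6_8_5_2 - x^2 * q^8 * s_8_12_8_4 - q^4 * s_4_4_2_1))) =
    (x * q^7 - x^2 * q^9) * ((s_8_14_9_5 - s_10_14_9_5) - x^2 * q^12 * s_16_26_17_9) +
    (x^2 * q^13 - x^3 * q^15) * ((s_12_22_15_8 - s_14_22_15_8) - x^2 * q^16 * s_20_34_23_12) +
    (q^4 - x * q^6) * ((s_4_4_3_1 - s_4_6_3_1) - x^3 * q^16 * s_16_28_19_9) +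
    (0 - x * q^7 + x^2 * q^9) * ((s_8_10_7_3 - s_8_12_7_3) - x^3 * q^22 * s_20_34_23_11) +
    (q^4 - x * q^6) * ((s_4_4_2_1 - s_4_4_3_1) - x^2 * q^8 * s_12_20_14_7) +
    (q^4 - x * q^6) * ((s_4_6_3_2 - s_4_6_4_2) - x^2 * q^9 * s_12_22_15_8) +
    (0 - x * q^7 + x^2 * q^9) * ((s_8_10_6_3 - s_8_10_7_3) - x^2 * q^12 * s_16_26_18_9) +
    (0 - x * q^7 + x^2 * q^9) * ((s_8_12_7_3 - s_8_12_8_3) - x^2 * q^13 * s_16_28_19_9) +
    (x^3 * q^19 - x^4 * q^21) * ((s_16_26_17_9 - s_16_26_18_9) - x^2 * q^23 * s_24_42_29_15) +
    (q^4 - x * q^6) * ((s_4_6_3_1 - s_4_6_3_2) - x * q^3 * s_8_14_9_5) +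
    (0 - x * q^7 + x^2 * q^9) * ((s_8_12_8_3 - s_8_12_8_4) - x * q^5 * s_12_20_14_7) +
    (0 - x * q^7 + x^2 * q^9) * ((s_10_14_9_4 - s_10_14_9_5) - x * q^6 * s_14_22_15_8) +
    (0 - x^4 * q^29 + x^5 * q^31) * ((s_20_34_23_11 - s_20_34_23_12) - x * q^13 * s_24_42_29_15)"
    by algebra
  also have "\<dots> = 0"
    unfolding r0 r1 r2 r3 r4 r5 r6 r7 r8 r9 r10 r11 r12 by simp
  finally show ?thesis using assms(1,2) by simp
qed

section \<open>Nandi's partitions\<close>

definition bad :: "nat list \<Rightarrow> bool" where
  "bad s \<longleftrightarrow> (\<exists>ds \<in> {[1], [0,0], [0,2], [2,0], [0,3]}. diff_cond ds s) \<or>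
     odd (sum_list s) \<and>
       (\<exists>ds \<in> {[3,0], [0,4], [4,0]} \<union> {3 # replicate n 2 @ [3,0] | n. True}. diff_cond ds s)"

lemma N_set_altdef: "p \<in> N_set \<longleftrightarrow> is_partition p \<and> (\<forall>s. sublist s p \<longrightarrow> \<not> bad s)"
  unfolding N_set_def bad_def mem_Collect_eq by blast

lemma N_set_partition: "p \<in> N_set \<Longrightarrow> is_partition p"
  by (simp add: N_set_altdef)

lemma N_set_sublist: "p \<in> N_set \<Longrightarrow> sublist s p \<Longrightarrow> \<not> bad s"
  by (simp add: N_set_altdef)

definition bump :: "nat list \<Rightarrow> nat list" where
  "bump p = map (\<lambda>a. a + 2) p"

lemma bump_simps [simp]:
  "bump [] = []" "bump (a # p) = (a + 2) # bump p" "bump (p @ q) = bump p @ bump q"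
  "length (bump p) = length p" "bump p = [] \<longleftrightarrow> p = []"
  by (auto simp: bump_def)

lemma bump_inject [simp]: "bump p = bump q \<longleftrightarrow> p = q"
  unfolding bump_def by (rule inj_map_eq_map) (auto simp: inj_def)

lemma sum_list_bump: "sum_list (bump p) = sum_list p + 2 * length p"
  by (induction p) auto

lemma diff_cond_bump: "diff_cond ds (bump s) \<longleftrightarrow> diff_cond ds s"
  by (auto simp: diff_cond_def bump_def)

text \<open>Adding 2 to all parts keeps the differences and changes the weight by an even number, so
  it preserves the parity condition too.\<close>

lemma bad_bump: "bad (bump s) \<longleftrightarrow> bad s"
  by (simp add: bad_def diff_cond_bump sum_list_bump)

lemma diff_cond_Nil: "diff_cond [] p \<longleftrightarrow> (\<exists>a. p = [a])"
  by (auto simp: diff_cond_def length_Suc_conv)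

lemma diff_cond_Cons: "diff_cond (d # ds) p \<longleftrightarrow> (\<exists>a b q. p = a # b # q \<and> a = b + d \<and> diff_cond ds (b # q))"
  by (cases p; cases "tl p") (auto simp: diff_cond_def All_less_Suc2)

text \<open>The list a + 2(n-1), ..., a + 2, a, that is, the run produced by the differences
  2*.\<close>

definition stair :: "nat \<Rightarrow> nat \<Rightarrow> nat list" where
  "stair a n = rev (map (\<lambda>i. a + 2 * i) [0..<n])"

lemma stair_0 [simp]: "stair a 0 = []"
  by (simp add: stair_def)

lemma stair_Suc: "stair a (Suc n) = (a + 2 * n) # stair a n"
  by (simp add: stair_def)

lemma stair_Suc': "stair a (Suc n) = stair (a + 2) n @ [a]"
  by (induction n) (auto simp: stair_Suc)

lemma bump_stair: "bump (stair a n) = stair (a + 2) n"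
  by (induction n) (auto simp: stair_Suc)

lemma stair_eq_Nil [simp]: "stair a n = [] \<longleftrightarrow> n = 0"
  by (simp add: stair_def)

lemma diff_cond_stair:
  "diff_cond (replicate n 2 @ [3, 0]) s \<longleftrightarrow> (\<exists>a. s = stair (a + 3) (Suc n) @ [a, a])"
proof (induction n arbitrary: s)
  case 0
  show ?case by (auto simp: diff_cond_Cons diff_cond_Nil stair_Suc)
next
  case (Suc n)
  show ?case
    by (auto simp: diff_cond_Cons Suc.IH stair_Suc)
qed

lemma bad_iff:
  "bad s \<longleftrightarrow> (\<exists>b. s = [b + 1, b] \<or> s = [b, b, b] \<or> s = [b + 2, b + 2, b] \<or> s = [b + 2, b, b] \<or>
       s = [b + 3, b + 3, b]) \<or>
     odd (sum_list s) \<and>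
       (\<exists>b. s = [b + 3, b, b] \<or> s = [b + 4, b + 4, b] \<or> s = [b + 4, b, b] \<or>
         (\<exists>n. s = (b + 2 * n + 6) # stair (b + 3) (Suc n) @ [b, b]))"
proof -
  have long: "(\<exists>ds \<in> {3 # replicate n 2 @ [3,0] | n. True}. diff_cond ds s) \<longleftrightarrow>
     (\<exists>b n. s = (b + 2 * n + 6) # stair (b + 3) (Suc n) @ [b, b])"
    by (auto simp: diff_cond_Cons diff_cond_stair stair_Suc)
  have short: "(\<exists>ds \<in> {[1], [0,0], [0,2], [2,0], [0,3]}. diff_cond ds s) \<longleftrightarrow>
      (\<exists>b. s = [b + 1, b] \<or> s = [b, b, b] \<or> s = [b + 2, b + 2, b] \<or> s = [b + 2, b, b] \<or>
       s = [b + 3, b + 3, b])"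
    by (simp add: diff_cond_Cons diff_cond_Nil) (fastforce simp: add.commute)
  have odds: "(\<exists>ds \<in> {[3,0], [0,4], [4,0]}. diff_cond ds s) \<longleftrightarrow>
      (\<exists>b. s = [b + 3, b, b] \<or> s = [b + 4, b + 4, b] \<or> s = [b + 4, b, b])"
    by (simp add: diff_cond_Cons diff_cond_Nil) blast
  show ?thesis
    unfolding bad_def bex_Un long short odds by blast
qed

lemma bump_snoc_eq: "bump t = q @ [c] \<longleftrightarrow> (\<exists>t' a. t = t' @ [a] \<and> bump t' = q \<and> c = a + 2)"
  by (cases t rule: rev_cases) auto

lemma eq_snoc_Cons: "t @ [a] = b # r \<longleftrightarrow> (t = [] \<and> a = b \<and> r = []) \<or> (\<exists>t'. t = b # t' \<and> r = t' @ [a])"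
  by (cases t) auto

lemma bump_eq_Cons: "bump t = c # r \<longleftrightarrow> (\<exists>a t'. t = a # t' \<and> c = a + 2 \<and> bump t' = r)"
  by (cases t) auto

lemma append_two_eq: "p @ [a, b] = q @ [c, d] \<longleftrightarrow> p = q \<and> a = c \<and> b = d"
  by auto

text \<open>All parts of \<open>bump t\<close> are at least 3, so a pattern ending in difference 0
  cannot end at the new part; [1], [0, 2], [0, 3] and [0, 4] remain. The last one has weight 3c + 8,
  which is odd for c = 1 only.\<close>

lemma bad_bump_snoc:
  assumes "0 \<notin> set t" "c \<le> 2" "c \<ge> 1"
  shows "bad (bump t @ [c]) \<longleftrightarrow>
    (if c = 2 then t \<in> {[1], [2, 2], [3, 3]} else t \<in> {[1, 1], [2, 2], [3, 3]})"
proof -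
  have "bump t @ [c] \<noteq> (b # q) @ [a, a]" for q a b
  proof
    assume "bump t @ [c] = (b # q) @ [a, a]"
    then have "bump t @ [c] = ((b # q) @ [a]) @ [a]" by simp
    then have "bump t = (b # q) @ [a]" "a = c" by (simp_all only: append1_eq_conv)
    then obtain z where "z \<in> set t" "a = z + 2" unfolding bump_snoc_eq by auto
    with assms \<open>a = c\<close> show False by auto
  qed
  then have long: "bump t @ [c] = b # q @ [a, a] \<longleftrightarrow> False" for q a b by simp
  have c: "c = 1 \<or> c = 2" using assms by auto
  have short: "bump t @ [c] = [x, y] \<longleftrightarrow> (\<exists>a. t = [a] \<and> x = a + 2 \<and> y = c)"
    "bump t @ [c] = [x, y, z] \<longleftrightarrow> (\<exists>a b. t = [a, b] \<and> x = a + 2 \<and> y = b + 2 \<and> z = c)" for x y z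
    by (auto simp: eq_snoc_Cons bump_eq_Cons)
  have "bad (bump t @ [c]) \<longleftrightarrow>
      t = [c - 1] \<and> c = 2 \<or> t = [c, c] \<or> t = [c + 1, c + 1] \<or> c = 1 \<and> t = [c + 2, c + 2]"
    unfolding bad_iff short long
    using c assms(1) by (elim disjE) (auto simp: sum_list_bump)
  then show ?thesis using c by auto
qed

text \<open>Here the pattern must end in difference 0. For [1, 1], positivity and parity leave
  [2, 0], [4, 0] and the long pattern, which turns into the staircase excluded in
  \<open>N3_set\<close>. For [2, 2], every surviving pattern forces the last part of t to be 2 or 3,
  so that a condition on this part disposes of the long pattern as well.\<close>

lemma bad_bump_snoc2:
  assumes "0 \<notin> set t" "t \<noteq> []"
  shows "t \<in> {[2], [3]} \<Longrightarrow> bad (bump t @ [2, 2])"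
    "bad (bump t @ [2, 2]) \<Longrightarrow> last t \<in> {2, 3}"
    "bad (bump t @ [1, 1]) \<longleftrightarrow> t \<in> {[1], [3]} \<or> (\<exists>k\<ge>1. t = (2 * k + 3) # stair 2 k)"
proof -
  have ap: "bump t @ [c, c] = b # q @ [a, a] \<longleftrightarrow> bump t = b # q \<and> a = c" for b c a q
    using append_two_eq[of "bump t" c c "b # q" a a] by auto
  have tri: "bump t @ [c, c] = [a, b, d] \<longleftrightarrow> bump t = [a] \<and> b = c \<and> d = c" for a b c d
    using append_two_eq[of "bump t" c c "[a]" b d] by auto
  have two: "bump t @ [c, c] = [a, b] \<longleftrightarrow> False" for a b c
    using assms(2) by (cases t) auto
  have st: "bump t = x # stair (y + 2) n \<longleftrightarrow> (\<exists>z. x = z + 2 \<and> t = z # stair y n)" for x y n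
    unfolding bump_eq_Cons bump_stair[symmetric] by auto
  show "t \<in> {[2], [3]} \<Longrightarrow> bad (bump t @ [2, 2])"
    unfolding bad_iff ap tri two by auto
  have last: "last (bump t) = last t + 2" using assms(2) by (simp add: bump_def last_map)
  show "last t \<in> {2, 3}" if "bad (bump t @ [2, 2])"
  proof -
    have "bump t = [2] \<or> bump t = [4] \<or> bump t = [5] \<or> (\<exists>n x. bump t = x # stair 5 (Suc n))"
      using that assms(1) unfolding bad_iff ap tri two by (auto simp: sum_list_bump bump_eq_Cons)
    then show ?thesis using last assms(1) by (auto simp: stair_Suc' bump_eq_Cons)
  qed
  have "(\<exists>k\<ge>1. t = (2 * k + 3) # stair 2 k) \<longleftrightarrow>
      odd (sum_list (bump t @ [1, 1])) \<and> (\<exists>b n. bump t = (b + 2 * n + 6) # stair (b + 3) (Suc n) \<and> b = 1)"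
    (is "?L = ?R")
  proof
    assume ?L
    then obtain k where k: "k \<ge> 1" "t = (2 * k + 3) # stair 2 k" by blast
    have "even (sum_list (stair 4 k))" by (induction k) (auto simp: stair_Suc)
    then show ?R using k by (cases k) (auto simp: sum_list_bump bump_stair)
  next
    assume ?R
    then obtain n where "bump t = (2 * n + 7) # stair (2 + 2) (Suc n)" by auto
    then have "t = (2 * Suc n + 3) # stair 2 (Suc n)" unfolding st by auto
    then show ?L by (intro exI[of _ "Suc n"]) auto
  qed
  moreover have "bad (bump t @ [1, 1])" if "t = [1] \<or> t = [3]"
    using that by (auto simp: bad_iff)
  moreover have "bad (bump t @ [1, 1])"
    if "odd (sum_list (bump t @ [1, 1]))" "bump t = (b + 2 * n + 6) # stair (b + 3) (Suc n)" "b = 1" for b n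
    unfolding bad_iff ap tri two using that by blast
  moreover have "t = [1] \<or> t = [3] \<or> odd (sum_list (bump t @ [1, 1])) \<and>
      (\<exists>b n. bump t = (b + 2 * n + 6) # stair (b + 3) (Suc n) \<and> b = 1)" if "bad (bump t @ [1, 1])"
  proof -
    have "bump t = [1 + 2] \<or> bump t = [1 + 4] \<or> bump t = [1 + 0] \<or> odd (sum_list (bump t @ [1, 1])) \<and>
      ((\<exists>b n. bump t = (b + 2 * n + 6) # stair (b + 3) (Suc n) \<and> b = 1) \<or> bump t = [1 + 3])"
      using that unfolding bad_iff ap tri two by auto
    then show ?thesis using assms(1) by (auto simp: bump_eq_Cons sum_list_bump)
  qed
  ultimately show "bad (bump t @ [1, 1]) \<longleftrightarrow> t \<in> {[1], [3]} \<or> (\<exists>k\<ge>1. t = (2 * k + 3) # stair 2 k)"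
    by blast
qed

lemma sublist_bump: "sublist s (bump p) \<longleftrightarrow> (\<exists>s'. s = bump s' \<and> sublist s' p)"
proof
  assume "sublist s (bump p)"
  then obtain u v where "bump p = u @ s @ v" by (auto simp: sublist_def)
  then obtain u' s' v' where "p = u' @ s' @ v'" "s = bump s'"
    by (auto simp: bump_def map_eq_append_conv append_eq_map_conv)
  then show "\<exists>s'. s = bump s' \<and> sublist s' p" by (auto simp: sublist_def)
next
  assume "\<exists>s'. s = bump s' \<and> sublist s' p"
  then obtain s' u v where "s = bump s'" "p = u @ s' @ v" by (auto simp: sublist_def)
  then have "bump p = bump u @ s @ bump v" by simp
  then show "sublist s (bump p)" unfolding sublist_def by blast
qed

lemma suffix_bump: "suffix s (bump p) \<longleftrightarrow> (\<exists>s'. s = bump s' \<and> suffix s' p)"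
proof
  assume "suffix s (bump p)"
  then obtain u where "bump p = u @ s" by (auto simp: suffix_def)
  then obtain u' s' where "p = u' @ s'" "s = bump s'"
    by (auto simp: bump_def map_eq_append_conv append_eq_map_conv)
  then show "\<exists>s'. s = bump s' \<and> suffix s' p" by (auto simp: suffix_def)
qed (auto simp: suffix_def)

text \<open>The possible tails of parts at most 2 of a partition in \<open>N_set\<close>; the other parts form a list
  \<open>bump p\<close> with \<open>p\<close> again in \<open>N_set\<close>.\<close>

definition letters :: "nat list set" where
  "letters = {[], [2], [2, 2], [1], [1, 1]}"

section \<open>Attaching a tail of parts at most two\<close>

lemma is_partition_bump_append:
  assumes "0 \<notin> set p" "w \<in> letters"
  shows "is_partition (bump p @ w) \<longleftrightarrow> is_partition p"
  using assms unfolding is_partition_def letters_def bump_def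
  by (auto simp: sorted_wrt_append sorted_wrt_map)

lemma not_bad_letter:
  assumes "w \<in> letters" "sublist s w"
  shows "\<not> bad s"
proof -
  have "set s \<subseteq> set w" "length s \<le> length w"
    using assms(2) by (auto dest: set_mono_sublist sublist_length_le)
  then have "length s \<le> 2" "set s \<subseteq> {1} \<or> set s \<subseteq> {2}" using assms(1) by (auto simp: letters_def)
  then show ?thesis by (auto simp: bad_iff)
qed

text \<open>A contiguous piece of a concatenation lies in \<open>bump p\<close>, lies in w, or
  straddles the border. The first kind is governed by p, the second is harmless by
  \<open>not_bad_letter\<close>, so only the straddling pieces give conditions.\<close>

lemma bump_append_in_N_set:
  assumes "0 \<notin> set p" "w \<in> letters"
  shows "bump p @ w \<in> N_set \<longleftrightarrow>
    p \<in> N_set \<and> (\<forall>t v. suffix t p \<and> t \<noteq> [] \<and> prefix v w \<and> v \<noteq> [] \<longrightarrow> \<not> bad (bump t @ v))"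
proof -
  have "(\<forall>s. sublist s (bump p @ w) \<longrightarrow> \<not> bad s) \<longleftrightarrow>
     (\<forall>s. sublist s p \<longrightarrow> \<not> bad s) \<and>
     (\<forall>t v. suffix t p \<and> t \<noteq> [] \<and> prefix v w \<and> v \<noteq> [] \<longrightarrow> \<not> bad (bump t @ v))" (is "?L \<longleftrightarrow> ?R")
  proof
    assume L: ?L
    show ?R
    proof (intro conjI allI impI)
      fix s assume "sublist s p"
      then have "sublist (bump s) (bump p @ w)" by (auto simp: sublist_append sublist_bump)
      then show "\<not> bad s" using L bad_bump by blast
    next
      fix t v assume "suffix t p \<and> t \<noteq> [] \<and> prefix v w \<and> v \<noteq> []"
      then have "sublist (bump t @ v) (bump p @ w)"
        unfolding sublist_append suffix_bump by blast
      then show "\<not> bad (bump t @ v)" using L by blast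
    qed
  next
    assume R: ?R
    show ?L
    proof (intro allI impI)
      fix s assume "sublist s (bump p @ w)"
      then consider s' where "s = bump s'" "sublist s' p" | "sublist s w"
        | t v where "s = bump t @ v" "suffix t p" "prefix v w"
        unfolding sublist_append suffix_bump sublist_bump by blast
      then show "\<not> bad s"
      proof cases
        case 1
        then show ?thesis using R bad_bump by blast
      next
        case 2
        then show ?thesis using assms not_bad_letter by blast
      next
        case 3
        show ?thesis
        proof (cases "t = [] \<or> v = []")
          case True
          then show ?thesis
            using 3 R assms not_bad_letter[of w v] bad_bump[of t]
            by (auto simp: suffix_imp_sublist prefix_imp_sublist)
        qed (use 3 R in blast)
      qed
    qed
  qed
  then show ?thesis
    unfolding N_set_altdef is_partition_bump_append[OF assms] by blast
qed

lemma sorted_decomp_3: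
  assumes "is_partition p"
  shows "p = filter (\<lambda>b. b > 3) p @ replicate (count_list p 3) 3 @ replicate (count_list p 2) 2 @
    replicate (count_list p 1) 1"
  using assms
proof (induction p)
  case (Cons a p)
  have part: "is_partition p" and le: "\<forall>b\<in>set p. b \<le> a" "0 \<notin> set p" and "a \<noteq> 0"
    using Cons.prems by (auto simp: is_partition_def)
  have IH: "filter (\<lambda>b. b > 3) p @ replicate (count_list p 3) 3 @ replicate (count_list p 2) 2 @
    replicate (count_list p 1) 1 = p" by (rule Cons.IH[OF part, symmetric])
  have ge: "count_list p b = 0" if "b > a" for b using le that by (intro count_notin) force
  have F: "filter (\<lambda>b. b > 3) p = []" if "a \<le> 3" using le that by (auto simp: filter_empty_conv)
  consider "a > 3" | "a = 3" | "a = 2" | "a = 1" using \<open>a \<noteq> 0\<close> by linarith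
  then show ?case
  proof cases
    case 1
    then show ?thesis using IH by simp
  next
    case 2
    then show ?thesis using IH F by simp
  next
    case 3
    then show ?thesis using IH F ge[of 3] by simp
  next
    case 4
    then show ?thesis using IH F ge[of 3] ge[of 2] by simp
  qed
qed simp

text \<open>[2, 1] and [3, 2] violate the condition [1], three equal parts violate [0, 0], and
  [3, 3, 1] violates [0, 2]. Finitely many candidate tails of parts at most 3 are left, so that
  suffix conditions can be decided case by case.\<close>

lemma N_set_cases:
  assumes "p \<in> N_set"
  obtains r where "\<And>b. b \<in> set r \<Longrightarrow> b > 3" "is_partition r"
    "p \<in> {r, r @ [1], r @ [1, 1], r @ [2], r @ [2, 2], r @ [3], r @ [3, 3], r @ [3, 1], r @ [3, 1, 1]}"
proof -
  define r where "r = filter (\<lambda>b. b > 3) p"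
  define a b c where "a = count_list p 1" and "b = count_list p 2" and "c = count_list p 3"
  note part = N_set_partition[OF assms]
  have p: "p = r @ replicate c 3 @ replicate b 2 @ replicate a 1"
    unfolding r_def a_def b_def c_def by (rule sorted_decomp_3[OF part])
  have r: "b > 3" if "b \<in> set r" for b using that by (simp add: r_def)
  have "is_partition r" using part by (auto simp: r_def is_partition_def sorted_wrt_filter)
  have nb: "\<not> bad s" if "p = u @ s @ v" for u s v
    using N_set_sublist[OF assms] that by (auto simp: sublist_def)
  have rep: "n < 3" if "p = u @ replicate n d @ v" for n d u v
  proof (rule ccontr)
    assume "\<not> n < 3"
    then have "n = 3 + (n - 3)" by simp
    then have "replicate n d = [d, d, d] @ replicate (n - 3) d"
      by (metis numeral_3_eq_3 replicate_0 replicate_Suc replicate_add)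
    then show False using nb[of u "[d, d, d]"] that by (auto simp: bad_iff)
  qed
  have lt: "a < 3" "b < 3" "c < 3"
    using rep[of "r @ replicate c 3 @ replicate b 2" a 1 "[]"] rep[of "r @ replicate c 3" b 2]
      rep[of r c 3] p by auto
  have ab: "a = 0 \<or> b = 0"
  proof (rule ccontr)
    assume "\<not> ?thesis"
    then obtain a' b' where "a = Suc a'" "b = Suc b'" by (auto simp: gr0_conv_Suc)
    moreover have "replicate (Suc b') 2 = replicate b' 2 @ [2::nat]" by (simp add: replicate_append_same)
    ultimately have "\<not> bad [2, 1]"
      using nb[of "r @ replicate c 3 @ replicate b' 2" "[2, 1]" "replicate a' 1"] p by simp
    then show False by (auto simp: bad_iff)
  qed
  have bc: "b = 0 \<or> c = 0"
  proof (rule ccontr)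
    assume "\<not> ?thesis"
    then obtain c' b' where "c = Suc c'" "b = Suc b'" by (auto simp: gr0_conv_Suc)
    moreover have "replicate (Suc c') 3 = replicate c' 3 @ [3::nat]" by (simp add: replicate_append_same)
    ultimately have "\<not> bad [3, 2]"
      using nb[of "r @ replicate c' 3" "[3, 2]" "replicate b' 2 @ replicate a 1"] p by simp
    then show False by (auto simp: bad_iff)
  qed
  have ac: "a = 0 \<or> c < 2"
  proof (rule ccontr)
    assume "\<not> ?thesis"
    then obtain a' where "c = 2" "a = Suc a'" using lt by (auto simp: gr0_conv_Suc)
    then have "\<not> bad [3, 3, 1]" using nb[of r "[3, 3, 1]" "replicate a' 1"] p bc
      by (simp add: numeral_2_eq_2)
    then show False by (auto simp: bad_iff)
  qed
  have "a \<in> {0, 1, 2}" "b \<in> {0, 1, 2}" "c \<in> {0, 1, 2}" using lt by auto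
  then have "p \<in> {r, r @ [1], r @ [1, 1], r @ [2], r @ [2, 2], r @ [3], r @ [3, 3], r @ [3, 1], r @ [3, 1, 1]}"
    using ab bc ac p by (auto simp: numeral_2_eq_2)
  then show ?thesis
    by (intro that[of r]) (use r \<open>is_partition r\<close> in blast)+
qed

text \<open>Attaching a letter tests p only through its small parts, apart from the staircase
  patterns relevant for [1, 1]. The nine cases of \<open>N_set_cases\<close> translate the suffix
  conditions into multiplicities.\<close>

lemma bump_letter_in_N_set:
  assumes p: "p \<in> N_set"
  shows "bump p \<in> N_set"
    "bump p @ [2] \<in> N_set \<longleftrightarrow> count_list p 1 = 0 \<and> count_list p 2 \<le> 1 \<and> count_list p 3 \<le> 1"
    "bump p @ [2, 2] \<in> N_set \<longleftrightarrow> count_list p 1 = 0 \<and> count_list p 2 = 0 \<and> count_list p 3 = 0"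
    "bump p @ [1] \<in> N_set \<longleftrightarrow> count_list p 1 \<le> 1 \<and> count_list p 2 \<le> 1 \<and> count_list p 3 \<le> 1"
    "bump p @ [1, 1] \<in> N_set \<longleftrightarrow> count_list p 1 = 0 \<and> count_list p 2 \<le> 1 \<and> count_list p 3 = 0 \<and>
       (\<forall>k\<ge>1. \<not> suffix ((2 * k + 3) # stair 2 k) p)"
proof -
  have p0: "0 \<notin> set p" using p by (auto dest: N_set_partition simp: is_partition_def)
  have t0: "0 \<notin> set t" if "suffix t p" for t using p0 set_mono_suffix[OF that] by blast
  obtain r where r: "\<And>b. b \<in> set r \<Longrightarrow> b > 3" and
    pr: "p \<in> {r, r @ [1], r @ [1, 1], r @ [2], r @ [2, 2], r @ [3], r @ [3, 3], r @ [3, 1], r @ [3, 1, 1]}"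
    using N_set_cases[OF p] by metis
  have notr: "r \<noteq> u @ [b]" "r \<noteq> u @ [b, c]" if "b \<le> 3" for u b c using r[of b] that by auto
  have cnt: "count_list r b = 0" if "b \<le> 3" for b using r that by (intro count_notin) force
  have pre1: "prefix v [c] \<and> v \<noteq> [] \<longleftrightarrow> v = [c]" for v and c :: nat by (cases v) auto
  have pre2: "prefix v [c, c] \<and> v \<noteq> [] \<longleftrightarrow> v = [c] \<or> v = [c, c]" for v and c :: nat
    by (cases v; cases "tl v") auto
  show "bump p \<in> N_set" using bump_append_in_N_set[OF p0, of "[]"] p by (auto simp: letters_def)
  have 2: "(\<forall>t. suffix t p \<and> t \<noteq> [] \<longrightarrow> \<not> bad (bump t @ [2])) \<longleftrightarrow>
      count_list p 1 = 0 \<and> count_list p 2 \<le> 1 \<and> count_list p 3 \<le> 1" (is "?A \<longleftrightarrow> ?B")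
  proof -
    have "?A \<longleftrightarrow> \<not> suffix [1] p \<and> \<not> suffix [2, 2] p \<and> \<not> suffix [3, 3] p"
    proof -
      have "bad (bump t @ [2]) \<longleftrightarrow> t \<in> {[1], [2, 2], [3, 3]}" if "suffix t p" for t
        using bad_bump_snoc[OF t0[OF that], of 2] by simp
      then have "?A \<longleftrightarrow> (\<forall>t. suffix t p \<and> t \<noteq> [] \<longrightarrow> t \<notin> {[1], [2, 2], [3, 3]})" by meson
      then show ?thesis by auto
    qed
    also have "\<dots> \<longleftrightarrow> ?B" using pr by (elim insertE emptyE) (simp_all add: suffix_def cnt notr)
    finally show ?thesis .
  qed
  have 1: "(\<forall>t. suffix t p \<and> t \<noteq> [] \<longrightarrow> \<not> bad (bump t @ [1])) \<longleftrightarrow>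
      count_list p 1 \<le> 1 \<and> count_list p 2 \<le> 1 \<and> count_list p 3 \<le> 1" (is "?A \<longleftrightarrow> ?B")
  proof -
    have "?A \<longleftrightarrow> \<not> suffix [1, 1] p \<and> \<not> suffix [2, 2] p \<and> \<not> suffix [3, 3] p"
    proof -
      have "bad (bump t @ [1]) \<longleftrightarrow> t \<in> {[1, 1], [2, 2], [3, 3]}" if "suffix t p" for t
        using bad_bump_snoc[OF t0[OF that], of 1] by simp
      then have "?A \<longleftrightarrow> (\<forall>t. suffix t p \<and> t \<noteq> [] \<longrightarrow> t \<notin> {[1, 1], [2, 2], [3, 3]})" by meson
      then show ?thesis by auto
    qed
    also have "\<dots> \<longleftrightarrow> ?B" using pr by (elim insertE emptyE) (simp_all add: suffix_def cnt notr)
    finally show ?thesis .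
  qed
  have 11: "(\<forall>t. suffix t p \<and> t \<noteq> [] \<longrightarrow> \<not> bad (bump t @ [1, 1])) \<longleftrightarrow>
      \<not> suffix [1] p \<and> \<not> suffix [3] p \<and> (\<forall>k\<ge>1. \<not> suffix ((2 * k + 3) # stair 2 k) p)"
  proof -
    have "bad (bump t @ [1, 1]) \<longleftrightarrow> t \<in> {[1], [3]} \<or> (\<exists>k\<ge>1. t = (2 * k + 3) # stair 2 k)"
      if "suffix t p" "t \<noteq> []" for t
      using bad_bump_snoc2(3)[OF t0[OF that(1)] that(2)] .
    note e = this
    show ?thesis (is "?A \<longleftrightarrow> ?B")
    proof
      assume ?A
      then have n: "\<not> bad (bump t @ [1, 1])" if "suffix t p" "t \<noteq> []" for t using that by blast
      have "\<not> suffix [1] p" "\<not> suffix [3] p"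
        using n[of "[1]"] e[of "[1]"] n[of "[3]"] e[of "[3]"] by blast+
      moreover have "\<not> suffix ((2 * k + 3) # stair 2 k) p" if "k \<ge> 1" for k
        using n[of "(2 * k + 3) # stair 2 k"] e[of "(2 * k + 3) # stair 2 k"] that by blast
      ultimately show ?B by blast
    next
      assume ?B
      then show ?A using e by blast
    qed
  qed
  have 22: "(\<forall>t. suffix t p \<and> t \<noteq> [] \<longrightarrow> \<not> bad (bump t @ [2, 2])) \<longleftrightarrow>
      \<not> suffix [2] p \<and> \<not> suffix [3] p"
  proof
    assume *: "\<forall>t. suffix t p \<and> t \<noteq> [] \<longrightarrow> \<not> bad (bump t @ [2, 2])"
    show "\<not> suffix [2] p \<and> \<not> suffix [3] p"
      using *[rule_format, of "[2]"] *[rule_format, of "[3]"] bad_bump_snoc2(1)[of "[2]"]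
        bad_bump_snoc2(1)[of "[3]"] by auto
  next
    assume *: "\<not> suffix [2] p \<and> \<not> suffix [3] p"
    show "\<forall>t. suffix t p \<and> t \<noteq> [] \<longrightarrow> \<not> bad (bump t @ [2, 2])"
    proof (intro allI impI notI)
      fix t assume t: "suffix t p \<and> t \<noteq> []" "bad (bump t @ [2, 2])"
      then have "last t \<in> {2, 3}" using bad_bump_snoc2(2)[of t] t0 by blast
      moreover have "suffix [last t] t" using t by (metis append_butlast_last_id suffixI)
      ultimately show False using * t by (metis insertE singletonD suffix_order.trans)
    qed
  qed
  have letter: "bump p @ w \<in> N_set \<longleftrightarrow>
      (\<forall>t v. suffix t p \<and> t \<noteq> [] \<and> prefix v w \<and> v \<noteq> [] \<longrightarrow> \<not> bad (bump t @ v))" if "w \<in> letters" for w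
    using bump_append_in_N_set[OF p0 that] p by simp
  have one: "bump p @ [c] \<in> N_set \<longleftrightarrow> (\<forall>t. suffix t p \<and> t \<noteq> [] \<longrightarrow> \<not> bad (bump t @ [c]))"
    if "[c] \<in> letters" for c
    unfolding letter[OF that] pre1 by auto
  have two: "bump p @ [c, c] \<in> N_set \<longleftrightarrow> (\<forall>t. suffix t p \<and> t \<noteq> [] \<longrightarrow> \<not> bad (bump t @ [c])) \<and>
      (\<forall>t. suffix t p \<and> t \<noteq> [] \<longrightarrow> \<not> bad (bump t @ [c, c]))" if "[c, c] \<in> letters" for c
    unfolding letter[OF that] pre2 by auto
  have lets: "[2] \<in> letters" "[1] \<in> letters" "[2, 2] \<in> letters" "[1, 1] \<in> letters"
    by (auto simp: letters_def)
  show "bump p @ [2] \<in> N_set \<longleftrightarrow> count_list p 1 = 0 \<and> count_list p 2 \<le> 1 \<and> count_list p 3 \<le> 1"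
    unfolding one[OF lets(1)] 2 ..
  show "bump p @ [1] \<in> N_set \<longleftrightarrow> count_list p 1 \<le> 1 \<and> count_list p 2 \<le> 1 \<and> count_list p 3 \<le> 1"
    unfolding one[OF lets(2)] 1 ..
  show "bump p @ [2, 2] \<in> N_set \<longleftrightarrow> count_list p 1 = 0 \<and> count_list p 2 = 0 \<and> count_list p 3 = 0"
    unfolding two[OF lets(3)] 2 22 using pr by (elim insertE emptyE) (simp_all add: suffix_def cnt notr)
  have "((count_list p 1 \<le> 1 \<and> count_list p 2 \<le> 1 \<and> count_list p 3 \<le> 1) \<and>
      \<not> suffix [1] p \<and> \<not> suffix [3] p) \<longleftrightarrow> count_list p 1 = 0 \<and> count_list p 2 \<le> 1 \<and> count_list p 3 = 0"
    using pr by (elim insertE emptyE) (simp_all add: suffix_def cnt notr)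
  then show "bump p @ [1, 1] \<in> N_set \<longleftrightarrow> count_list p 1 = 0 \<and> count_list p 2 \<le> 1 \<and> count_list p 3 = 0 \<and>
       (\<forall>k\<ge>1. \<not> suffix ((2 * k + 3) # stair 2 k) p)"
    unfolding two[OF lets(4)] 1 11 by blast
qed

text \<open>By \<open>bump_letter_in_N_set\<close>, these are the partitions whose shift may be
  followed by a single part 2.\<close>

definition NA_set :: "nat list set" where
  "NA_set = {p \<in> N_set. count_list p 1 = 0 \<and> count_list p 2 \<le> 1 \<and> count_list p 3 \<le> 1}"

text \<open>These are the partitions whose shift may be followed by two parts 2.\<close>

definition NB_set :: "nat list set" where
  "NB_set = {p \<in> N_set. count_list p 1 = 0 \<and> count_list p 2 = 0 \<and> count_list p 3 = 0}"

text \<open>Since \<open>bump p\<close> has as many parts 3 as p has parts 1, this class appears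
  when a bound of one part 3 is pulled back along the shift.\<close>

definition NC_set :: "nat list set" where
  "NC_set = {p \<in> N_set. count_list p 1 \<le> 1}"

section \<open>Recursive descriptions of the classes\<close>

lemma N_set_0: "p \<in> N_set \<Longrightarrow> 0 \<notin> set p"
  by (auto dest: N_set_partition simp: is_partition_def)

lemma count_bump:
  "count_list (bump p) (Suc 0) = 0" "0 \<notin> set p \<Longrightarrow> count_list (bump p) 2 = 0"
  "count_list (bump p) 3 = count_list p (Suc 0)"
  by (induction p) auto

lemma N_set_decomp:
  assumes "p \<in> N_set"
  obtains p' w where "p' \<in> N_set" "w \<in> letters" "p = bump p' @ w"
proof -
  obtain r where r: "\<And>b. b \<in> set r \<Longrightarrow> b > 3" and
    pr: "p \<in> {r, r @ [1], r @ [1, 1], r @ [2], r @ [2, 2], r @ [3], r @ [3, 3], r @ [3, 1], r @ [3, 1, 1]}"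
    using N_set_cases[OF assms] by metis
  then have "\<exists>u\<in>{r, r @ [3], r @ [3, 3]}. \<exists>w\<in>letters. p = u @ w"
    unfolding letters_def by auto
  then obtain u w where uw: "u \<in> {r, r @ [3], r @ [3, 3]}" "w \<in> letters" "p = u @ w" by blast
  then have "\<forall>b\<in>set u. b \<ge> 3" using r by fastforce
  then have "bump (map (\<lambda>a. a - 2) u) = u" "0 \<notin> set (map (\<lambda>a. a - 2) u)"
    unfolding bump_def by (auto intro!: map_idI)
  with uw that assms bump_append_in_N_set show ?thesis by metis
qed

text \<open>The pattern ends in the part 2; anything after it would be a part 1 or a second part 2,
  and both are excluded by the multiplicities.\<close>

lemma sublist_pattern_iff_suffix:
  assumes "p \<in> N_set" "count_list p 1 = 0" "count_list p 2 \<le> 1" "k \<ge> 1"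
  shows "sublist ((2 * k + 3) # rev (map (\<lambda>i. 2 * i) [1..<Suc k])) p \<longleftrightarrow>
    suffix ((2 * k + 3) # stair 2 k) p"
proof -
  have st: "rev (map (\<lambda>i. 2 * i) [1..<Suc k]) = stair 2 k" for k
    by (induction k) (auto simp: stair_Suc)
  have "suffix ((2 * k + 3) # stair 2 k) p" if sub: "sublist ((2 * k + 3) # stair 2 k) p"
  proof -
    obtain u v where uv: "p = u @ ((2 * k + 3) # stair 2 k) @ v" using sub by (auto simp: sublist_def)
    obtain k' where k: "k = Suc k'" using assms(4) by (cases k) auto
    have "v = []"
    proof (rule ccontr)
      assume "v \<noteq> []"
      then obtain b where b: "b \<in> set v" by (cases v) auto
      then have "b \<le> 2"
        using N_set_partition[OF assms(1)] uv k by (auto simp: is_partition_def sorted_wrt_append stair_Suc')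
      moreover have "0 \<notin> set v" using N_set_0[OF assms(1)] uv by auto
      then have "b \<noteq> 0" using b by metis
      ultimately have "b \<le> 2" "b \<noteq> 0" by auto
      then have "b = 1 \<or> b = 2" by auto
      then have "count_list v 1 > 0 \<or> count_list v 2 > 0"
        using b by (metis count_list_0_iff gr0I)
      then show False using assms(2,3) uv k by (auto simp: stair_Suc')
    qed
    then show ?thesis using uv by (auto simp: suffix_def)
  qed
  then show ?thesis unfolding st by auto
qed

lemma N3_set_altdef:
  "N3_set = {p \<in> N_set. count_list p 1 = 0 \<and> count_list p 2 \<le> 1 \<and> count_list p 3 = 0 \<and>
       (\<forall>k\<ge>1. \<not> suffix ((2 * k + 3) # stair 2 k) p)}"
  unfolding N3_set_def using sublist_pattern_iff_suffix by blast

lemma N_set_eq: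
  "N_set = bump ` N_set \<union> (\<lambda>p. bump p @ [2]) ` NA_set \<union> (\<lambda>p. bump p @ [2, 2]) ` NB_set \<union>
     (\<lambda>p. bump p @ [1]) ` N2_set \<union> (\<lambda>p. bump p @ [1, 1]) ` N3_set" (is "_ = ?R")
proof
  note b = bump_letter_in_N_set
  have "bump p @ [2] \<in> N_set" if "p \<in> NA_set" for p using that b(2)[of p] by (simp add: NA_set_def)
  moreover have "bump p @ [2, 2] \<in> N_set" if "p \<in> NB_set" for p
    using that b(3)[of p] by (simp add: NB_set_def)
  moreover have "bump p @ [1] \<in> N_set" if "p \<in> N2_set" for p using that b(4)[of p] by (simp add: N2_set_def)
  moreover have "bump p @ [1, 1] \<in> N_set" if "p \<in> N3_set" for p
    using that b(5)[of p] unfolding N3_set_altdef by blast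
  ultimately show "?R \<subseteq> N_set" using b(1) by blast
  show "N_set \<subseteq> ?R"
  proof
    fix p assume p: "p \<in> N_set"
    obtain p' w where pw: "p' \<in> N_set" "w \<in> letters" "p = bump p' @ w" by (rule N_set_decomp[OF p])
    note b = b[OF pw(1)]
    have "w = [2] \<Longrightarrow> p' \<in> NA_set" using p pw b(2) by (simp add: NA_set_def)
    moreover have "w = [2, 2] \<Longrightarrow> p' \<in> NB_set" using p pw b(3) by (simp add: NB_set_def)
    moreover have "w = [1] \<Longrightarrow> p' \<in> N2_set" using p pw b(4) by (simp add: N2_set_def)
    moreover have "w = [1, 1] \<Longrightarrow> p' \<in> N3_set"
      using p pw(1,3) b(5) unfolding N3_set_altdef by blast
    ultimately show "p \<in> ?R" using pw unfolding letters_def by auto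
  qed
qed

lemma N1_set_eq:
  "N1_set = bump ` N_set \<union> (\<lambda>p. bump p @ [2]) ` NA_set \<union> (\<lambda>p. bump p @ [2, 2]) ` NB_set"
  unfolding N1_set_def by (subst N_set_eq) (auto simp: count_bump)

lemma NC_set_eq:
  "NC_set = bump ` N_set \<union> (\<lambda>p. bump p @ [2]) ` NA_set \<union> (\<lambda>p. bump p @ [2, 2]) ` NB_set \<union>
     (\<lambda>p. bump p @ [1]) ` N2_set"
  unfolding NC_set_def by (subst N_set_eq) (auto simp: count_bump)

lemma NA_set_eq: "NA_set = bump ` NC_set \<union> (\<lambda>p. bump p @ [2]) ` NA_set"
proof -
  have "NA_set = {p \<in> N_set. count_list p 1 = 0 \<and> count_list p 2 \<le> 1 \<and> count_list p 3 \<le> 1}"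
    by (simp add: NA_set_def)
  also have "\<dots> = bump ` {p \<in> N_set. count_list p 1 \<le> 1} \<union> (\<lambda>p. bump p @ [2]) ` {p \<in> NA_set. count_list p 1 = 0}"
    by (subst N_set_eq) (auto simp: count_bump N_set_0 NA_set_def)
  also have "{p \<in> NA_set. count_list p 1 = 0} = NA_set" by (auto simp: NA_set_def)
  finally show ?thesis by (simp add: NC_set_def)
qed

lemma NB_set_eq: "NB_set = bump ` N1_set"
  unfolding NB_set_def by (subst N_set_eq) (auto simp: count_bump N_set_0 NA_set_def N1_set_def)

lemma N2_set_eq:
  "N2_set = bump ` NC_set \<union> (\<lambda>p. bump p @ [2]) ` NA_set \<union> (\<lambda>p. bump p @ [1]) ` N2_set"
proof -
  have "N2_set = {p \<in> N_set. count_list p 1 \<le> 1 \<and> count_list p 2 \<le> 1 \<and> count_list p 3 \<le> 1}"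
    by (simp add: N2_set_def)
  also have "\<dots> = bump ` {p \<in> N_set. count_list p 1 \<le> 1} \<union> (\<lambda>p. bump p @ [2]) ` NA_set \<union>
     (\<lambda>p. bump p @ [1]) ` N2_set"
    by (subst N_set_eq) (auto simp: count_bump N_set_0 NA_set_def N2_set_def)
  finally show ?thesis by (simp add: NC_set_def)
qed

text \<open>The staircase for k + 1 is the shifted staircase for k followed by 2, and for k = 0 the
  pattern degenerates to [3]. Thus infinitely many forbidden suffixes reproduce themselves under the
  recursion, at the cost of one condition on the part 3.\<close>

lemma suffix_pattern_bump:
  assumes "p \<in> N_set"
  shows "(\<forall>k\<ge>1. \<not> suffix ((2 * k + 3) # stair 2 k) (bump p))"
    "(\<forall>k\<ge>1. \<not> suffix ((2 * k + 3) # stair 2 k) (bump p @ [2])) \<longleftrightarrow>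
      \<not> suffix [3] p \<and> (\<forall>k\<ge>1. \<not> suffix ((2 * k + 3) # stair 2 k) p)"
proof -
  have "False" if k1: "k \<ge> 1" and suf: "suffix ((2 * k + 3) # stair 2 k) (bump p)" for k
  proof -
    obtain k' where k: "k = Suc k'" using k1 by (cases k) auto
    then have "2 \<in> set (bump p)" using set_mono_suffix[OF suf] by (auto simp: stair_Suc')
    then show False using N_set_0[OF assms] by (auto simp: bump_def)
  qed
  then show "(\<forall>k\<ge>1. \<not> suffix ((2 * k + 3) # stair 2 k) (bump p))" by blast
  have suf: "suffix ((2 * Suc k + 3) # stair 2 (Suc k)) (bump p @ [2]) \<longleftrightarrow>
      suffix ((2 * k + 3) # stair 2 k) p" for k
  proof -
    have "(2 * Suc k + 3) # stair 2 (Suc k) = bump ((2 * k + 3) # stair 2 k) @ [2]"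
      by (simp add: stair_Suc' bump_stair)
    then have "suffix ((2 * Suc k + 3) # stair 2 (Suc k)) (bump p @ [2]) \<longleftrightarrow>
       suffix (bump ((2 * k + 3) # stair 2 k) @ [2]) (bump p @ [2])" by simp
    also have "\<dots> \<longleftrightarrow> suffix (bump ((2 * k + 3) # stair 2 k)) (bump p)"
      by (rule same_suffix_suffix)
    also have "\<dots> \<longleftrightarrow> suffix ((2 * k + 3) # stair 2 k) p"
      unfolding suffix_bump using bump_inject by metis
    finally show ?thesis .
  qed
  have ge1: "(\<forall>k\<ge>1. P k) \<longleftrightarrow> (\<forall>k. P (Suc k))" for P :: "nat \<Rightarrow> bool"
    by (auto simp: Suc_le_eq gr0_conv_Suc)
  have "(\<forall>k\<ge>1. \<not> suffix ((2 * k + 3) # stair 2 k) (bump p @ [2])) \<longleftrightarrow>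
     (\<forall>k. \<not> suffix ((2 * k + 3) # stair 2 k) p)"
    unfolding ge1 suf ..
  also have "\<dots> \<longleftrightarrow> \<not> suffix ((2 * 0 + 3) # stair 2 0) p \<and> (\<forall>k\<ge>1. \<not> suffix ((2 * k + 3) # stair 2 k) p)"
    by (metis less_one linorder_not_le)
  also have "(2 * 0 + 3) # stair 2 0 = [3]" by simp
  finally show "(\<forall>k\<ge>1. \<not> suffix ((2 * k + 3) # stair 2 k) (bump p @ [2])) \<longleftrightarrow>
      \<not> suffix [3] p \<and> (\<forall>k\<ge>1. \<not> suffix ((2 * k + 3) # stair 2 k) p)" .
qed

lemma NA_set_suffix_3:
  assumes "p \<in> NA_set" "count_list p 1 = 0"
  shows "suffix [3] p \<longleftrightarrow> count_list p 3 \<noteq> 0"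
proof -
  have p: "p \<in> N_set" using assms by (simp add: NA_set_def)
  obtain r where r: "\<And>b. b \<in> set r \<Longrightarrow> b > 3" and
    pr: "p \<in> {r, r @ [1], r @ [1, 1], r @ [2], r @ [2, 2], r @ [3], r @ [3, 3], r @ [3, 1], r @ [3, 1, 1]}"
    using N_set_cases[OF p] by metis
  have notr: "r \<noteq> u @ [3]" for u using r[of 3] by auto
  have cnt: "count_list r b = 0" if "b \<le> 3" for b using r that by (intro count_notin) force
  show ?thesis using pr assms(2) by (auto simp: suffix_def cnt notr)
qed

lemma bump_in_N3_set:
  assumes "p \<in> N_set"
  shows "bump p \<in> N3_set \<longleftrightarrow> p \<in> N1_set"
proof -
  have c: "count_list (bump p) 1 = 0" "count_list (bump p) 2 = 0" "count_list (bump p) 3 = count_list p 1"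
    using N_set_0[OF assms] by (simp_all add: count_bump)
  show ?thesis
    unfolding N3_set_altdef N1_set_def mem_Collect_eq c
    using suffix_pattern_bump(1)[OF assms] bump_letter_in_N_set(1)[OF assms] assms zero_le by blast
qed

lemma bump_2_in_N3_set:
  assumes "p \<in> NA_set"
  shows "bump p @ [2] \<in> N3_set \<longleftrightarrow> p \<in> N3_set"
proof -
  have N: "p \<in> N_set" "count_list p 1 = 0" "count_list p 2 \<le> 1" "count_list p 3 \<le> 1"
    using assms by (auto simp: NA_set_def)
  have c: "count_list (bump p @ [2]) 1 = 0" "count_list (bump p @ [2]) 2 = 1"
    "count_list (bump p @ [2]) 3 = 0"
    using N_set_0[OF N(1)] N(2) by (simp_all add: count_bump)
  have mem: "bump p @ [2] \<in> N_set" using bump_letter_in_N_set(2)[OF N(1)] N by blast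
  show ?thesis
    unfolding N3_set_altdef mem_Collect_eq c suffix_pattern_bump(2)[OF N(1)] NA_set_suffix_3[OF assms N(2)]
    by (simp only: N mem simp_thms le_refl not_not)
qed

lemma N3_set_eq: "N3_set = bump ` N1_set \<union> (\<lambda>p. bump p @ [2]) ` N3_set"
proof
  show "N3_set \<subseteq> bump ` N1_set \<union> (\<lambda>p. bump p @ [2]) ` N3_set"
  proof
    fix p assume p: "p \<in> N3_set"
    then have N: "p \<in> N_set" and c: "count_list p 1 = 0" "count_list p 2 \<le> 1"
      unfolding N3_set_altdef by blast+
    from equalityD1[OF N_set_eq, THEN subsetD, OF N]
    show "p \<in> bump ` N1_set \<union> (\<lambda>p. bump p @ [2]) ` N3_set"
    proof (elim UnE imageE)
      fix p' assume "p = bump p'" "p' \<in> N_set"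
      then show ?thesis using p bump_in_N3_set by blast
    next
      fix p' assume "p = bump p' @ [2]" "p' \<in> NA_set"
      then show ?thesis using p bump_2_in_N3_set by blast
    qed (use c in simp_all)
  qed
  have "N3_set \<subseteq> NA_set" unfolding N3_set_altdef NA_set_def by auto
  moreover have "N1_set \<subseteq> N_set" unfolding N1_set_def by blast
  ultimately show "bump ` N1_set \<union> (\<lambda>p. bump p @ [2]) ` N3_set \<subseteq> N3_set"
    using bump_in_N3_set bump_2_in_N3_set by blast
qed

text \<open>The letter consists of the parts below 3 and can therefore be read off. This makes the
  unions over letters disjoint, so that generating functions add.\<close>

lemma bump_letter_unique:
  assumes "0 \<notin> set p" "0 \<notin> set p'" "w \<in> letters" "w' \<in> letters" "bump p @ w = bump p' @ w'"
  shows "w = w'" "p = p'"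
proof -
  have f: "filter (\<lambda>a. a < 3) (bump p @ w) = w" if "0 \<notin> set p" "w \<in> letters" for p w
    using that by (auto simp: letters_def bump_def filter_empty_conv) (metis gr0I)+
  show "w = w'" using f[OF assms(1,3)] f[OF assms(2,4)] assms(5) by simp
  then show "p = p'" using assms(5) by simp
qed

section \<open>Generating functions of the classes\<close>

lemma finite_partitions_of_length: "finite {p :: nat list. p \<in> C \<and> length p = m \<and> sum_list p = n}"
proof (rule finite_subset)
  show "{p. p \<in> C \<and> length p = m \<and> sum_list p = n} \<subseteq> {p. set p \<subseteq> {..n} \<and> length p = m}"
    by (auto simp: member_le_sum_list)
qed (rule finite_lists_length_eq, simp)

lemma gen_series_nth: "fps_nth (fps_nth (gen_series C) m) n = int (card {p \<in> C. length p = m \<and> sum_list p = n})"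
  by (simp add: gen_series_def)

lemma gen_series_Un:
  assumes "C \<inter> D = {}"
  shows "gen_series (C \<union> D) = gen_series C + gen_series D"
proof (intro fps_ext)
  fix m n
  have "{p \<in> C \<union> D. length p = m \<and> sum_list p = n} =
    {p \<in> C. length p = m \<and> sum_list p = n} \<union> {p \<in> D. length p = m \<and> sum_list p = n}" by auto
  then show "fps_nth (fps_nth (gen_series (C \<union> D)) m) n = fps_nth (fps_nth (gen_series C + gen_series D) m) n"
    using assms finite_partitions_of_length
    by (simp add: gen_series_nth) (subst card_Un_disjoint, auto)
qed

lemma subst_xq2_nth: "fps_nth (subst_xq2 f) n = fps_X ^ (2 * n) * fps_nth f n"
proof -
  have "q_ps\<^sup>2 * x_ps = fps_const (fps_X ^ 2) * fps_X" by (simp add: fps_const_power)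
  then show ?thesis
    unfolding subst_xq2_def by (simp add: fps_nth_compose_linear power_mult)
qed

text \<open>The shift raises the weight by 2 for each part, which is the substitution x -> x q^2;
  the letter w contributes a fixed monomial.\<close>

lemma gen_series_bump_append:
  "gen_series ((\<lambda>p. bump p @ w) ` C) = x_ps ^ length w * q_ps ^ sum_list w * subst_xq2 (gen_series C)"
proof (intro fps_ext)
  fix m n
  define k s where "k = length w" and "s = sum_list w"
  have inj: "inj_on (\<lambda>p. bump p @ w) A" for A by (auto simp: inj_on_def)
  have "fps_nth (fps_nth (gen_series ((\<lambda>p. bump p @ w) ` C)) m) n =
     int (card ((\<lambda>p. bump p @ w) ` {p \<in> C. length p + k = m \<and> sum_list p + 2 * length p + s = n}))"
    unfolding gen_series_nth
    by (intro arg_cong[of _ _ int] arg_cong[of _ _ card]) (auto simp: sum_list_bump k_def s_def)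
  also have "\<dots> = int (card {p \<in> C. length p + k = m \<and> sum_list p + 2 * length p + s = n})"
    by (simp add: card_image inj)
  also have "\<dots> = (if m < k then 0 else if n < s + 2 * (m - k) then 0 else
     int (card {p \<in> C. length p = m - k \<and> sum_list p = n - (s + 2 * (m - k))}))"
  proof -
    have "{p \<in> C. length p + k = m \<and> sum_list p + 2 * length p + s = n} =
      (if m < k then {} else if n < s + 2 * (m - k) then {} else
        {p \<in> C. length p = m - k \<and> sum_list p = n - (s + 2 * (m - k))})" by auto
    then show ?thesis by simp
  qed
  also have "\<dots> = fps_nth (fps_nth (x_ps ^ k * q_ps ^ s * subst_xq2 (gen_series C)) m) n"
  proof -
    have "x_ps ^ k * q_ps ^ s * subst_xq2 (gen_series C) =
        fps_X ^ k * (fps_const (fps_X ^ s) * subst_xq2 (gen_series C))"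
      by (simp add: fps_const_power mult.assoc)
    then have "fps_nth (x_ps ^ k * q_ps ^ s * subst_xq2 (gen_series C)) m =
        (if m < k then 0 else fps_X ^ s * (fps_X ^ (2 * (m - k)) * fps_nth (gen_series C) (m - k)))"
      by (simp only: fps_X_power_mult_nth fps_mult_left_const_nth subst_xq2_nth)
    also have "\<dots> = (if m < k then 0 else fps_X ^ (s + 2 * (m - k)) * fps_nth (gen_series C) (m - k))"
      by (simp only: power_add mult.assoc)
    finally show ?thesis by (simp add: fps_X_power_mult_nth gen_series_nth)
  qed
  finally show "fps_nth (fps_nth (gen_series ((\<lambda>p. bump p @ w) ` C)) m) n =
    fps_nth (fps_nth (x_ps ^ length w * q_ps ^ sum_list w * subst_xq2 (gen_series C)) m) n"
    by (simp add: k_def s_def)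
qed

lemma gen_series_UN_letters:
  assumes "W \<subseteq> letters" "\<And>w. w \<in> W \<Longrightarrow> C w \<subseteq> N_set"
  shows "gen_series (\<Union>w\<in>W. (\<lambda>p. bump p @ w) ` C w) =
    (\<Sum>w\<in>W. x_ps ^ length w * q_ps ^ sum_list w * subst_xq2 (gen_series (C w)))"
proof -
  have "finite W" using assms(1) by (rule finite_subset) (simp add: letters_def)
  then show ?thesis using assms
  proof (induction W)
    case empty
    show ?case by (intro fps_ext) (simp add: gen_series_nth)
  next
    case (insert w W)
    have "((\<lambda>p. bump p @ w) ` C w) \<inter> (\<Union>w\<in>W. (\<lambda>p. bump p @ w) ` C w) = {}"
    proof (intro equals0I, elim IntE UN_E imageE)
      fix q v p p' assume *: "v \<in> W" "q = bump p @ w" "p \<in> C w" "q = bump p' @ v" "p' \<in> C v"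
      have "w = v"
      proof (rule bump_letter_unique[of p p'])
        show "0 \<notin> set p" "0 \<notin> set p'" using insert.prems(2) * N_set_0 by blast+
      qed (use * insert.prems in auto)
      then show False using * insert.hyps by simp
    qed
    then show ?case using insert by (simp add: gen_series_Un gen_series_bump_append)
  qed
qed

text \<open>The class counted by \<open>F_series i\<close>. The classes for \<open>i = 1, 2, 5\<close> have no name in the paper.\<close>

definition nandi_class :: "nat \<Rightarrow> nat list set" where
  "nandi_class i = (if i = 0 then N_set else if i = 1 then NA_set else if i = 2 then NB_set
     else if i = 3 then N2_set else if i = 4 then N3_set else if i = 5 then NC_set else N1_set)"

lemma nandi_class_subset: "nandi_class i \<subseteq> N_set"
  by (auto simp: nandi_class_def NA_set_def NB_set_def NC_set_def N1_set_def N2_set_def N3_set_def)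

lemma gen_series_nandi_system: "F_system (\<lambda>i. gen_series (nandi_class i))"
proof -
  define C where "C w = (if w = [] then N_set else if w = [2] then NA_set else if w = [2, 2] then NB_set
    else if w = [1] then N2_set else N3_set)" for w :: "nat list"
  have C: "C w \<subseteq> N_set" for w
    using nandi_class_subset[of 0] nandi_class_subset[of 1] nandi_class_subset[of 2]
      nandi_class_subset[of 3] nandi_class_subset[of 4] by (auto simp: C_def nandi_class_def)
  have L: "[] \<in> letters" "[2] \<in> letters" "[2,2] \<in> letters" "[1] \<in> letters" "[1,1] \<in> letters"
    by (auto simp: letters_def)
  have sub: "NC_set \<subseteq> N_set" "N1_set \<subseteq> N_set" "NA_set \<subseteq> N_set" "N2_set \<subseteq> N_set" "N3_set \<subseteq> N_set"
    by (auto simp: NC_set_def N1_set_def NA_set_def N2_set_def N3_set_def)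
  have "gen_series N_set = gen_series (\<Union>w\<in>{[],[2],[2,2],[1],[1,1]}. (\<lambda>p. bump p @ w) ` (C w))"
    by (rule arg_cong[of _ _ gen_series], subst N_set_eq) (simp add: C_def Un_assoc)
  also have "\<dots> = (\<Sum>w\<in>{[],[2],[2,2],[1],[1,1]}. x_ps ^ length w * q_ps ^ sum_list w * subst_xq2 (gen_series (C w)))"
    by (rule gen_series_UN_letters) (use C L in auto)
  also have "\<dots> = subst_xq2 (gen_series N_set) + x_ps * q_ps^2 * subst_xq2 (gen_series NA_set) + x_ps^2 * q_ps^4 * subst_xq2 (gen_series NB_set) + x_ps * q_ps * subst_xq2 (gen_series N2_set) + x_ps^2 * q_ps^2 * subst_xq2 (gen_series N3_set)"
    by (simp add: C_def add.assoc power2_eq_square)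
  finally have e0: "gen_series N_set = subst_xq2 (gen_series N_set) + x_ps * q_ps^2 * subst_xq2 (gen_series NA_set) + x_ps^2 * q_ps^4 * subst_xq2 (gen_series NB_set) + x_ps * q_ps * subst_xq2 (gen_series N2_set) + x_ps^2 * q_ps^2 * subst_xq2 (gen_series N3_set)" .
  have "gen_series N1_set = gen_series (\<Union>w\<in>{[],[2],[2,2]}. (\<lambda>p. bump p @ w) ` (C w))"
    by (rule arg_cong[of _ _ gen_series], subst N1_set_eq) (simp add: C_def Un_assoc)
  also have "\<dots> = (\<Sum>w\<in>{[],[2],[2,2]}. x_ps ^ length w * q_ps ^ sum_list w * subst_xq2 (gen_series (C w)))"
    by (rule gen_series_UN_letters) (use C L in auto)
  also have "\<dots> = subst_xq2 (gen_series N_set) + x_ps * q_ps^2 * subst_xq2 (gen_series NA_set) + x_ps^2 * q_ps^4 * subst_xq2 (gen_series NB_set)"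
    by (simp add: C_def add.assoc power2_eq_square)
  finally have e7: "gen_series N1_set = subst_xq2 (gen_series N_set) + x_ps * q_ps^2 * subst_xq2 (gen_series NA_set) + x_ps^2 * q_ps^4 * subst_xq2 (gen_series NB_set)" .
  have "gen_series NC_set = gen_series (\<Union>w\<in>{[],[2],[2,2],[1]}. (\<lambda>p. bump p @ w) ` (C w))"
    by (rule arg_cong[of _ _ gen_series], subst NC_set_eq) (simp add: C_def Un_assoc)
  also have "\<dots> = (\<Sum>w\<in>{[],[2],[2,2],[1]}. x_ps ^ length w * q_ps ^ sum_list w * subst_xq2 (gen_series (C w)))"
    by (rule gen_series_UN_letters) (use C L in auto)
  also have "\<dots> = subst_xq2 (gen_series N_set) + x_ps * q_ps^2 * subst_xq2 (gen_series NA_set) + x_ps^2 * q_ps^4 * subst_xq2 (gen_series NB_set) + x_ps * q_ps * subst_xq2 (gen_series N2_set)"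
    by (simp add: C_def add.assoc power2_eq_square)
  finally have e5: "gen_series NC_set = subst_xq2 (gen_series N_set) + x_ps * q_ps^2 * subst_xq2 (gen_series NA_set) + x_ps^2 * q_ps^4 * subst_xq2 (gen_series NB_set) + x_ps * q_ps * subst_xq2 (gen_series N2_set)" .
  have "gen_series NA_set = gen_series (\<Union>w\<in>{[2],[]}. (\<lambda>p. bump p @ w) ` (if w = [] then NC_set else NA_set))"
    by (rule arg_cong[of _ _ gen_series], subst NA_set_eq) (simp add: Un_commute)
  also have "\<dots> = (\<Sum>w\<in>{[2],[]}. x_ps ^ length w * q_ps ^ sum_list w * subst_xq2 (gen_series (if w = [] then NC_set else NA_set)))"
    by (rule gen_series_UN_letters) (use sub L in auto)
  also have "\<dots> = x_ps * q_ps^2 * subst_xq2 (gen_series NA_set) + subst_xq2 (gen_series NC_set)"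
    by (simp add: C_def add.assoc power2_eq_square)
  finally have e1: "gen_series NA_set = x_ps * q_ps^2 * subst_xq2 (gen_series NA_set) + subst_xq2 (gen_series NC_set)" .
  have "gen_series N2_set = gen_series (\<Union>w\<in>{[2],[1],[]}. (\<lambda>p. bump p @ w) ` (if w = [] then NC_set else if w = [2] then NA_set else N2_set))"
    by (rule arg_cong[of _ _ gen_series], subst N2_set_eq) (simp add: Un_ac)
  also have "\<dots> = (\<Sum>w\<in>{[2],[1],[]}. x_ps ^ length w * q_ps ^ sum_list w * subst_xq2 (gen_series (if w = [] then NC_set else if w = [2] then NA_set else N2_set)))"
    by (rule gen_series_UN_letters) (use sub L in auto)
  also have "\<dots> = x_ps * q_ps^2 * subst_xq2 (gen_series NA_set) + x_ps * q_ps * subst_xq2 (gen_series N2_set) + subst_xq2 (gen_series NC_set)"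
    by (simp add: C_def add.assoc power2_eq_square)
  finally have e3: "gen_series N2_set = x_ps * q_ps^2 * subst_xq2 (gen_series NA_set) + x_ps * q_ps * subst_xq2 (gen_series N2_set) + subst_xq2 (gen_series NC_set)" .
  have "gen_series N3_set = gen_series (\<Union>w\<in>{[2],[]}. (\<lambda>p. bump p @ w) ` (if w = [] then N1_set else N3_set))"
    by (rule arg_cong[of _ _ gen_series], subst N3_set_eq) (simp add: Un_commute)
  also have "\<dots> = (\<Sum>w\<in>{[2],[]}. x_ps ^ length w * q_ps ^ sum_list w * subst_xq2 (gen_series (if w = [] then N1_set else N3_set)))"
    by (rule gen_series_UN_letters) (use sub L in auto)
  also have "\<dots> = x_ps * q_ps^2 * subst_xq2 (gen_series N3_set) + subst_xq2 (gen_series N1_set)"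
    by (simp add: C_def add.assoc power2_eq_square)
  finally have e4: "gen_series N3_set = x_ps * q_ps^2 * subst_xq2 (gen_series N3_set) + subst_xq2 (gen_series N1_set)" .
  have e2: "gen_series NB_set = subst_xq2 (gen_series N1_set)"
    using gen_series_bump_append[of "[]" N1_set] NB_set_eq by simp
  have nc: "nandi_class 0 = N_set" "nandi_class 1 = NA_set" "nandi_class 2 = NB_set" "nandi_class 3 = N2_set"
    "nandi_class 4 = N3_set" "nandi_class 5 = NC_set" "nandi_class 7 = N1_set"
    by (simp_all add: nandi_class_def)
  show ?thesis
    unfolding F_system_def Let_def nc
    by (intro conjI) (rule e0 e1 e2 e3 e4 e5 e7)+
qed

lemma gen_series_nandi_S_space: "gen_series (nandi_class i) \<in> S_space"
proof -
  have nil: "[] \<in> nandi_class i"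
  proof -
    have "[] \<in> N_set"
      by (auto simp: N_set_altdef is_partition_def bad_iff)
    then show ?thesis
      by (simp add: nandi_class_def NA_set_def NB_set_def NC_set_def N1_set_def N2_set_def N3_set_def)
  qed
  have zero: "p = []" if "p \<in> nandi_class i" "sum_list p = 0" for p
  proof -
    have "0 \<notin> set p" using that(1) nandi_class_subset N_set_0 by blast
    then show ?thesis using that(2) by (cases p) auto
  qed
  have "{p \<in> nandi_class i. length p = 0 \<and> sum_list p = n} = (if n = 0 then {[]} else {})" for n
    using nil by auto
  moreover have "{p \<in> nandi_class i. length p = m \<and> sum_list p = 0} = (if m = 0 then {[]} else {})" for m
    using nil zero by (auto simp del: sum_list_eq_0_iff)
  ultimately show ?thesis
    unfolding S_space_def by (auto simp: fps_eq_iff gen_series_nth)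
qed

section \<open>The reduced functional equations\<close>

text \<open>Passage from integral power series to the field of Laurent series in q, where division
  is possible; injectivity (\<open>lift_q_inject\<close>) brings uniqueness results back.\<close>

definition lift_q :: "int fps \<Rightarrow> rat fls" where
  "lift_q g = fps_to_fls (Abs_fps (\<lambda>n. of_int (fps_nth g n)))"

definition lift_xq :: "int fps fps \<Rightarrow> rat fls fps" where
  "lift_xq f = Abs_fps (\<lambda>m. lift_q (fps_nth f m))"

lemma to_laurent_eq: "to_laurent f = fps_to_fls (lift_xq f)"
  by (simp add: to_laurent_def lift_xq_def lift_q_def)

lemma lift_q_add: "lift_q (a + b) = lift_q a + lift_q b"
  by (rule fls_eqI) (simp add: lift_q_def)

lemma lift_q_mult: "lift_q (a * b) = lift_q a * lift_q b"
  unfolding lift_q_def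
  by (subst fls_times_fps_to_fls[symmetric]) (simp add: fps_eq_iff fps_mult_nth)

lemma lift_q_0: "lift_q 0 = 0"
  by (simp add: lift_q_def fps_eq_iff flip: fps_zero_to_fls)

lemma lift_q_sum: "lift_q (\<Sum>x\<in>A. f x) = (\<Sum>x\<in>A. lift_q (f x))"
  by (induction A rule: infinite_finite_induct) (auto simp: lift_q_0 lift_q_add)

lemma lift_q_1: "lift_q 1 = 1"
  by (simp add: lift_q_def fps_eq_iff flip: fps_one_to_fls)

lemma lift_q_X: "lift_q fps_X = fls_X"
  by (simp add: lift_q_def fps_eq_iff fps_X_def flip: fps_X_to_fls)

lemma lift_q_X_power: "lift_q (fps_X ^ n) = fls_X ^ n"
  by (induction n) (auto simp: lift_q_1 lift_q_mult lift_q_X)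

lemma lift_q_inject: "lift_q a = lift_q b \<longleftrightarrow> a = b"
  by (simp add: lift_q_def fps_eq_iff)

lemma lift_xq_nth: "fps_nth (lift_xq f) n = lift_q (fps_nth f n)"
  by (simp add: lift_xq_def)

lemma lift_xq_add: "lift_xq (a + b) = lift_xq a + lift_xq b"
  by (simp add: fps_eq_iff lift_xq_nth lift_q_add)

lemma lift_xq_mult: "lift_xq (a * b) = lift_xq a * lift_xq b"
  by (simp add: fps_eq_iff lift_xq_nth fps_mult_nth lift_q_sum lift_q_mult)

lemma lift_xq_X: "lift_xq fps_X = fps_X"
  by (auto simp: fps_eq_iff lift_xq_nth fps_X_def lift_q_0 lift_q_1)

lemma lift_xq_q: "lift_xq (fps_const fps_X) = fps_const fls_X"
  by (auto simp: fps_eq_iff lift_xq_nth lift_q_0 lift_q_X)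

lemma lift_xq_1: "lift_xq 1 = 1"
  by (auto simp: fps_eq_iff lift_xq_nth lift_q_0 lift_q_1)

lemma lift_xq_power: "lift_xq (a ^ n) = lift_xq a ^ n"
  by (induction n) (auto simp: lift_xq_mult lift_xq_1)

lemma lift_xq_inject: "lift_xq a = lift_xq b \<longleftrightarrow> a = b"
  by (simp add: fps_eq_iff[of a] fps_eq_iff[of "lift_xq a"] lift_xq_nth lift_q_inject)

lemma lift_xq_subst: "lift_xq (subst_xq2 f) = xscale (fls_X ^ 2) (lift_xq f)"
  unfolding fps_eq_iff lift_xq_nth subst_xq2_nth lift_q_mult lift_q_X_power xscale_nth
  by (simp add: power_mult)

section \<open>Elimination and uniqueness\<close>

abbreviation "E \<equiv> xscale (fls_X ^ 2 :: rat fls)"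
abbreviation "qf \<equiv> (fps_const fls_X :: rat fls fps)"

lemmas E_simps = xscale_add xscale_diff xscale_mult xscale_power xscale_X xscale_const

text \<open>The third argument stands for \<open>x\<^sup>2 q\<^sup>2 F\<^sub>4\<close>, which keeps the quadruple sums for \<open>F\<^sub>4\<close> free of
  negative powers of \<open>x\<close>.\<close>

definition reduced_system :: "rat fls fps \<Rightarrow> rat fls fps \<Rightarrow> rat fls fps \<Rightarrow> bool" where
  "reduced_system f g H \<longleftrightarrow>
     qf^2 * H = fps_X * E H + fps_X^2 * qf^4 * E f \<and>
     g = (fps_X * qf + fps_X * qf^2) * E g + fps_X * qf^3 * (1 - fps_X * qf^2) * E (E g) + E f \<and>
     qf^4 * (f - E f - fps_X * qf^2 * (E g - fps_X * qf^3 * E (E g)) - fps_X^2 * qf^4 * E (E f)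
       - fps_X * qf^3 * E (E g)) = E (E H)"

lemma E_X: "E fps_X = qf^2 * fps_X"
  by (simp add: xscale_X fps_const_power)

lemma E_1 [simp]: "E 1 = 1"
  by (auto simp: fps_eq_iff)

lemma E_qf [simp]: "E qf = qf" "E (qf ^ n) = qf ^ n"
  by (simp_all add: xscale_const fps_const_power)

text \<open>Several right-hand sides of the system differ by one or two terms only. Subtracting them
  expresses the series 0, 1, 2 and 5 through 7, 3 and 4, and substituting back leaves one equation
  for each of these three.\<close>

lemma F_system_elim:
  assumes "F_system F"
  defines "L \<equiv> \<lambda>i. lift_xq (F i)"
  shows "L 2 = E (L 7)"
    "L 1 = L 3 - fps_X * qf * E (L 3)"
    "L 5 = L 7 + fps_X * qf * E (L 3)"
    "L 0 = L 7 + fps_X * qf * E (L 3) + fps_X^2 * qf^2 * E (L 4)"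
    "L 4 = fps_X * qf^2 * E (L 4) + E (L 7)"
    "L 3 = (fps_X * qf + fps_X * qf^2) * E (L 3) + fps_X * qf^3 * (1 - fps_X * qf^2) * E (E (L 3)) + E (L 7)"
    "L 7 - E (L 7) - fps_X * qf^2 * (E (L 3) - fps_X * qf^3 * E (E (L 3))) - fps_X^2 * qf^4 * E (E (L 7))
       - fps_X * qf^3 * E (E (L 3)) = fps_X^2 * qf^6 * E (E (L 4))"
proof -
  let ?x = "fps_X :: rat fls fps"
  note sys = assms(1)[unfolded F_system_def Let_def]
  have lift: "lift_xq a = lift_xq b" if "a = b" for a b using that by simp
  note rules = lift_xq_add lift_xq_mult lift_xq_power lift_xq_X lift_xq_q lift_xq_subst
  have a: "L 0 = E (L 0) + ?x * qf^2 * E (L 1) + ?x^2 * qf^4 * E (L 2) + ?x * qf * E (L 3) + ?x^2 * qf^2 * E (L 4)"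
    "L 1 = ?x * qf^2 * E (L 1) + E (L 5)"
    "L 2 = E (L 7)"
    "L 3 = ?x * qf^2 * E (L 1) + ?x * qf * E (L 3) + E (L 5)"
    "L 4 = ?x * qf^2 * E (L 4) + E (L 7)"
    "L 5 = E (L 0) + ?x * qf^2 * E (L 1) + ?x^2 * qf^4 * E (L 2) + ?x * qf * E (L 3)"
    "L 7 = E (L 0) + ?x * qf^2 * E (L 1) + ?x^2 * qf^4 * E (L 2)"
    unfolding L_def rules[symmetric] using sys by (blast intro: lift)+
  show 2: "L 2 = E (L 7)" by (rule a(3))
  show 1: "L 1 = L 3 - ?x * qf * E (L 3)" using a(2,4) by algebra
  show 5: "L 5 = L 7 + ?x * qf * E (L 3)" using a(6,7) by algebra
  show 0: "L 0 = L 7 + ?x * qf * E (L 3) + ?x^2 * qf^2 * E (L 4)" using a(1,7) by algebra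
  show "L 4 = ?x * qf^2 * E (L 4) + E (L 7)" by (rule a(5))
  have E1: "E (L 1) = E (L 3) - qf^2 * ?x * qf * E (E (L 3))"
    unfolding 1 E_simps E_X by (simp add: xscale_X fps_const_power mult_ac)
  have E5: "E (L 5) = E (L 7) + qf^2 * ?x * qf * E (E (L 3))"
    unfolding 5 E_simps E_X by (simp add: xscale_X fps_const_power mult_ac)
  have E0: "E (L 0) = E (L 7) + qf^2 * ?x * qf * E (E (L 3)) + (qf^2 * ?x)^2 * qf^2 * E (E (L 4))"
    unfolding 0 E_simps E_X by (simp add: xscale_X fps_const_power mult_ac)
  show "L 3 = (?x * qf + ?x * qf^2) * E (L 3) + ?x * qf^3 * (1 - ?x * qf^2) * E (E (L 3)) + E (L 7)"
    using a(4) unfolding E1 E5 by algebra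
  show "L 7 - E (L 7) - ?x * qf^2 * (E (L 3) - ?x * qf^3 * E (E (L 3))) - ?x^2 * qf^4 * E (E (L 7))
       - ?x * qf^3 * E (E (L 3)) = ?x^2 * qf^6 * E (E (L 4))"
    using a(7) unfolding E1 E0 2 by algebra
qed

lemma F_system_reduced:
  assumes "F_system F"
  shows "reduced_system (lift_xq (F 7)) (lift_xq (F 3)) (fps_X^2 * qf^2 * lift_xq (F 4))"
proof -
  note e = F_system_elim[OF assms]
  let ?x = "fps_X :: rat fls fps"
  have EH: "E (?x^2 * qf^2 * lift_xq (F 4)) = (qf^2 * ?x)^2 * qf^2 * E (lift_xq (F 4))"
    unfolding E_simps by (simp add: fps_const_power)
  have EEH: "E ((qf^2 * ?x)^2 * qf^2 * E (lift_xq (F 4))) = (qf^2 * (qf^2 * ?x))^2 * qf^2 * E (E (lift_xq (F 4)))"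
    unfolding E_simps by (simp add: fps_const_power)
  show ?thesis
    unfolding reduced_system_def EH EEH
  proof (intro conjI)
    show "qf^2 * (?x^2 * qf^2 * lift_xq (F 4)) = ?x * ((qf^2 * ?x)^2 * qf^2 * E (lift_xq (F 4))) +
      ?x^2 * qf^4 * E (lift_xq (F 7))" using e(5) by algebra
    show "qf ^ 4 * (lift_xq (F 7) - E (lift_xq (F 7)) - ?x * qf\<^sup>2 * (E (lift_xq (F 3)) - ?x * qf ^ 3 * E (E (lift_xq (F 3))))
      - ?x\<^sup>2 * qf ^ 4 * E (E (lift_xq (F 7))) - ?x * qf ^ 3 * E (E (lift_xq (F 3)))) =
      (qf\<^sup>2 * (qf\<^sup>2 * ?x))\<^sup>2 * qf\<^sup>2 * E (E (lift_xq (F 4)))"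
      unfolding e(7) by algebra
  qed (rule e(6))
qed

text \<open>Strong induction on the exponent of x: the equation for H yields its n-th coefficient
  from lower ones, the third equation then yields that of f through the factor 1 - q^(2n), and the
  second that of g. The factor vanishes at n = 0, which is why the constant term of f must be
  prescribed.\<close>

lemma reduced_system_zero:
  assumes "reduced_system f g H" "fps_nth f 0 = 0"
  shows "f = 0 \<and> g = 0 \<and> H = 0"
proof -
  let ?q = "fls_X :: rat fls"
  have e1: "?q^2 * fps_nth H n = (if n = 0 then 0 else (?q^2)^(n-1) * fps_nth H (n - 1))
      + (if n < 2 then 0 else ?q^4 * ((?q^2)^(n-2) * fps_nth f (n - 2)))" for n
  proof -
    have "fps_const (?q^2) * H = fps_X * E H + fps_X^2 * (fps_const (?q^4) * E f)"
      using assms(1) by (simp add: reduced_system_def fps_const_power mult.assoc)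
    from arg_cong[OF this, of "\<lambda>h. fps_nth h n"] show ?thesis
      by (simp add: fps_X_power_mult_nth)
  qed
  have "fps_nth f n = 0 \<and> fps_nth g n = 0 \<and> fps_nth H n = 0" for n
  proof (induction n rule: less_induct)
    case (less n)
    have IH: "fps_nth f m = 0" "fps_nth g m = 0" "fps_nth H m = 0" if "m < n" for m
      using less[OF that] by auto
    have H: "fps_nth H n = 0" using e1[of n] IH by (cases n) (auto split: if_splits)
    have X0: "fps_nth (fps_X * a * k) n = 0" if "\<And>m. m < n \<Longrightarrow> fps_nth k m = 0" for a k :: "rat fls fps"
    proof -
      have "fps_nth (a * k) (n - 1) = 0" if "n > 0"
        unfolding fps_mult_nth by (rule sum.neutral) (use that \<open>\<And>m. m < n \<Longrightarrow> fps_nth k m = 0\<close> in auto)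
      then show ?thesis by (cases "n = 0") (auto simp: mult.assoc)
    qed
    have f: "fps_nth f n = 0"
    proof (cases "n = 0")
      case False
      have "fps_const (?q^4) * (f - E f) = E (E H) + fps_X * qf^6 * E g - fps_X * (fps_X * qf^9) * E (E g)
         + fps_X * (fps_X * qf^8) * E (E f) + fps_X * qf^7 * E (E g)"
        using assms(1) unfolding reduced_system_def fps_const_power[symmetric] by algebra
      moreover have "fps_nth (fps_X * qf^6 * E g) n = 0" "fps_nth (fps_X * (fps_X * qf^9) * E (E g)) n = 0"
        "fps_nth (fps_X * (fps_X * qf^8) * E (E f)) n = 0" "fps_nth (fps_X * qf^7 * E (E g)) n = 0"
        by (rule X0, use IH in simp)+
      ultimately have "fps_nth (fps_const (?q^4) * (f - E f)) n = 0"
        by (simp add: H)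
      then have "?q^4 * (fps_nth f n - (?q^2)^n * fps_nth f n) = 0" by simp
      then have "(1 - ?q^(2 * n)) * fps_nth f n = 0" by (simp add: power_mult left_diff_distrib)
      then show ?thesis using one_minus_X_power_neq_0[of "2 * n"] False by simp
    qed (use assms(2) in simp)
    have "fps_nth g n = 0"
    proof -
      have "g = fps_X * (qf + qf^2) * E g + fps_X * (qf^3 * (1 - fps_X * qf^2)) * E (E g) + E f"
        using assms(1) unfolding reduced_system_def by algebra
      from arg_cong[OF this, of "\<lambda>h. fps_nth h n"] show ?thesis
        using X0[of "E g" "qf + qf^2"] X0[of "E (E g)" "qf^3 * (1 - fps_X * qf^2)"] IH f
        by (simp only: fps_add_nth xscale_nth mult_zero_right add_0)
    qed
    then show ?case using f H by blast
  qed
  then show ?thesis by (simp add: fps_eq_iff)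
qed

lemma reduced_system_unique:
  assumes "reduced_system f g H" "reduced_system f' g' H'" "fps_nth f 0 = fps_nth f' 0"
  shows "f = f'" "g = g'" "H = H'"
proof -
  have "reduced_system (f - f') (g - g') (H - H')"
    unfolding reduced_system_def xscale_diff
  proof (intro conjI)
    note a = assms(1)[unfolded reduced_system_def] and b = assms(2)[unfolded reduced_system_def]
    show "qf^2 * (H - H') = fps_X * (E H - E H') + fps_X^2 * qf^4 * (E f - E f')"
      using a[THEN conjunct1] b[THEN conjunct1] by algebra
    show "g - g' = (fps_X * qf + fps_X * qf^2) * (E g - E g') +
      fps_X * qf^3 * (1 - fps_X * qf^2) * (E (E g) - E (E g')) + (E f - E f')"
      using a[THEN conjunct2, THEN conjunct1] b[THEN conjunct2, THEN conjunct1] by algebra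
    show "qf^4 * (f - f' - (E f - E f') - fps_X * qf^2 * (E g - E g' - fps_X * qf^3 * (E (E g) - E (E g')))
       - fps_X^2 * qf^4 * (E (E f) - E (E f')) - fps_X * qf^3 * (E (E g) - E (E g'))) = E (E H) - E (E H')"
      unfolding a[THEN conjunct2, THEN conjunct2, symmetric] b[THEN conjunct2, THEN conjunct2, symmetric]
      by algebra
  qed
  then have "f - f' = 0 \<and> g - g' = 0 \<and> H - H' = 0"
    by (rule reduced_system_zero) (use assms(3) in simp)
  then show "f = f'" "g = g'" "H = H'" by auto
qed

text \<open>Multiplication by q^a clears negative powers of q and brings the contiguity relations
  into the form of the premises of the certificates.\<close>

lemma S_rel_qf:
  assumes "P = fps_X ^ d * fps_const (qpow e) * R" "int a + e = int b"
  shows "qf ^ a * P = fps_X ^ d * qf ^ b * R"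
proof -
  have "fps_const (qpow (int b)) = fps_const (qpow (int a)) * fps_const (qpow e)"
    unfolding assms(2)[symmetric] qpow_add by simp
  then show ?thesis unfolding assms(1) qpow_of_nat fps_const_power[symmetric] by (simp add: mult_ac)
qed

lemmas S_rel_i = S_rel_qf[OF S_fps_rel_i]
lemmas S_rel_j = S_rel_qf[OF S_fps_rel_j]
lemmas S_rel_k = S_rel_qf[OF S_fps_rel_k]
lemmas S_rel_l = S_rel_qf[where d = 1, unfolded power_one_right, OF S_fps_rel_l]

section \<open>The quadruple sums solve the reduced system\<close>

lemma qf_neq_0: "qf \<noteq> 0"
  by simp

context
  notes fps_const_power [simp del]
begin

lemmas S_cert_1 = quad_cert_1[OF qf_neq_0 fps_X_neq_zero
    S_rel_i[of 4 "-8" 0 "-12" "-8" "-4", simplified]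
    S_rel_i[of 2 "-6" 0 "-10" "-8" "-4", simplified]
    S_rel_i[of 0 "-4" 0 "-6" "-4" "-2", simplified]
    S_rel_i[of 0 "-2" 2 "-2" "-2" "-1", simplified]
    S_rel_j[of 0 "-12" 0 "-6" "-8" "-4", simplified]
    S_rel_j[of 0 "-10" 2 "-4" "-6" "-3", simplified]
    S_rel_j[of 0 "-6" 6 "-2" "-4" "-2", simplified]
    S_rel_j[of 0 "-4" 8 "-2" "-2" "-1", simplified]
    S_rel_j[of 0 2 14 2 2 1, simplified]
    S_rel_k[of 2 "-8" 0 "-4" "-10" "-4", simplified]
    S_rel_k[of 1 "-7" 0 "-4" "-10" "-3", simplified]
    S_rel_k[of 0 "-4" 2 "-2" "-4" "-2", simplified]
    S_rel_k[of 0 "-3" 3 "-2" "-4" "-1", simplified]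
    S_rel_k[of 0 "-2" 4 0 "-2" "-1", simplified]
    S_rel_k[of 0 0 6 2 2 0, simplified]
    S_rel_k[of 0 1 7 2 2 1, simplified]
    S_rel_k[of 0 2 8 2 4 1, simplified]
    S_rel_k[of 0 6 12 6 10 3, simplified]
    S_rel_l[of 2 "-4" 0 "-4" "-10" "-7", simplified]
    S_rel_l[of 0 "-2" 0 "-2" "-4" "-3", simplified]
    S_rel_l[of 0 "-1" 1 0 "-2" "-1", simplified]
    S_rel_l[of 0 0 2 2 2 1, simplified]
    S_rel_l[of 0 1 3 2 4 3, simplified]
    S_rel_l[of 0 3 5 6 10 7, simplified]]

lemmas S_cert_2 = quad_cert_2[OF qf_neq_0 fps_X_neq_zero
    S_rel_i[of 0 0 4 "-2" "-2" "-1", simplified]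
    S_rel_i[of 0 0 4 0 "-1" "-1", simplified]
    S_rel_i[of 0 0 4 0 0 0, simplified]
    S_rel_i[of 0 2 6 4 2 1, simplified]
    S_rel_j[of 0 "-2" 10 0 "-1" "-1", simplified]
    S_rel_j[of 0 "-2" 10 2 "-1" "-1", simplified]
    S_rel_j[of 0 2 14 2 2 1, simplified]
    S_rel_j[of 0 4 16 4 3 1, simplified]
    S_rel_j[of 0 8 20 6 6 3, simplified]
    S_rel_k[of 0 "-2" 4 0 "-2" "-1", simplified]
    S_rel_k[of 0 "-2" 4 2 "-2" "-1", simplified]
    S_rel_k[of 0 "-1" 5 2 0 "-1", simplified]
    S_rel_k[of 0 1 7 2 2 1, simplified]
    S_rel_k[of 0 2 8 4 4 1, simplified]
    S_rel_k[of 0 3 9 4 6 1, simplified]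
    S_rel_k[of 0 5 11 6 8 3, simplified]
    S_rel_k[of 0 6 12 6 10 3, simplified]
    S_rel_k[of 0 7 13 8 12 3, simplified]
    S_rel_k[of 0 9 15 10 14 5, simplified]
    S_rel_k[of 0 10 16 10 16 5, simplified]
    S_rel_l[of 0 "-1" 1 2 0 0, simplified]
    S_rel_l[of 0 0 2 2 2 1, simplified]
    S_rel_l[of 0 1 3 4 6 4, simplified]
    S_rel_l[of 0 2 4 6 8 5, simplified]
    S_rel_l[of 0 3 5 6 10 7, simplified]
    S_rel_l[of 0 3 5 8 12 8, simplified]
    S_rel_l[of 0 4 6 10 14 9, simplified]
    S_rel_l[of 0 5 7 10 16 11, simplified]
    S_rel_l[of 0 7 9 14 22 15, simplified]]

lemmas S_cert_3 = quad_cert_3[OF qf_neq_0 fps_X_neq_zero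
    S_rel_i[of 0 8 12 14 9 5, simplified]
    S_rel_i[of 0 12 16 22 15 8, simplified]
    S_rel_j[of 0 4 16 4 3 1, simplified]
    S_rel_j[of 0 10 22 8 7 3, simplified]
    S_rel_k[of 0 2 8 4 4 1, simplified]
    S_rel_k[of 0 3 9 4 6 2, simplified]
    S_rel_k[of 0 6 12 8 10 3, simplified]
    S_rel_k[of 0 7 13 8 12 3, simplified]
    S_rel_k[of 0 17 23 16 26 9, simplified]
    S_rel_l[of 0 1 3 4 6 3, simplified]
    S_rel_l[of 0 3 5 8 12 8, simplified]
    S_rel_l[of 0 4 6 10 14 9, simplified]
    S_rel_l[of 0 11 13 20 34 23, simplified]]

end

definition S_f :: "rat fls fps" where
  "S_f = S_fps 0 0 0 0"

definition S_g :: "rat fls fps" where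
  "S_g = S_fps 0 (- 2) (- 2) (- 1) - S_fps 0 0 0 0 + S_fps 2 2 1 0"

text \<open>This is x^2 q^2 times the combination claimed for F_4. Its divisibility by x^2 is not
  visible here; it follows from \<open>reduced_system_unique\<close>.\<close>

definition S_h :: "rat fls fps" where
  "S_h = qf^4 * S_fps (- 8) (- 12) (- 8) (- 4) - fps_X * qf^2 * S_fps (- 2) (- 4) (- 3) (- 2)
     - fps_X^2 * S_fps 0 0 0 0 - qf^4 * S_fps (- 4) (- 8) (- 6) (- 3)"

lemma S_reduced: "reduced_system S_f S_g S_h"
proof -
  let ?x = "fps_X :: rat fls fps"
  have Ef: "E S_f = S_fps 4 6 4 2" unfolding S_f_def by (simp add: xscale_S_fps)
  have EEf: "E (E S_f) = S_fps 8 12 8 4" unfolding Ef by (simp add: xscale_S_fps)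
  have Eg: "E S_g = S_fps 4 4 2 1 - S_fps 4 6 4 2 + S_fps 6 8 5 2"
    unfolding S_g_def by (simp add: xscale_S_fps E_simps)
  have EEg: "E (E S_g) = S_fps 8 10 6 3 - S_fps 8 12 8 4 + S_fps 10 14 9 4"
    unfolding Eg by (simp add: xscale_S_fps E_simps)
  have S: "E (S_fps (- 8) (- 12) (- 8) (- 4)) = S_fps (- 4) (- 6) (- 4) (- 2)"
    "E (S_fps (- 4) (- 6) (- 4) (- 2)) = S_fps 0 0 0 0"
    "E (S_fps (- 2) (- 4) (- 3) (- 2)) = S_fps 2 2 1 0" "E (S_fps 2 2 1 0) = S_fps 6 8 5 2"
    "E (S_fps 0 0 0 0) = S_fps 4 6 4 2" "E (S_fps 4 6 4 2) = S_fps 8 12 8 4"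
    "E (S_fps (- 4) (- 8) (- 6) (- 3)) = S_fps 0 (- 2) (- 2) (- 1)"
    "E (S_fps 0 (- 2) (- 2) (- 1)) = S_fps 4 4 2 1"
    by (simp_all add: xscale_S_fps)
  have Eh: "E S_h = qf^4 * S_fps (- 4) (- 6) (- 4) (- 2) - ?x * qf^4 * S_fps 2 2 1 0
      - ?x^2 * qf^4 * S_fps 4 6 4 2 - qf^4 * S_fps 0 (- 2) (- 2) (- 1)"
    unfolding S_h_def xscale_diff xscale_mult xscale_power E_X E_qf S by algebra
  have EEh: "E (E S_h) = qf^4 * S_fps 0 0 0 0 - ?x * qf^6 * S_fps 6 8 5 2
      - ?x^2 * qf^8 * S_fps 8 12 8 4 - qf^4 * S_fps 4 4 2 1"
    unfolding Eh xscale_diff xscale_mult xscale_power E_X E_qf S by algebra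
  show ?thesis
    unfolding reduced_system_def EEh EEf EEg unfolding Eh Ef Eg
    unfolding S_f_def S_g_def S_h_def
    using S_cert_1 S_cert_2 S_cert_3 by blast
qed

section \<open>Recurrences for the coefficients\<close>

definition qs :: "nat \<Rightarrow> rat fls" where
  "qs n = qpoch (fls_X ^ 2) (fls_X ^ 2) n"

lemma qs_neq_0 [simp]: "qs n \<noteq> 0"
  unfolding qs_def by (rule qpoch_X_neq_0) simp

lemma qs_0 [simp]: "qs 0 = 1"
  by (simp add: qs_def qpoch_def)

lemma qs_Suc: "qs (Suc n) = qs n * (1 - fls_X ^ (2 * Suc n))"
  by (simp add: qs_def qpoch_Suc power_mult[symmetric] power_add[symmetric])

text \<open>By Euler this is \<open>1 / (x; q\<^sup>2)\<^sub>\<infinity>\<close>. The products of \<open>F\<^sub>7\<close>, \<open>F\<^sub>3\<close> and \<open>F\<^sub>4\<close> with it satisfy functional equations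
  whose coefficient recurrences have order one.\<close>

definition expq :: "rat fls fps" where
  "expq = Abs_fps (\<lambda>m. inverse (qs m))"

lemma expq_nth: "fps_nth expq m = inverse (qs m)"
  by (simp add: expq_def)

lemma X_mult_nth_Suc: "fps_nth (fps_X * (f :: 'a::comm_ring_1 fps)) (Suc m) = fps_nth f m"
  by simp

text \<open>The infinite product (x;q^2)_inf loses its first factor 1 - x under x -> x q^2. On
  coefficients this is the recurrence \<open>qs_Suc\<close>.\<close>

lemma E_expq: "E expq = (1 - fps_X) * expq"
proof (intro fps_ext)
  fix m
  have eq: "(1 - fps_X) * expq = expq - fps_X * expq" by algebra
  show "fps_nth (E expq) m = fps_nth ((1 - fps_X) * expq) m"
  proof (cases m)
    case (Suc n)
    have "inverse (qs (Suc n)) * (1 - fls_X ^ (2 * Suc n)) = inverse (qs n)"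
      using qs_neq_0[of "Suc n"] unfolding qs_Suc by (simp add: field_simps)
    moreover have "t * i = i - i'" if "i * (1 - t) = i'" for i i' t :: "rat fls"
      using that by (auto simp: algebra_simps)
    ultimately show ?thesis
      unfolding Suc eq fps_sub_nth X_mult_nth_Suc xscale_nth expq_nth power_mult[symmetric] by blast
  qed (simp add: left_diff_distrib expq_nth)
qed

lemma EE_expq: "E (E expq) = (1 - qf^2 * fps_X) * E expq"
proof -
  have "E (E expq) = E ((1 - fps_X) * expq)" by (simp only: E_expq)
  also have "\<dots> = (E 1 - E fps_X) * E expq" by (simp only: xscale_mult xscale_diff)
  finally show ?thesis by (simp only: E_1 E_X)
qed

lemma EE_expq': "E (E expq) = (1 - qf^2 * fps_X) * (1 - fps_X) * expq"
  by (subst EE_expq, subst E_expq) (simp only: mult.assoc)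

text \<open>Each application of \<open>E\<close> to \<open>expq\<close> produces one more factor 1 -
  q^(2i) x, and these factors absorb the polynomial coefficients of the equations for f and g. What
  results has degree one in x.\<close>

lemma damped_system:
  assumes h: "h = fps_X * qf^2 * E h + E f"
    and g: "g = (fps_X * qf + fps_X * qf^2) * E g + fps_X * qf^3 * (1 - fps_X * qf^2) * E (E g) + E f"
    and f: "f - E f - fps_X * qf^2 * (E g - fps_X * qf^3 * E (E g)) - fps_X^2 * qf^4 * E (E f)
       - fps_X * qf^3 * E (E g) = fps_X^2 * qf^6 * E (E h)"
  defines "\<phi> \<equiv> expq * f" and "\<gamma> \<equiv> expq * g" and "\<eta> \<equiv> expq * h"
  shows "(1 - fps_X) * \<eta> = fps_X * qf^2 * E \<eta> + E \<phi>"
    "(1 - fps_X) * \<gamma> = fps_X * qf * (1 + qf) * E \<gamma> + fps_X * qf^3 * E (E \<gamma>) + E \<phi>"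
    "(1 - fps_X) * \<phi> = E \<phi> + fps_X * qf^2 * E \<gamma> + fps_X * qf^3 * E (E \<gamma>) + fps_X * qf^2 * E \<eta>
       - fps_X * qf^2 * E (E \<phi>)"
proof -
  let ?x = "fps_X :: rat fls fps"
  note e = E_expq and ee = EE_expq
  show 1: "(1 - ?x) * \<eta> = ?x * qf^2 * E \<eta> + E \<phi>"
    unfolding \<eta>_def \<phi>_def xscale_mult e using h by algebra
  note ee' = EE_expq'
  show 2: "(1 - ?x) * \<gamma> = ?x * qf * (1 + qf) * E \<gamma> + ?x * qf^3 * E (E \<gamma>) + E \<phi>"
    unfolding \<gamma>_def \<phi>_def xscale_mult ee' unfolding e using g by algebra
  \<comment> \<open>The shifted first equation serves to eliminate the x^2 term with E (E \<eta>);
    afterwards every term of the third equation contains the factor 1 - q^2 x.\<close>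
  have "E ((1 - ?x) * \<eta>) = E (?x * qf^2 * E \<eta> + E \<phi>)" unfolding 1 ..
  then have E1: "(1 - qf^2 * ?x) * E \<eta> = qf^4 * ?x * E (E \<eta>) + E (E \<phi>)"
    unfolding xscale_mult xscale_add xscale_diff E_X E_qf E_1 by algebra
  have "E (E expq) * (f - E f - ?x * qf^2 * (E g - ?x * qf^3 * E (E g)) - ?x^2 * qf^4 * E (E f)
       - ?x * qf^3 * E (E g)) = E (E expq) * (?x^2 * qf^6 * E (E h))" unfolding f ..
  then have "(1 - qf^2 * ?x) * (1 - ?x) * \<phi> - (1 - qf^2 * ?x) * E \<phi> - ?x * qf^2 * ((1 - qf^2 * ?x) * E \<gamma> - ?x * qf^3 * E (E \<gamma>))
     - ?x^2 * qf^4 * E (E \<phi>) - ?x * qf^3 * E (E \<gamma>) = ?x^2 * qf^6 * E (E \<eta>)"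
    unfolding \<gamma>_def \<phi>_def \<eta>_def xscale_mult ee' unfolding e by algebra
  with E1 have "(1 - qf^2 * ?x) * ((1 - ?x) * \<phi>) = (1 - qf^2 * ?x) *
     (E \<phi> + ?x * qf^2 * E \<gamma> + ?x * qf^3 * E (E \<gamma>) + ?x * qf^2 * E \<eta> - ?x * qf^2 * E (E \<phi>))"
    by algebra
  moreover have "1 - qf^2 * ?x \<noteq> 0"
  proof
    assume "1 - qf^2 * ?x = 0"
    then have "fps_nth (1 - qf^2 * ?x) 0 = fps_nth 0 0" by (simp only:)
    then show False by simp
  qed
  ultimately show "(1 - ?x) * \<phi> = E \<phi> + ?x * qf^2 * E \<gamma> + ?x * qf^3 * E (E \<gamma>) + ?x * qf^2 * E \<eta>
       - ?x * qf^2 * E (E \<phi>)"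
    by simp
qed

text \<open>This is (-q;q)_(2m), the solution of the homogeneous part of the recurrence for b in
  \<open>coupled_recurrence_unique\<close>. Once it is split off, that recurrence
  telescopes.\<close>

definition poch_neg :: "nat \<Rightarrow> rat fls" where
  "poch_neg m = (\<Prod>t<2 * m. 1 + fls_X ^ Suc t)"

lemma poch_neg_Suc: "poch_neg (Suc m) = poch_neg m * (1 + fls_X ^ (2 * m + 1)) * (1 + fls_X ^ (2 * m + 2))"
  by (simp add: poch_neg_def mult_ac)

section \<open>Coefficient recurrences of order one\<close>

lemma coupled_recurrence_unique:
  fixes a b c a' b' c' :: "nat \<Rightarrow> rat fls"
  defines "rec \<equiv> \<lambda>a b c. \<forall>m. a (Suc m) * (1 - fls_X ^ (2 * m + 2)) =
      (1 - fls_X ^ (4 * m + 2)) * a m + fls_X ^ (2 * m + 2) * (1 + fls_X ^ (2 * m + 1)) * b m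
        + fls_X ^ (2 * m + 2) * c m \<and>
    b (Suc m) = (1 + fls_X ^ (2 * m + 1)) * (1 + fls_X ^ (2 * m + 2)) * b m + fls_X ^ (2 * m + 2) * a (Suc m) \<and>
    c (Suc m) = (1 + fls_X ^ (2 * m + 2)) * c m + fls_X ^ (2 * m + 2) * a (Suc m)"
  assumes "rec a b c" "rec a' b' c'" "a 0 = a' 0" "b 0 = b' 0" "c 0 = c' 0"
  shows "a m = a' m \<and> b m = b' m \<and> c m = c' m"
proof (induction m)
  case (Suc m)
  have ne: "1 - fls_X ^ (2 * m + 2) \<noteq> (0 :: rat fls)" by (rule one_minus_X_power_neq_0) simp
  have "a (Suc m) * (1 - fls_X ^ (2 * m + 2)) = a' (Suc m) * (1 - fls_X ^ (2 * m + 2))"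
    using assms(2,3) Suc unfolding rec_def by simp
  then have "a (Suc m) = a' (Suc m)" using ne by simp
  then show ?case using assms(2,3) Suc unfolding rec_def by simp
qed (use assms in auto)

lemma X_power_split:
  "((fls_X :: rat fls)^2)^m = fls_X ^ (2 * m)" "((fls_X :: rat fls)^2) ^ Suc m = fls_X ^ (2 * m) * fls_X^2"
  "(fls_X :: rat fls) ^ (2 * m + 2) = fls_X ^ (2 * m) * fls_X ^ 2"
  "(fls_X :: rat fls) ^ (2 * m + 1) = fls_X ^ (2 * m) * fls_X"
  "(fls_X :: rat fls) ^ (4 * m + 2) = fls_X ^ (2 * m) * fls_X ^ (2 * m) * fls_X ^ 2"
proof -
  have "4 * m + 2 = 2 * m + 2 * m + 2" by simp
  then show "(fls_X :: rat fls) ^ (4 * m + 2) = fls_X ^ (2 * m) * fls_X ^ (2 * m) * fls_X ^ 2"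
    by (simp only: power_add)
  show "(fls_X :: rat fls) ^ (2 * m + 1) = fls_X ^ (2 * m) * fls_X"
    by (simp only: power_add power_one_right)
qed (simp_all only: power_mult power_Suc2 power_add)

lemma damped_recurrence:
  assumes "(1 - fps_X) * \<eta> = fps_X * qf^2 * E \<eta> + E \<phi>"
    "(1 - fps_X) * \<gamma> = fps_X * qf * (1 + qf) * E \<gamma> + fps_X * qf^3 * E (E \<gamma>) + E \<phi>"
    "(1 - fps_X) * \<phi> = E \<phi> + fps_X * qf^2 * E \<gamma> + fps_X * qf^3 * E (E \<gamma>) + fps_X * qf^2 * E \<eta>
       - fps_X * qf^2 * E (E \<phi>)"
  shows "fps_nth \<phi> (Suc m) * (1 - fls_X ^ (2 * m + 2)) =
      (1 - fls_X ^ (4 * m + 2)) * fps_nth \<phi> m + fls_X ^ (2 * m + 2) * (1 + fls_X ^ (2 * m + 1)) * fps_nth \<gamma> m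
        + fls_X ^ (2 * m + 2) * fps_nth \<eta> m" (is ?A)
    "fps_nth \<gamma> (Suc m) = (1 + fls_X ^ (2 * m + 1)) * (1 + fls_X ^ (2 * m + 2)) * fps_nth \<gamma> m + fls_X ^ (2 * m + 2) * fps_nth \<phi> (Suc m)" (is ?B)
    "fps_nth \<eta> (Suc m) = (1 + fls_X ^ (2 * m + 2)) * fps_nth \<eta> m + fls_X ^ (2 * m + 2) * fps_nth \<phi> (Suc m)" (is ?C)
    "fps_nth \<gamma> 0 = fps_nth \<phi> 0" "fps_nth \<eta> 0 = fps_nth \<phi> 0"
proof -
  let ?q = "fls_X :: rat fls"
  define y where "y = ?q ^ (2 * m)"
  note p = X_power_split[of m, folded y_def]
  have "\<phi> = E \<phi> + fps_X * (\<phi> + fps_const (?q^2) * E \<gamma> + fps_const (?q^3) * E (E \<gamma>) + fps_const (?q^2) * E \<eta> - fps_const (?q^2) * E (E \<phi>))"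
    using assms(3) unfolding fps_const_power[symmetric] by algebra
  from arg_cong[OF this, of "\<lambda>f. fps_nth f (Suc m)"]
  have "fps_nth \<phi> (Suc m) = (?q^2) ^ Suc m * fps_nth \<phi> (Suc m) + (fps_nth \<phi> m + ?q^2 * ((?q^2)^m * fps_nth \<gamma> m)
     + ?q^3 * ((?q^2)^m * ((?q^2)^m * fps_nth \<gamma> m)) + ?q^2 * ((?q^2)^m * fps_nth \<eta> m) - ?q^2 * ((?q^2)^m * ((?q^2)^m * fps_nth \<phi> m)))"
    unfolding fps_add_nth X_mult_nth_Suc by (simp del: power_Suc)
  then show ?A unfolding p by algebra
  have "\<gamma> = E \<phi> + fps_X * (\<gamma> + fps_const ?q * E \<gamma> + fps_const (?q^2) * E \<gamma> + fps_const (?q^3) * E (E \<gamma>))"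
    using assms(2) unfolding fps_const_power[symmetric] by algebra
  note g = arg_cong[OF this, of "\<lambda>f. fps_nth f n" for n]
  have "fps_nth \<gamma> (Suc m) = (?q^2) ^ Suc m * fps_nth \<phi> (Suc m) + (fps_nth \<gamma> m + ?q * ((?q^2)^m * fps_nth \<gamma> m) + ?q^2 * ((?q^2)^m * fps_nth \<gamma> m)
     + ?q^3 * ((?q^2)^m * ((?q^2)^m * fps_nth \<gamma> m)))"
    using g[of "Suc m"] unfolding fps_add_nth X_mult_nth_Suc by (simp del: power_Suc)
  then show ?B unfolding p by algebra
  show "fps_nth \<gamma> 0 = fps_nth \<phi> 0" using g[of 0] by simp
  have "\<eta> = E \<phi> + fps_X * (\<eta> + fps_const (?q^2) * E \<eta>)"
    using assms(1) unfolding fps_const_power[symmetric] by algebra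
  note h = arg_cong[OF this, of "\<lambda>f. fps_nth f n" for n]
  have "fps_nth \<eta> (Suc m) = (?q^2) ^ Suc m * fps_nth \<phi> (Suc m) + (fps_nth \<eta> m + ?q^2 * ((?q^2)^m * fps_nth \<eta> m))"
    using h[of "Suc m"] unfolding fps_add_nth X_mult_nth_Suc by (simp del: power_Suc)
  then show ?C unfolding p by algebra
  show "fps_nth \<eta> 0 = fps_nth \<phi> 0" using h[of 0] by simp
qed

section \<open>An explicit solution of the recurrences\<close>

definition delta :: "nat \<Rightarrow> rat fls" where
  "delta n = (- 1) ^ n * fls_X ^ (n\<^sup>2) * qpoch fls_X (fls_X ^ 2) n"

text \<open>Here \<open>delta\<close> is the weight of Bailey's lemma in base q^2 with a = 1, rho_1
  = q and rho_2 tending to infinity, and the reciprocal of \<open>qs (2 * n)\<close> is the beta_n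
  of the first pair in \<open>bailey_pair\<close>.\<close>

definition useq :: "nat \<Rightarrow> rat fls" where
  "useq n = delta n / qs (2 * n)"

lemma delta_Suc: "delta (Suc n) = - delta n * fls_X ^ (2 * n + 1) * (1 - fls_X ^ (2 * n + 1))"
proof -
  have "(Suc n)\<^sup>2 = n\<^sup>2 + (2 * n + 1)" by (simp add: power2_eq_square)
  then have pw: "fls_X ^ (Suc n)\<^sup>2 = (fls_X ^ n\<^sup>2 * fls_X ^ (2 * n + 1) :: rat fls)"
    by (simp only: power_add)
  have e: "fls_X * (fls_X ^ 2) ^ n = (fls_X ^ (2 * n + 1) :: rat fls)"
    by (simp only: power_mult[symmetric] power_add power_one_right mult.commute)
  have gen: "(- 1 * s) * (A * B) * (C * (1 - B)) = - (s * A * C) * B * (1 - B)" for s A B C :: "rat fls"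
    by algebra
  show ?thesis unfolding delta_def qpoch_Suc pw e power_Suc by (rule gen)
qed

text \<open>The factor 1 - q^(2n+1) from \<open>delta\<close> cancels one half of 1 - q^(4n+2) in
  \<open>qs\<close>, which leaves 1 + q^(2n+1).\<close>

lemma useq_Suc:
  "useq (Suc n) * ((1 - fls_X ^ (4 * n + 4)) * (1 + fls_X ^ (2 * n + 1))) = - (fls_X ^ (2 * n + 1) * useq n)"
proof -
  let ?q = "fls_X :: rat fls"
  have q: "qs (2 * Suc n) = qs (2 * n) * ((1 - ?q ^ (2 * n + 1)) * (1 + ?q ^ (2 * n + 1))) * (1 - ?q ^ (4 * n + 4))"
  proof -
    have e: "2 * Suc n = Suc (Suc (2 * n))" "2 * Suc (2 * n) = (2 * n + 1) + (2 * n + 1)"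
      "2 * Suc (Suc (2 * n)) = 4 * n + 4" by simp_all
    have "?q ^ (2 * Suc (2 * n)) = ?q ^ (2 * n + 1) * ?q ^ (2 * n + 1)" unfolding e(2) by (rule power_add)
    moreover have "(1 - a) * (1 + a) = 1 - a * a" for a :: "rat fls" by algebra
    ultimately show ?thesis unfolding e(1) qs_Suc e(3) by simp
  qed
  have ne: "qs (2 * Suc n) \<noteq> 0" "qs (2 * n) \<noteq> 0" by simp_all
  then have "(1 - ?q ^ (2 * n + 1)) \<noteq> 0" "(1 + ?q ^ (2 * n + 1)) \<noteq> 0" "1 - ?q ^ (4 * n + 4) \<noteq> 0"
    unfolding q by auto
  with ne show ?thesis unfolding useq_def delta_Suc q
    by (simp add: field_simps del: power_Suc)
qed

definition Useries :: "rat fls fps" where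
  "Useries = Abs_fps useq"

text \<open>The bracket is the beta_n factor of the third pair in \<open>bailey_pair\<close>.
  Integer powers are used because q^(2n-2) and q^(6n-2) have a pole at n = 0, where they cancel and
  leave the value 1.\<close>

definition vseq :: "nat \<Rightarrow> rat fls" where
  "vseq n = (qpow (2 * int n) + qpow (2 * int n - 2) - qpow (6 * int n - 2)) * useq n"

definition Vseries :: "rat fls fps" where
  "Vseries = Abs_fps vseq"

text \<open>The term ratio \<open>useq_Suc\<close> written as a q-difference equation: a factor
  q^(2n) on the n-th coefficient is one application of \<open>E\<close>. With y = q^(2n), the cubic
  q + y - q y^2 - y^3 is q (1 - y^2) (1 + y/q).\<close>

lemma Useries_eq: "qf * Useries + E Useries - qf * E (E Useries) - E (E (E Useries)) = - (qf^2 * fps_X * E Useries)"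
proof (intro fps_ext)
  fix n
  let ?q = "fls_X :: rat fls"
  have qq: "qf^2 * fps_X * E Useries = fps_X * (fps_const (?q^2) * E Useries)"
    by (simp add: fps_const_power mult_ac)
  show "fps_nth (qf * Useries + E Useries - qf * E (E Useries) - E (E (E Useries))) n = fps_nth (- (qf^2 * fps_X * E Useries)) n"
  proof (cases n)
    case (Suc m)
    have "?q * useq (Suc m) + ?q ^ (2 * Suc m) * useq (Suc m) - ?q * (?q ^ (2 * Suc m) * (?q ^ (2 * Suc m) * useq (Suc m)))
       - ?q ^ (2 * Suc m) * (?q ^ (2 * Suc m) * (?q ^ (2 * Suc m) * useq (Suc m))) =
       ?q * (useq (Suc m) * ((1 - ?q ^ (4 * m + 4)) * (1 + ?q ^ (2 * m + 1))))"
    proof -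
      have "?q ^ (2 * Suc m) = ?q * ?q ^ (2 * m + 1)" "?q ^ (4 * m + 4) = ?q * ?q ^ (2 * m + 1) * (?q * ?q ^ (2 * m + 1))"
      proof -
        have "2 * Suc m = 1 + (2 * m + 1)" "4 * m + 4 = (1 + (2 * m + 1)) + (1 + (2 * m + 1))" by simp_all
        then show "?q ^ (2 * Suc m) = ?q * ?q ^ (2 * m + 1)"
          "?q ^ (4 * m + 4) = ?q * ?q ^ (2 * m + 1) * (?q * ?q ^ (2 * m + 1))"
          by (simp_all only: power_add power_one_right)
      qed
      moreover have "x * u + x * a * u - x * (x * a * (x * a * u)) - x * a * (x * a * (x * a * u)) =
          x * (u * ((1 - x * a * (x * a)) * (1 + a)))" for x a u :: "rat fls" by algebra
      ultimately show ?thesis by (simp only:)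
    qed
    also have "\<dots> = - (?q ^ 2 * (?q ^ (2 * m) * useq m))"
      unfolding useq_Suc by (simp add: power2_eq_square mult_ac)
    finally show ?thesis
      unfolding qq Suc fps_neg_nth X_mult_nth_Suc
      by (simp add: Useries_def power_mult[symmetric] del: power_Suc mult_Suc_right)
  next
    case 0
    then show ?thesis unfolding qq by (simp add: Useries_def)
  qed
qed

lemma qpow_2: "qpow 2 = fls_X ^ 2"
  using qpow_of_nat[of 2] by simp

lemma Vseries_eq: "qf^2 * Vseries = (qf^2 + 1) * E Useries - E (E (E Useries))"
proof (intro fps_ext)
  fix n
  let ?q = "fls_X :: rat fls"
  have a: "(qf^2 + 1) * E Useries = fps_const (?q^2) * E Useries + E Useries"
    by (simp add: fps_const_power algebra_simps)
  have "?q^2 * vseq n = (qpow 2 * qpow (2 * int n) + qpow 2 * qpow (2 * int n - 2) - qpow 2 * qpow (6 * int n - 2)) * useq n"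
    by (simp add: vseq_def qpow_2 algebra_simps)
  also have "\<dots> = (qpow 2 * qpow (int (2 * n)) + qpow (int (2 * n)) - qpow (int (2 * n) + int (2 * n) + int (2 * n))) * useq n"
    unfolding qpow_add[symmetric] by (simp add: algebra_simps)
  also have "\<dots> = (?q^2 * ?q ^ (2 * n) + ?q ^ (2 * n) - ?q ^ (2 * n) * ?q ^ (2 * n) * ?q ^ (2 * n)) * useq n"
    unfolding qpow_add qpow_of_nat qpow_2 ..
  finally have "?q^2 * vseq n = (?q^2 * ?q ^ (2 * n) + ?q ^ (2 * n) - ?q ^ (2 * n) * ?q ^ (2 * n) * ?q ^ (2 * n)) * useq n" .
  then show "fps_nth (qf^2 * Vseries) n = fps_nth ((qf^2 + 1) * E Useries - E (E (E Useries))) n"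
    unfolding a by (simp add: fps_const_power Vseries_def Useries_def power_mult[symmetric] algebra_simps)
qed

text \<open>This and the five identities after it hold the polynomial algebra of
  \<open>explicit_recurrence\<close>. There ui stands for the i-th \<open>E\<close>-shift of
  \<open>Useries\<close>, v and v1 for \<open>Vseries\<close> and its shift, e for
  \<open>expq\<close>, y for q^(2m), P for \<open>poch_neg m\<close>, and the remaining letters for
  single coefficients.\<close>

lemma explicit_recurrence_aux_1:
  fixes q :: "'a::idom"
  assumes "q * u1 + u2 - q * u3 - u4 = - (q^2 * (q^2 * x) * u2)"
    and "q^2 * v = (q^2 + 1) * u1 - u3" "q^2 * v1 = (q^2 + 1) * u2 - u4"
  shows "q^2 * (q * v + v1) = q^2 * (q * u1 + (1 - q^2 * x) * u2)"
proof -
  have "q^2 * (q * v + v1) - q^2 * (q * u1 + (1 - q^2 * x) * u2) =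
    q * (q^2 * v - ((q^2 + 1) * u1 - u3)) + (q^2 * v1 - ((q^2 + 1) * u2 - u4)) +
    ((q * u1 + u2 - q * u3 - u4) + q^2 * (q^2 * x) * u2)" by algebra
  then show ?thesis using assms by simp
qed

lemma explicit_recurrence_aux_2:
  fixes q :: "'a::idom"
  assumes "q * u0 + u1 - q * u2 - u3 = - (q^2 * x * u1)"
    and "q * u1 + u2 - q * u3 - u4 = - (q^2 * (q^2 * x) * u2)" "q^2 * v1 = (q^2 + 1) * u2 - u4"
  shows "q^2 * u0 + q * u1 - q^2 * (1 - q^2 * x) * u2 - q * (1 - q^2 * x) * (1 - q^4 * x) * u3 =
    x^2 * q^6 * u2 + x * q^5 * (1 - q^2 * x) * u3 + x * q^4 * v1"
proof -
  have "(q^2 * u0 + q * u1 - q^2 * (1 - q^2 * x) * u2 - q * (1 - q^2 * x) * (1 - q^4 * x) * u3) -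
    (x^2 * q^6 * u2 + x * q^5 * (1 - q^2 * x) * u3 + x * q^4 * v1) =
    q * ((q * u0 + u1 - q * u2 - u3) + q^2 * x * u1) - x * q^2 * (q^2 * v1 - ((q^2 + 1) * u2 - u4)) -
    q^2 * x * ((q * u1 + u2 - q * u3 - u4) + q^2 * (q^2 * x) * u2)" by algebra
  then show ?thesis using assms by simp
qed

lemma explicit_recurrence_aux_3:
  fixes q :: "'a::idom"
  assumes "q * w' + y * q^2 * w' = q * (y * q^2 * s) + y * q^2 * (y * q^2 * s) + q * w"
  shows "q * (P * (1 + y * q) * (1 + y * q^2) * w') =
    q * ((1 + y * q^2) * (P * w) + y * q^2 * (P * (1 + y * q) * (1 + y * q^2) * s))"
proof -
  have "q * (P * (1 + y * q) * (1 + y * q^2) * w') -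
    q * ((1 + y * q^2) * (P * w) + y * q^2 * (P * (1 + y * q) * (1 + y * q^2) * s)) =
    P * (1 + y * q^2) * ((q * w' + y * q^2 * w') - (q * (y * q^2 * s) + y * q^2 * (y * q^2 * s) + q * w))"
    by algebra
  then show ?thesis using assms by simp
qed

lemma explicit_recurrence_aux_4:
  fixes q :: "'a::idom"
  assumes "q^2 * s + q * (y * q^2 * s) - q^2 * (y * q^2 * (y * q^2 * s)) - q * (y * q^2 * (y * q^2 * (y * q^2 * s))) =
     q^2 * s0 - q^4 * (y * (y * s0)) + q^4 * (y * c) + q^5 * (y * (y * c)) + q^4 * (y * w)"
  shows "q^2 * (P * (1 + y * q) * (1 + y * q^2) * s * (1 - y * q^2)) =
    q^2 * ((1 - y * y * q^2) * (P * s0) + y * q^2 * (1 + y * q) * (P * c) + y * q^2 * (P * w))"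
proof -
  have "q^2 * (P * (1 + y * q) * (1 + y * q^2) * s * (1 - y * q^2)) -
    q^2 * ((1 - y * y * q^2) * (P * s0) + y * q^2 * (1 + y * q) * (P * c) + y * q^2 * (P * w)) =
    P * ((q^2 * s + q * (y * q^2 * s) - q^2 * (y * q^2 * (y * q^2 * s)) - q * (y * q^2 * (y * q^2 * (y * q^2 * s)))) -
     (q^2 * s0 - q^4 * (y * (y * s0)) + q^4 * (y * c) + q^5 * (y * (y * c)) + q^4 * (y * w)))"
    by algebra
  then show ?thesis using assms by simp
qed

lemma explicit_recurrence_aux_5:
  fixes q :: "'a::idom"
  assumes "q^2 * (q * v + v1) = q^2 * (q * u1 + (1 - q^2 * x) * u2)"
  shows "q^2 * (q * (1 - x) * (e * v) + (1 - x) * e * v1) =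
    q^2 * (q * ((1 - x) * e * u1) + (1 - q^2 * x) * (1 - x) * e * u2)"
proof -
  have "q^2 * (q * (1 - x) * (e * v) + (1 - x) * e * v1) -
    q^2 * (q * ((1 - x) * e * u1) + (1 - q^2 * x) * (1 - x) * e * u2) =
    (1 - x) * e * (q^2 * (q * v + v1) - q^2 * (q * u1 + (1 - q^2 * x) * u2))" by algebra
  then show ?thesis using assms by simp
qed

lemma explicit_recurrence_aux_6:
  fixes q :: "'a::idom"
  assumes "q^2 * u0 + q * u1 - q^2 * (1 - q^2 * x) * u2 - q * (1 - q^2 * x) * (1 - q^4 * x) * u3 =
    x^2 * q^6 * u2 + x * q^5 * (1 - q^2 * x) * u3 + x * q^4 * v1"
  shows "q^2 * (e * u0) + q * ((1 - x) * e * u1) - q^2 * ((1 - q^2 * x) * (1 - x) * e * u2) -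
      q * ((1 - q^4 * x) * (1 - q^2 * x) * (1 - x) * e * u3) =
    x * (q^2 * (e * u0) - q^4 * ((1 - q^2 * x) * (1 - x) * e * u2) + q^4 * ((1 - x) * e * u2) +
      q^5 * ((1 - q^2 * x) * (1 - x) * e * u3) + q^4 * ((1 - x) * e * v1))"
proof -
  have "(q^2 * (e * u0) + q * ((1 - x) * e * u1) - q^2 * ((1 - q^2 * x) * (1 - x) * e * u2) -
      q * ((1 - q^4 * x) * (1 - q^2 * x) * (1 - x) * e * u3)) -
    x * (q^2 * (e * u0) - q^4 * ((1 - q^2 * x) * (1 - x) * e * u2) + q^4 * ((1 - x) * e * u2) +
      q^5 * ((1 - q^2 * x) * (1 - x) * e * u3) + q^4 * ((1 - x) * e * v1)) =
    (1 - x) * e * ((q^2 * u0 + q * u1 - q^2 * (1 - q^2 * x) * u2 - q * (1 - q^2 * x) * (1 - q^4 * x) * u3) -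
      (x^2 * q^6 * u2 + x * q^5 * (1 - q^2 * x) * u3 + x * q^4 * v1))" by algebra
  then show ?thesis using assms by simp
qed

text \<open>As for the damped series, multiplication by \<open>expq\<close> reduces the q-difference
  equations of \<open>Useries\<close> and \<open>Vseries\<close> to degree one in x. Comparing the
  coefficients of x^(m+1) and multiplying by \<open>poch_neg\<close> then gives the recurrences of
  \<open>damped_recurrence\<close>.\<close>

lemma explicit_recurrence:
  defines "a \<equiv> \<lambda>m. poch_neg m * fps_nth (expq * Useries) m"
    and "b \<equiv> \<lambda>m. poch_neg m * fps_nth (expq * E Useries) m"
    and "c \<equiv> \<lambda>m. poch_neg m * fps_nth (expq * Vseries) m"
  shows "a (Suc m) * (1 - fls_X ^ (2 * m + 2)) =
      (1 - fls_X ^ (4 * m + 2)) * a m + fls_X ^ (2 * m + 2) * (1 + fls_X ^ (2 * m + 1)) * b m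
        + fls_X ^ (2 * m + 2) * c m" (is ?A)
    "b (Suc m) = (1 + fls_X ^ (2 * m + 1)) * (1 + fls_X ^ (2 * m + 2)) * b m + fls_X ^ (2 * m + 2) * a (Suc m)" (is ?B)
    "c (Suc m) = (1 + fls_X ^ (2 * m + 2)) * c m + fls_X ^ (2 * m + 2) * a (Suc m)" (is ?C)
proof -
  let ?x = "fps_X :: rat fls fps" and ?U = Useries and ?V = Vseries and ?q = "fls_X :: rat fls"
  define \<psi> C W where "\<psi> = expq * ?U" and "C = expq * E ?U" and "W = expq * ?V"
  have e1: "E expq = (1 - ?x) * expq" by (rule E_expq)
  note e2 = EE_expq'
  have e3: "E (E (E expq)) = (1 - qf^4 * ?x) * (1 - qf^2 * ?x) * (1 - ?x) * expq"
    unfolding e2 xscale_mult xscale_diff E_X e1 E_1 E_qf by algebra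
  note U = Useries_eq
  have "E (qf * ?U + E ?U - qf * E (E ?U) - E (E (E ?U))) = E (- (qf^2 * ?x * E ?U))" unfolding U ..
  moreover have "E (- f) = - E f" for f by (simp add: fps_eq_iff)
  ultimately have EU: "qf * E ?U + E (E ?U) - qf * E (E (E ?U)) - E (E (E (E ?U))) = - (qf^2 * (qf^2 * ?x) * E (E ?U))"
    by (simp only: xscale_mult xscale_add xscale_diff E_X E_qf)
  note V = Vseries_eq
  have "E (qf^2 * ?V) = E ((qf^2 + 1) * E ?U - E (E (E ?U)))" unfolding V ..
  then have EV: "qf^2 * E ?V = (qf^2 + 1) * E (E ?U) - E (E (E (E ?U)))"
    by (simp only: xscale_mult xscale_add xscale_diff E_X E_qf E_1)
  have B: "C = E \<psi> + ?x * C" unfolding C_def \<psi>_def xscale_mult e1 by algebra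
  have qf0: "qf^2 \<noteq> 0" by simp
  have "qf^2 * (qf * (1 - ?x) * W + E W) = qf^2 * (qf * E \<psi> + E (E \<psi>))"
    unfolding W_def \<psi>_def xscale_mult e2 unfolding e1
    by (rule explicit_recurrence_aux_5[OF explicit_recurrence_aux_1[OF EU V EV]])
  then have "qf * (1 - ?x) * W + E W = qf * E \<psi> + E (E \<psi>)" using qf0 by simp
  then have Cc: "qf * W + E W = qf * E \<psi> + E (E \<psi>) + ?x * (qf * W)" by algebra
  have "qf^2 * \<psi> + qf * E \<psi> - qf^2 * E (E \<psi>) - qf * E (E (E \<psi>)) =
     ?x * (qf^2 * \<psi> - qf^4 * E (E \<psi>) + qf^4 * E C + qf^5 * E (E C) + qf^4 * E W)"
    unfolding W_def \<psi>_def C_def xscale_mult e3 unfolding e2 unfolding e1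
    by (rule explicit_recurrence_aux_6[OF explicit_recurrence_aux_2[OF U EU EV]])
  then have A: "fps_const (?q^2) * \<psi> + qf * E \<psi> - fps_const (?q^2) * E (E \<psi>) - qf * E (E (E \<psi>)) =
     ?x * (fps_const (?q^2) * \<psi> - fps_const (?q^4) * E (E \<psi>) + fps_const (?q^4) * E C + fps_const (?q^5) * E (E C) + fps_const (?q^4) * E W)"
    by (simp only: fps_const_power)
  define y where "y = ?q ^ (2 * m)"
  note p = X_power_split[of m, folded y_def]
  have q0: "?q \<noteq> 0" by simp
  let ?y = y
  have B': "fps_nth C (Suc m) = ?y * ?q^2 * fps_nth \<psi> (Suc m) + fps_nth C m"
    using arg_cong[OF B, of "\<lambda>f. fps_nth f (Suc m)"] unfolding fps_add_nth X_mult_nth_Suc xscale_nth p .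
  show ?B unfolding a_def b_def poch_neg_Suc using B' unfolding p C_def \<psi>_def
    by (simp add: algebra_simps)
  have C': "?q * fps_nth W (Suc m) + ?y * ?q^2 * fps_nth W (Suc m) =
     ?q * (?y * ?q^2 * fps_nth \<psi> (Suc m)) + ?y * ?q^2 * (?y * ?q^2 * fps_nth \<psi> (Suc m)) + ?q * fps_nth W m"
    using arg_cong[OF Cc, of "\<lambda>f. fps_nth f (Suc m)"]
    unfolding fps_add_nth X_mult_nth_Suc fps_mult_left_const_nth xscale_nth p .
  have "?q * c (Suc m) = ?q * ((1 + ?q ^ (2 * m + 2)) * c m + ?q ^ (2 * m + 2) * a (Suc m))"
    unfolding a_def c_def poch_neg_Suc using explicit_recurrence_aux_3[OF C'] unfolding p W_def \<psi>_def .
  then show ?C using q0 by simp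
  have A': "?q^2 * fps_nth \<psi> (Suc m) + ?q * (?y * ?q^2 * fps_nth \<psi> (Suc m)) - ?q^2 * (?y * ?q^2 * (?y * ?q^2 * fps_nth \<psi> (Suc m)))
     - ?q * (?y * ?q^2 * (?y * ?q^2 * (?y * ?q^2 * fps_nth \<psi> (Suc m)))) =
     ?q^2 * fps_nth \<psi> m - ?q^4 * (?y * (?y * fps_nth \<psi> m)) + ?q^4 * (?y * fps_nth C m) + ?q^5 * (?y * (?y * fps_nth C m)) + ?q^4 * (?y * fps_nth W m)"
    using arg_cong[OF A, of "\<lambda>f. fps_nth f (Suc m)"]
    unfolding fps_add_nth fps_sub_nth X_mult_nth_Suc fps_mult_left_const_nth xscale_nth p .
  have "?q^2 * (a (Suc m) * (1 - ?q ^ (2 * m + 2))) =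
      ?q^2 * ((1 - ?q ^ (4 * m + 2)) * a m + ?q ^ (2 * m + 2) * (1 + ?q ^ (2 * m + 1)) * b m
        + ?q ^ (2 * m + 2) * c m)"
    unfolding a_def b_def c_def poch_neg_Suc using explicit_recurrence_aux_4[OF A']
    unfolding p W_def \<psi>_def C_def .
  then show ?A using q0 by simp
qed

section \<open>A Bailey pair\<close>

text \<open>The kernel of Bailey's transform for a = 1 in base q^2. The value 0 outside |j| <= n is
  the usual convention for 1 / (q^2;q^2)_n at negative n; it lets the relations in j and n hold
  without boundary cases.\<close>

definition bailey :: "nat \<Rightarrow> int \<Rightarrow> rat fls" where
  "bailey n j = (if \<bar>j\<bar> \<le> int n then inverse (qs (nat (int n - j)) * qs (nat (int n + j))) else 0)"

lemma bailey_minus: "bailey n (- j) = bailey n j"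
  by (simp add: bailey_def mult.commute)

lemma inverse_qs: "m > 0 \<Longrightarrow> inverse (qs (m - 1)) = inverse (qs m) * (1 - qpow (2 * int m))"
proof -
  assume "m > 0"
  then obtain k where m: "m = Suc k" by (cases m) auto
  have e: "qpow (2 * int (Suc k)) = fls_X ^ (2 * Suc k)"
    using qpow_of_nat[of "2 * Suc k"] by (simp only: of_nat_mult of_nat_numeral)
  have "1 - fls_X ^ (2 * Suc k) \<noteq> (0 :: rat fls)" by (rule one_minus_X_power_neq_0) simp
  then show ?thesis unfolding m e qs_Suc by (simp add: field_simps del: power_Suc mult_Suc_right of_nat_Suc)
qed

text \<open>Inside the range both sides equal 1 / ((q^2;q^2)_(n-j-1) (q^2;q^2)_(n+j)). At j = n and
  j = -n - 1 one side has a factor 1 - q^0 and the other a vanishing kernel.\<close>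

lemma bailey_Suc_j:
  "bailey n j * (1 - qpow (2 * (int n - j))) = bailey n (j + 1) * (1 - qpow (2 * (int n + j + 1)))"
proof -
  consider "j = int n" | "j = - int n - 1" | "j > int n" | "j < - int n - 1" | "- int n \<le> j" "j < int n" by linarith
  then show ?thesis
  proof cases
    case 5
    define a b where "a = nat (int n - j)" and "b = nat (int n + j + 1)"
    have ab: "a > 0" "b > 0" "int n - j = int a" "int n + j + 1 = int b"
      using 5 by (auto simp: a_def b_def)
    have n: "nat (int n - (j + 1)) = a - 1" "nat (int n + (j + 1)) = b" "nat (int n + j) = b - 1" "nat (int n - j) = a"
      using 5 by (auto simp: a_def b_def)
    have "\<bar>j\<bar> \<le> int n" "\<bar>j + 1\<bar> \<le> int n" using 5 by auto
    then show ?thesis unfolding bailey_def n ab(3,4) using inverse_qs[OF ab(1)] inverse_qs[OF ab(2)]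
      by (simp add: mult_ac)
  qed (auto simp: bailey_def)
qed

lemma bailey_Suc_n:
  assumes "n > 0"
  shows "bailey (n - 1) j = bailey n j * (1 - qpow (2 * (int n - j))) * (1 - qpow (2 * (int n + j)))"
proof -
  consider "j = int n" | "j = - int n" | "\<bar>j\<bar> > int n" | "\<bar>j\<bar> < int n" by linarith
  then show ?thesis
  proof cases
    case 4
    define a b where "a = nat (int n - j)" and "b = nat (int n + j)"
    have ab: "a > 0" "b > 0" "int n - j = int a" "int n + j = int b"
      using 4 by (auto simp: a_def b_def)
    have n: "nat (int (n - 1) - j) = a - 1" "nat (int (n - 1) + j) = b - 1" "nat (int n + j) = b" "nat (int n - j) = a"
      using 4 assms by (auto simp: a_def b_def)
    have "\<bar>j\<bar> \<le> int n" "\<bar>j\<bar> \<le> int (n - 1)" using 4 by auto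
    then show ?thesis unfolding bailey_def n ab(3,4) using inverse_qs[OF ab(1)] inverse_qs[OF ab(2)]
      by (simp add: mult_ac)
  qed (use assms in \<open>auto simp: bailey_def\<close>)
qed

text \<open>\<open>Xsum\<close> and \<open>Ysum\<close> are the contributions of the indices 0 and 1
  modulo 3 to a bilateral Bailey sum; indices 2 modulo 3 are reached through j -> -j. The range
  contains the support of the kernel and is symmetric under k -> -k - 1, as the reflection of
  \<open>Ysum\<close> requires.\<close>

definition Xsum :: "int \<Rightarrow> nat \<Rightarrow> rat fls" where
  "Xsum c n = (\<Sum>k\<in>{- int n - 1..int n}. qpow (2 * (6 * k^2 + c * k)) * bailey n (3 * k))"

definition Ysum :: "int \<Rightarrow> nat \<Rightarrow> rat fls" where
  "Ysum c n = (\<Sum>k\<in>{- int n - 1..int n}. qpow (2 * (6 * k^2 + (4 + c) * k)) * bailey n (3 * k + 1))"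

lemma Xsum_minus: "Xsum (- c) n = Xsum c n"
proof -
  have X: "Xsum c n = (\<Sum>k\<in>{- int n..int n}. qpow (2 * (6 * k^2 + c * k)) * bailey n (3 * k))" for c
    unfolding Xsum_def by (rule sum.mono_neutral_right) (auto simp: bailey_def)
  show ?thesis unfolding X
    by (rule sum.reindex_bij_witness[of _ uminus uminus]) (use bailey_minus in auto)
qed

lemma bailey_aux:
  fixes P :: "'a::idom"
  shows "q1 * p3 = P * e1 \<Longrightarrow> q2 * p2 = P * e2 \<Longrightarrow> b0 * (1 - e1) = b1 * (1 - e2) \<Longrightarrow>
      P * b0 - q1 * (p3 * b0) = P * b1 - q2 * (p2 * b1)"
    and "q1 * p3 = P * e1 \<Longrightarrow> r * p2 = P \<Longrightarrow> r * (q1 * p4) = P * e2 \<Longrightarrow> b0 * (1 - e1) = b1 * (1 - e2) \<Longrightarrow>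
      P * b0 - q1 * (p3 * b0) = r * (p2 * b1 - q1 * (p4 * b1))"
  by algebra+

lemma bailey_step_aux:
  fixes P :: "'a::idom"
  assumes "e1 * e2 = N" "q1 * (r * p2) = P * e2" "q1 * (s * p3) = P * e1"
  shows "P * (b0 * (1 - e1) * (1 - e2)) = (1 + N) * (P * b0) - q1 * (r * (p2 * b0) + s * (p3 * b0))"
proof -
  have "P * (b0 * (1 - e1) * (1 - e2)) = (1 + e1 * e2) * (P * b0) - ((P * e2) * b0 + (P * e1) * b0)"
    by (simp add: algebra_simps)
  then show ?thesis unfolding assms(1) assms(2,3)[symmetric] by (simp add: algebra_simps)
qed

text \<open>Termwise this is \<open>bailey_Suc_j\<close> at j = 3k, which moves from residue 0 to
  residue 1 modulo 3.\<close>

lemma Xsum_Ysum: "Xsum c n - qpow (2 * int n) * Xsum (c - 3) n = Ysum (c - 4) n - qpow (2 * int n + 2) * Ysum (c - 1) n"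
proof -
  have "qpow (2 * (6 * k^2 + c * k)) * bailey n (3 * k) - qpow (2 * int n) * (qpow (2 * (6 * k^2 + (c - 3) * k)) * bailey n (3 * k))
    = qpow (2 * (6 * k^2 + (4 + (c - 4)) * k)) * bailey n (3 * k + 1)
      - qpow (2 * int n + 2) * (qpow (2 * (6 * k^2 + (4 + (c - 1)) * k)) * bailey n (3 * k + 1))" for k
  proof -
    have "qpow (2 * int n) * qpow (2 * (6 * k^2 + (c - 3) * k)) = qpow (2 * (6 * k^2 + c * k)) * qpow (2 * (int n - 3 * k))"
      "qpow (2 * int n + 2) * qpow (2 * (6 * k^2 + (4 + (c - 1)) * k)) = qpow (2 * (6 * k^2 + c * k)) * qpow (2 * (int n + 3 * k + 1))"
      unfolding qpow_add[symmetric] by (simp_all add: algebra_simps)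
    from bailey_aux(1)[OF this bailey_Suc_j] show ?thesis by (simp only: add_diff_cancel_left' diff_add_cancel add.commute[of 4 "c - 4"])
  qed
  then show ?thesis
    unfolding Xsum_def Ysum_def sum_distrib_left sum_subtractf[symmetric] by simp
qed

text \<open>\<open>bailey_Suc_j\<close> at j = 3k + 1 leads to the index 3k + 2; the symmetry j ->
  -j together with k -> -k - 1 brings this back to residue 1, so that \<open>Ysum\<close> is related
  to itself.\<close>

lemma Ysum_refl: "Ysum c n - qpow (2 * int n - 2) * Ysum (c - 3) n =
  qpow (4 - 2 * c) * (Ysum (4 - c) n - qpow (2 * int n - 2) * Ysum (1 - c) n)"
proof -
  have t: "qpow (2 * (6 * k^2 + (4 + c) * k)) * bailey n (3 * k + 1) -
      qpow (2 * int n - 2) * (qpow (2 * (6 * k^2 + (4 + (c - 3)) * k)) * bailey n (3 * k + 1)) =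
    qpow (4 - 2 * c) * (qpow (2 * (6 * (- k - 1)^2 + (4 + (4 - c)) * (- k - 1))) * bailey n (3 * (- k - 1) + 1)
      - qpow (2 * int n - 2) * (qpow (2 * (6 * (- k - 1)^2 + (4 + (1 - c)) * (- k - 1))) * bailey n (3 * (- k - 1) + 1)))" for k
  proof -
    have b: "bailey n (3 * (- k - 1) + 1) = bailey n (3 * k + 1 + 1)"
      using bailey_minus[of n "3 * k + 2"] by (simp add: algebra_simps)
    have "qpow (2 * int n - 2) * qpow (2 * (6 * k^2 + (4 + (c - 3)) * k)) =
        qpow (2 * (6 * k^2 + (4 + c) * k)) * qpow (2 * (int n - (3 * k + 1)))"
      "qpow (4 - 2 * c) * qpow (2 * (6 * (- k - 1)^2 + (4 + (4 - c)) * (- k - 1))) = qpow (2 * (6 * k^2 + (4 + c) * k))"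
      "qpow (4 - 2 * c) * (qpow (2 * int n - 2) * qpow (2 * (6 * (- k - 1)^2 + (4 + (1 - c)) * (- k - 1)))) =
        qpow (2 * (6 * k^2 + (4 + c) * k)) * qpow (2 * (int n + (3 * k + 1) + 1))"
      unfolding qpow_add[symmetric] by (simp_all add: algebra_simps power2_eq_square)
    from bailey_aux(2)[OF this bailey_Suc_j] show ?thesis unfolding b .
  qed
  have "Ysum c n - qpow (2 * int n - 2) * Ysum (c - 3) n = (\<Sum>k\<in>{- int n - 1..int n}.
    qpow (4 - 2 * c) * (qpow (2 * (6 * (- k - 1)^2 + (4 + (4 - c)) * (- k - 1))) * bailey n (3 * (- k - 1) + 1)
      - qpow (2 * int n - 2) * (qpow (2 * (6 * (- k - 1)^2 + (4 + (1 - c)) * (- k - 1))) * bailey n (3 * (- k - 1) + 1))))"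
    unfolding Ysum_def sum_distrib_left sum_subtractf[symmetric] t ..
  also have "\<dots> = (\<Sum>k\<in>{- int n - 1..int n}.
    qpow (4 - 2 * c) * (qpow (2 * (6 * k^2 + (4 + (4 - c)) * k)) * bailey n (3 * k + 1)
      - qpow (2 * int n - 2) * (qpow (2 * (6 * k^2 + (4 + (1 - c)) * k)) * bailey n (3 * k + 1))))"
    by (rule sum.reindex_bij_witness[of _ "\<lambda>k. - k - 1" "\<lambda>k. - k - 1"]) auto
  finally show ?thesis unfolding Ysum_def sum_distrib_left sum_subtractf[symmetric] right_diff_distrib .
qed

text \<open>The two factors in \<open>bailey_Suc_n\<close> multiply to 1 + q^(4n) - q^(2n) (q^(2j) +
  q^(-2j)); at j = 3k the last two powers shift c by 3 and by -3.\<close>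

lemma Xsum_step:
  assumes "n > 0"
  shows "Xsum c (n - 1) = (1 + qpow (4 * int n)) * Xsum c n - qpow (2 * int n) * (Xsum (c + 3) n + Xsum (c - 3) n)"
proof -
  have "Xsum c (n - 1) = (\<Sum>k\<in>{- int n - 1..int n}. qpow (2 * (6 * k^2 + c * k)) * bailey (n - 1) (3 * k))"
    unfolding Xsum_def by (rule sum.mono_neutral_left) (use assms in \<open>auto simp: bailey_def\<close>)
  also have "\<dots> = (\<Sum>k\<in>{- int n - 1..int n}. (1 + qpow (4 * int n)) * (qpow (2 * (6 * k^2 + c * k)) * bailey n (3 * k))
     - qpow (2 * int n) * (qpow (2 * (6 * k^2 + (c + 3) * k)) * bailey n (3 * k) + qpow (2 * (6 * k^2 + (c - 3) * k)) * bailey n (3 * k)))"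
  proof (rule sum.cong)
    fix k
    have "qpow (2 * (int n - 3 * k)) * qpow (2 * (int n + 3 * k)) = qpow (4 * int n)"
      "qpow (2 * int n) * qpow (2 * (6 * k^2 + (c + 3) * k)) = qpow (2 * (6 * k^2 + c * k)) * qpow (2 * (int n + 3 * k))"
      "qpow (2 * int n) * qpow (2 * (6 * k^2 + (c - 3) * k)) = qpow (2 * (6 * k^2 + c * k)) * qpow (2 * (int n - 3 * k))"
      unfolding qpow_add[symmetric] by (simp_all add: algebra_simps)
    then show "qpow (2 * (6 * k^2 + c * k)) * bailey (n - 1) (3 * k) =
      (1 + qpow (4 * int n)) * (qpow (2 * (6 * k^2 + c * k)) * bailey n (3 * k))
     - qpow (2 * int n) * (qpow (2 * (6 * k^2 + (c + 3) * k)) * bailey n (3 * k) + qpow (2 * (6 * k^2 + (c - 3) * k)) * bailey n (3 * k))"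
      unfolding bailey_Suc_n[OF assms] using bailey_step_aux[of _ _ _ _ 1 _ _ 1] by (simp only: mult_1)
  qed simp
  also have "\<dots> = (1 + qpow (4 * int n)) * Xsum c n - qpow (2 * int n) * (Xsum (c + 3) n + Xsum (c - 3) n)"
    unfolding Xsum_def by (simp add: sum_subtractf sum_distrib_left[symmetric] sum.distrib)
  finally show ?thesis .
qed

lemma Ysum_step:
  assumes "n > 0"
  shows "Ysum c (n - 1) = (1 + qpow (4 * int n)) * Ysum c n -
    qpow (2 * int n) * (qpow 2 * Ysum (c + 3) n + qpow (- 2) * Ysum (c - 3) n)"
proof -
  have "Ysum c (n - 1) = (\<Sum>k\<in>{- int n - 1..int n}. qpow (2 * (6 * k^2 + (4 + c) * k)) * bailey (n - 1) (3 * k + 1))"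
    unfolding Ysum_def by (rule sum.mono_neutral_left) (use assms in \<open>auto simp: bailey_def\<close>)
  also have "\<dots> = (\<Sum>k\<in>{- int n - 1..int n}. (1 + qpow (4 * int n)) * (qpow (2 * (6 * k^2 + (4 + c) * k)) * bailey n (3 * k + 1))
     - qpow (2 * int n) * (qpow 2 * (qpow (2 * (6 * k^2 + (4 + (c + 3)) * k)) * bailey n (3 * k + 1))
       + qpow (- 2) * (qpow (2 * (6 * k^2 + (4 + (c - 3)) * k)) * bailey n (3 * k + 1))))"
  proof (rule sum.cong)
    fix k
    have "qpow (2 * (int n - (3 * k + 1))) * qpow (2 * (int n + (3 * k + 1))) = qpow (4 * int n)"
      "qpow (2 * int n) * (qpow 2 * qpow (2 * (6 * k^2 + (4 + (c + 3)) * k))) =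
        qpow (2 * (6 * k^2 + (4 + c) * k)) * qpow (2 * (int n + (3 * k + 1)))"
      "qpow (2 * int n) * (qpow (- 2) * qpow (2 * (6 * k^2 + (4 + (c - 3)) * k))) =
        qpow (2 * (6 * k^2 + (4 + c) * k)) * qpow (2 * (int n - (3 * k + 1)))"
      unfolding qpow_add[symmetric] by (simp_all add: algebra_simps)
    then show "qpow (2 * (6 * k^2 + (4 + c) * k)) * bailey (n - 1) (3 * k + 1) =
      (1 + qpow (4 * int n)) * (qpow (2 * (6 * k^2 + (4 + c) * k)) * bailey n (3 * k + 1))
     - qpow (2 * int n) * (qpow 2 * (qpow (2 * (6 * k^2 + (4 + (c + 3)) * k)) * bailey n (3 * k + 1))
       + qpow (- 2) * (qpow (2 * (6 * k^2 + (4 + (c - 3)) * k)) * bailey n (3 * k + 1)))"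
      unfolding bailey_Suc_n[OF assms] by (rule bailey_step_aux)
  qed simp
  also have "\<dots> = (1 + qpow (4 * int n)) * Ysum c n -
    qpow (2 * int n) * (qpow 2 * Ysum (c + 3) n + qpow (- 2) * Ysum (c - 3) n)"
    unfolding Ysum_def by (simp add: sum_subtractf sum_distrib_left[symmetric] sum.distrib)
  finally show ?thesis .
qed

text \<open>The parameters -2, 1, 4 differ by 3, the amount by which \<open>Xsum_step\<close> and
  \<open>Ysum_step\<close> move c. \<open>Xsum_Ysum\<close> and \<open>Ysum_refl\<close> express the
  second and third left-hand sides as multiples of the first, which turns the step relation into a
  first-order recurrence in n.\<close>

lemma bailey_pair:
  shows "Xsum 1 n - qpow 2 * Ysum 1 n = inverse (qs (2 * n))"
    and "Xsum (- 2) n - Ysum (- 2) n = qpow (2 * int n) * inverse (qs (2 * n))"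
    and "Xsum 4 n - qpow 4 * Ysum 4 n =
      (qpow (2 * int n) + qpow (2 * int n - 2) - qpow (6 * int n - 2)) * inverse (qs (2 * n))"
proof -
  define L1 L2 L4 where "L1 n = Xsum 1 n - qpow 2 * Ysum 1 n" and "L2 n = Xsum (- 2) n - Ysum (- 2) n"
    and "L4 n = Xsum 4 n - qpow 4 * Ysum 4 n" for n
  have L2: "L2 n = qpow (2 * int n) * L1 n" for n
    using Xsum_Ysum[of 2 n] Xsum_minus[of 2 n] Xsum_minus[of 1 n]
    by (simp add: L1_def L2_def qpow_add algebra_simps)
  have L4: "L4 n = (qpow (2 * int n) + qpow (2 * int n - 2) - qpow (6 * int n - 2)) * L1 n" for n
  proof -
    define y where "y = qpow (2 * int n)"
    have q: "qpow (2 * int n) = y" "qpow (2 * int n + 2) = y * qpow 2" "qpow (2 * int n - 2) = y * qpow (- 2)"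
      "qpow (6 * int n - 2) = y * y * y * qpow (- 2)"
      unfolding y_def qpow_add[symmetric] by simp_all
    have z: "qpow 2 * qpow (- 2) = 1" "qpow (- 4) * qpow 4 = 1" "qpow 4 = qpow 2 * qpow 2" "qpow (- 4) = qpow (- 2) * qpow (- 2)"
      unfolding qpow_add[symmetric] by simp_all
    have a: "Xsum 1 n - y * Xsum (- 2) n = Ysum (- 3) n - y * qpow 2 * Ysum 0 n"
      "Xsum 4 n - y * Xsum 1 n = Ysum 0 n - y * qpow 2 * Ysum 3 n"
      using Xsum_Ysum[of 1 n] Xsum_Ysum[of 4 n] unfolding q by simp_all
    have b: "Ysum 1 n - y * qpow (- 2) * Ysum (- 2) n = qpow 2 * (Ysum 3 n - y * qpow (- 2) * Ysum 0 n)"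
      "Ysum 4 n - y * qpow (- 2) * Ysum 1 n = qpow (- 4) * (Ysum 0 n - y * qpow (- 2) * Ysum (- 3) n)"
      using Ysum_refl[of 1 n] Ysum_refl[of 4 n] unfolding q by simp_all
    define r s where "r = qpow 2" and "s = qpow (- 2)"
    have rs: "r * s = 1" using z(1) by (simp add: r_def s_def)
    have q4: "qpow 4 = r * r" "qpow (- 4) = s * s" using z(3,4) by (simp_all add: r_def s_def)
    note a' = a[folded r_def s_def] and b' = b[folded r_def s_def, unfolded q4]
    \<comment> \<open>The terms with \<open>Ysum 0\<close> cancel because r s = 1. The next fact has
      the same remainder up to the factor y s, and eliminating it expresses \<open>L4\<close> by
      \<open>L1\<close> and \<open>L2\<close>.\<close>
    have 1: "L1 n - y * L2 n = Ysum (- 3) n - r * r * Ysum 3 n"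
    proof -
      have "L1 n - y * L2 n = (Xsum 1 n - y * Xsum (- 2) n) - r * (Ysum 1 n - y * s * Ysum (- 2) n)
          + (1 - r * s) * y * Ysum (- 2) n"
        unfolding L1_def L2_def r_def[symmetric] by (simp add: algebra_simps)
      also have "\<dots> = (Ysum (- 3) n - y * r * Ysum 0 n) - r * (r * (Ysum 3 n - y * s * Ysum 0 n))"
        unfolding a'(1) b'(1) rs by simp
      also have "\<dots> = Ysum (- 3) n - r * r * Ysum 3 n + (r * s - 1) * r * y * Ysum 0 n"
        by (simp add: algebra_simps)
      finally show ?thesis unfolding rs by simp
    qed
    have 2: "L4 n - y * L1 n = y * s * (Ysum (- 3) n - r * r * Ysum 3 n)"
    proof -
      have "L4 n - y * L1 n = (Xsum 4 n - y * Xsum 1 n) - r * r * (Ysum 4 n - y * s * Ysum 1 n)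
          + (1 - r * s) * r * y * Ysum 1 n"
        unfolding L4_def L1_def r_def[symmetric] q4 by (simp add: algebra_simps)
      also have "\<dots> = (Ysum 0 n - y * r * Ysum 3 n) - r * r * (s * s * (Ysum 0 n - y * s * Ysum (- 3) n))"
        unfolding a'(2) b'(2) rs by simp
      also have "\<dots> = y * s * (Ysum (- 3) n - r * r * Ysum 3 n)
         + (1 - r * s) * (1 + r * s) * (Ysum 0 n - y * s * Ysum (- 3) n) + (r * s - 1) * y * r * Ysum 3 n"
        by (simp add: algebra_simps)
      finally show ?thesis unfolding rs by simp
    qed
    have "L4 n = y * L1 n + y * s * (L1 n - y * (y * L1 n))"
      using 2 unfolding 1[symmetric] L2[of n, unfolded q] by (simp add: algebra_simps)
    then show ?thesis unfolding q s_def[symmetric] by (simp add: algebra_simps)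
  qed
  have step: "L1 (n - 1) = L1 n * (1 - qpow (4 * int n - 2)) * (1 - qpow (4 * int n))" if "n > 0" for n
  proof -
    have z: "qpow 4 = qpow 2 * qpow 2" "qpow 2 * qpow (- 2) = 1" unfolding qpow_add[symmetric] by simp_all
    have "L1 (n - 1) = (1 + qpow (4 * int n)) * L1 n - qpow (2 * int n) * (L4 n + L2 n)"
    proof -
      have gen: "x' - r * y' = (1 + N) * (x1 - r * y1) - t * ((x4 - r * r * y4) + (x2 - y2))"
        if "x' = (1 + N) * x1 - t * (x4 + x2)" "y' = (1 + N) * y1 - t * (r * y4 + s * y2)" "r * s = 1"
        for x' y' x1 y1 x2 y2 x4 y4 r s t N :: "rat fls"
      proof -
        have "r * y' = (1 + N) * (r * y1) - t * (r * r * y4 + (r * s) * y2)"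
          unfolding that(2) by (simp add: algebra_simps)
        then show ?thesis unfolding that(1,3) by (simp add: algebra_simps)
      qed
      have X: "Xsum 1 (n - 1) = (1 + qpow (4 * int n)) * Xsum 1 n - qpow (2 * int n) * (Xsum 4 n + Xsum (- 2) n)"
        using Xsum_step[OF that, of 1] by simp
      have Y: "Ysum 1 (n - 1) = (1 + qpow (4 * int n)) * Ysum 1 n -
        qpow (2 * int n) * (qpow 2 * Ysum 4 n + qpow (- 2) * Ysum (- 2) n)"
        using Ysum_step[OF that, of 1] by simp
      show ?thesis unfolding L1_def L4_def L2_def z(1) by (rule gen[OF X Y z(2)])
    qed
    also have "\<dots> = L1 n * (1 + qpow (4 * int n) - qpow (2 * int n) * qpow (2 * int n) - qpow (2 * int n) * qpow (2 * int n - 2)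
        + qpow (2 * int n) * qpow (6 * int n - 2) - qpow (2 * int n) * qpow (2 * int n))"
      unfolding L4 L2 by (simp add: algebra_simps)
    also have "\<dots> = L1 n * (1 - qpow (4 * int n - 2) - qpow (4 * int n) + qpow (4 * int n - 2) * qpow (4 * int n))"
      unfolding qpow_add[symmetric] by (simp add: algebra_simps)
    also have "\<dots> = L1 n * (1 - qpow (4 * int n - 2)) * (1 - qpow (4 * int n))"
      by (simp add: algebra_simps)
    finally show ?thesis .
  qed
  have L1: "L1 n = inverse (qs (2 * n))" for n
  proof (induction n)
    case 0
    have "{- int 0 - 1..int 0} = {- 1, 0}" by auto
    then show ?case by (simp add: L1_def Xsum_def Ysum_def bailey_def)
  next
    case (Suc n)
    have e: "qpow (4 * int (Suc n) - 2) = fls_X ^ (2 * Suc (2 * n))" "qpow (4 * int (Suc n)) = fls_X ^ (2 * Suc (Suc (2 * n)))"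
      unfolding qpow_of_nat[symmetric] by (simp_all add: algebra_simps)
    have d: "2 * Suc n = Suc (Suc (2 * n))" by simp
    have "inverse (qs (2 * n)) = L1 (Suc n) * (1 - qpow (4 * int (Suc n) - 2)) * (1 - qpow (4 * int (Suc n)))"
      using step[of "Suc n"] Suc by simp
    moreover have "1 - fls_X ^ (2 * Suc (2 * n)) \<noteq> (0 :: rat fls)" "1 - fls_X ^ (2 * Suc (Suc (2 * n))) \<noteq> (0 :: rat fls)"
      by (rule one_minus_X_power_neq_0, simp)+
    moreover have "l = inverse (a * u * v)" if "inverse a = l * u * v" "u \<noteq> 0" "v \<noteq> 0" "a \<noteq> 0" for l a u v :: "rat fls"
    proof -
      have "l * (a * u * v) = a * (l * u * v)" by (simp add: mult_ac)
      also have "\<dots> = 1" unfolding that(1)[symmetric] using that(4) by simp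
      finally show ?thesis using that by (simp add: field_simps)
    qed
    ultimately show ?case unfolding d qs_Suc e using qs_neq_0 by blast
  qed
  show "Xsum 1 n - qpow 2 * Ysum 1 n = inverse (qs (2 * n))" using L1 by (simp add: L1_def)
  show "Xsum (- 2) n - Ysum (- 2) n = qpow (2 * int n) * inverse (qs (2 * n))" using L2 L1 by (simp add: L2_def)
  show "Xsum 4 n - qpow 4 * Ysum 4 n =
      (qpow (2 * int n) + qpow (2 * int n - 2) - qpow (6 * int n - 2)) * inverse (qs (2 * n))"
    using L4 L1 by (simp add: L4_def)
qed

section \<open>The conjugate Bailey pair\<close>

definition unit0 :: "'a::zero fls \<Rightarrow> bool" where
  "unit0 a \<longleftrightarrow> ord_ge 0 a \<and> fls_nth a 0 \<noteq> 0"

lemma unit0_iff_subdegree: "unit0 a \<longleftrightarrow> a \<noteq> 0 \<and> fls_subdegree a = 0"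
proof
  assume "unit0 a"
  then have "a \<noteq> 0" "0 \<le> fls_subdegree a" "fls_nth a 0 \<noteq> 0" by (auto simp: unit0_def ord_ge_iff_subdegree)
  then show "a \<noteq> 0 \<and> fls_subdegree a = 0" using fls_subdegree_leI by fastforce
qed (auto simp: unit0_def ord_ge_iff_subdegree dest: nth_fls_subdegree_nonzero)

lemma unit0_mult: "unit0 a \<Longrightarrow> unit0 b \<Longrightarrow> unit0 (a * b :: 'a::idom fls)"
  by (simp add: unit0_iff_subdegree fls_subdegree_mult)

lemma unit0_inverse: "unit0 a \<Longrightarrow> unit0 (inverse a :: 'a::field fls)"
  by (simp add: unit0_iff_subdegree fls_inverse_subdegree)

lemma unit0_1 [simp]: "unit0 (1 :: 'a::zero_neq_one fls)"
  by (simp add: unit0_iff_subdegree)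

lemma unit0_ord_ge: "unit0 a \<Longrightarrow> ord_ge 0 a"
  by (simp add: unit0_def)

lemma unit0_neq_0: "unit0 a \<Longrightarrow> a \<noteq> 0"
  by (auto simp: unit0_def)

lemma unit0_cong: "unit0 a \<Longrightarrow> ord_ge 1 (a - b) \<Longrightarrow> unit0 (b :: 'a::group_add fls)"
  by (auto simp: unit0_def ord_ge_def)

lemma unit0_one_minus: "ord_ge 1 a \<Longrightarrow> unit0 (1 - a :: 'a::ring_1 fls)"
  by (auto simp: unit0_def ord_ge_def)

lemma unit0_qpoch:
  assumes "a > 0"
  shows "unit0 (qpoch (fls_X ^ a) (fls_X ^ d) n :: rat fls)"
proof (induction n)
  case (Suc n)
  have "ord_ge (int (a + d * n)) (fls_X ^ (a + d * n) :: rat fls)" by (rule ord_ge_X_power)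
  then have "ord_ge 1 (fls_X ^ a * (fls_X ^ d) ^ n :: rat fls)"
    unfolding power_mult[symmetric] power_add[symmetric] proof (rule ord_ge_mono)
    have "1 \<le> a + d * n" using assms by simp
    then have "int 1 \<le> int (a + d * n)" by (rule zle_int[THEN iffD2])
    then show "1 \<le> int (a + d * n)" by (simp only: of_nat_1)
  qed
  then show ?case unfolding qpoch_Suc using Suc by (intro unit0_mult unit0_one_minus)
qed (simp add: qpoch_def)

lemma unit0_tendsto:
  assumes "s \<longlonglongrightarrow> (L :: 'a::group_add fls)" "\<And>n. unit0 (s n)"
  shows "unit0 L"
proof -
  have "eventually (\<lambda>n. ord_ge 1 (s n - L)) sequentially" by (rule eventually_ord_ge_diff[OF assms(1)])
  then obtain n where "ord_ge 1 (s n - L)" by (auto simp: eventually_sequentially)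
  then show ?thesis using unit0_cong assms(2) by blast
qed

text \<open>Inversion is controlled here because units have order exactly 0: the error of the
  reciprocals is the error of the series times a unit, so no precision is lost.\<close>

lemma tendsto_inverse_unit0:
  assumes "s \<longlonglongrightarrow> (L :: 'a::field fls)" "\<And>n. unit0 (s n)"
  shows "(\<lambda>n. inverse (s n)) \<longlonglongrightarrow> inverse L"
  unfolding tendsto_fls_iff
proof
  fix N
  have L: "unit0 L" by (rule unit0_tendsto[OF assms])
  have "eventually (\<lambda>n. ord_ge N (s n - L)) sequentially" by (rule eventually_ord_ge_diff[OF assms(1)])
  then show "eventually (\<lambda>n. ord_ge N (inverse (s n) - inverse L)) sequentially"
  proof eventually_elim
    case (elim n)
    have "inverse (s n) - inverse L = - (s n - L) * (inverse (s n) * inverse L)"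
      using unit0_neq_0[OF L] unit0_neq_0[OF assms(2)[of n]] by (simp add: field_simps)
    moreover have "ord_ge (N + 0) (- (s n - L) * (inverse (s n) * inverse L))"
      using elim L assms(2) by (intro ord_ge_mult ord_ge_uminus unit0_ord_ge unit0_mult unit0_inverse) auto
    ultimately show ?case by simp
  qed
qed

lemma convergent_fls:
  fixes s :: "nat \<Rightarrow> 'a::ab_group_add fls"
  assumes "\<And>n. ord_ge (int n) (s (Suc n) - s n)"
  shows "convergent s"
proof -
  have "null_family (\<lambda>n. s (Suc n) - s n)"
    unfolding null_family_def
  proof
    fix N
    have "{k. \<not> ord_ge N (s (Suc k) - s k)} \<subseteq> {..nat N}"
      using assms by (auto dest: ord_ge_mono[of _ _ N] intro: ccontr)
        (metis assms le_nat_iff linorder_le_cases nat_le_iff ord_ge_mono)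
    then show "finite {k. \<not> ord_ge N (s (Suc k) - s k)}" by (rule finite_subset) simp
  qed
  then obtain D where "((\<lambda>n. s (Suc n) - s n) has_sum D) UNIV"
    using null_family_summable by (metis summable_on_def)
  then have "(\<lambda>n. s (Suc n) - s n) sums D" by (rule has_sum_imp_sums)
  then have "(\<lambda>n. (\<Sum>i<n. s (Suc i) - s i) + s 0) \<longlonglongrightarrow> D + s 0"
    unfolding sums_def by (intro tendsto_add tendsto_const)
  moreover have "(\<Sum>i<n. s (Suc i) - s i) + s 0 = s n" for n by (simp add: sum_lessThan_telescope)
  ultimately show ?thesis by (auto simp: convergent_def)
qed

lemma qpoch_tendsto:
  assumes "a > 0" "d > 0"
  shows "(\<lambda>n. qpoch (fls_X ^ a) (fls_X ^ d) n) \<longlonglongrightarrow> qpoch_inf (fls_X ^ a) (fls_X ^ d)"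
    and "unit0 (qpoch_inf (fls_X ^ a) (fls_X ^ d))"
proof -
  let ?s = "\<lambda>n. qpoch (fls_X ^ a) (fls_X ^ d) n :: rat fls"
  have "ord_ge (int n) (?s (Suc n) - ?s n)" for n
  proof -
    have eq: "?s (Suc n) - ?s n = - (?s n * fls_X ^ (a + d * n))"
      by (simp add: qpoch_Suc power_add power_mult algebra_simps)
    have "ord_ge (0 + int (a + d * n)) (?s n * fls_X ^ (a + d * n))"
      by (intro ord_ge_mult unit0_ord_ge unit0_qpoch ord_ge_X_power assms)
    moreover have "n \<le> a + d * n" using assms(2) by (simp add: trans_le_add2)
    then have "int n \<le> int (a + d * n)" by (rule zle_int[THEN iffD2])
    ultimately show ?thesis unfolding eq by (intro ord_ge_uminus) (auto elim: ord_ge_mono)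
  qed
  then have "convergent ?s" by (rule convergent_fls)
  then obtain L where L: "?s \<longlonglongrightarrow> L" by (auto simp: convergent_def)
  have u: "unit0 L" by (rule unit0_tendsto[OF L unit0_qpoch[OF assms(1)]])
  have "(\<lambda>n. ?s (Suc n)) \<longlonglongrightarrow> L" by (rule LIMSEQ_Suc[OF L])
  then have "(\<lambda>n. \<Prod>t\<le>n. 1 - fls_X ^ a * (fls_X ^ d) ^ t) \<longlonglongrightarrow> L"
    by (simp add: qpoch_def lessThan_Suc_atMost)
  \<comment> \<open>Convergence of an infinite product requires a nonzero limit, which the unit
    property of \<open>L\<close> provides.\<close>
  then have "(\<lambda>t. 1 - fls_X ^ a * (fls_X ^ d) ^ t) has_prod L"
    using unit0_neq_0[OF u] by (simp add: has_prod_def raw_has_prod_def)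
  then have "L = qpoch_inf (fls_X ^ a) (fls_X ^ d)" unfolding qpoch_inf_def by (rule has_prod_unique)
  then show "?s \<longlonglongrightarrow> qpoch_inf (fls_X ^ a) (fls_X ^ d)" "unit0 (qpoch_inf (fls_X ^ a) (fls_X ^ d))"
    using L u by auto
qed

lemma unit0_qs: "unit0 (qs n)"
  unfolding qs_def by (rule unit0_qpoch) simp

lemma ord_ge_qpow: "ord_ge e (qpow e)"
  unfolding qpow_def by (rule ord_ge_X_powi)

lemma ord_ge_delta: "ord_ge (int (n\<^sup>2)) (delta n)"
proof -
  have "ord_ge (0 + int (n\<^sup>2) + 0) ((- 1) ^ n * fls_X ^ (n\<^sup>2) * qpoch fls_X (fls_X ^ 2) n :: rat fls)"
  proof (intro ord_ge_mult ord_ge_X_power unit0_ord_ge)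
    show "unit0 ((- 1) ^ n :: rat fls)"
      by (cases "even n") (auto simp: unit0_def ord_ge_def)
    show "unit0 (qpoch fls_X (fls_X ^ 2) n :: rat fls)" using unit0_qpoch[of 1 2 n] by simp
  qed
  then show ?thesis by (simp add: delta_def)
qed

lemma ord_ge_bailey: "ord_ge 0 (bailey n j)"
  by (auto simp: bailey_def intro!: unit0_ord_ge unit0_inverse unit0_mult unit0_qs)

lemma ord_ge_delta_mult: "ord_ge 0 a \<Longrightarrow> ord_ge (int n) (delta n * a)"
proof -
  assume "ord_ge 0 a"
  then have "ord_ge (int (n\<^sup>2) + 0) (delta n * a)" by (intro ord_ge_mult ord_ge_delta)
  moreover have "n \<le> n\<^sup>2" by (simp add: power2_eq_square)
  then have "int n \<le> int (n\<^sup>2)" by (rule zle_int[THEN iffD2])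
  ultimately show ?thesis by (metis add_0_right ord_ge_mono)
qed

lemma null_family_natI:
  fixes f :: "nat \<Rightarrow> 'a::zero fls"
  assumes "\<And>n. ord_ge (int n) (f n)"
  shows "null_family f"
  unfolding null_family_def
proof
  fix N
  have "{k. \<not> ord_ge N (f k)} \<subseteq> {..nat N}"
  proof
    fix k assume "k \<in> {k. \<not> ord_ge N (f k)}"
    then have "\<not> N \<le> int k" using ord_ge_mono[OF assms] by blast
    then show "k \<in> {..nat N}" by simp
  qed
  then show "finite {k. \<not> ord_ge N (f k)}" by (rule finite_subset) simp
qed

lemma has_sum_ex:
  "null_family (f :: 'b \<Rightarrow> 'a::ab_group_add fls) \<Longrightarrow> \<exists>S. (f has_sum S) A"
  using null_family_summable by (metis summable_on_def)

section \<open>The conjugate sums gamma_j\<close>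

definition conj_sum :: "int \<Rightarrow> rat fls" where
  "conj_sum j = (\<Sum>\<^sub>\<infinity>n. delta n * bailey n j)"

lemma conj_sum_has_sum: "((\<lambda>n. delta n * bailey n j) has_sum conj_sum j) UNIV"
proof -
  have "null_family (\<lambda>n. delta n * bailey n j)"
    by (rule null_family_natI) (intro ord_ge_delta_mult ord_ge_bailey)
  then show ?thesis unfolding conj_sum_def by (intro has_sum_infsum null_family_summable)
qed

lemma has_sum_nat_Suc:
  fixes G :: "nat \<Rightarrow> 'a::ab_group_add fls"
  assumes "(G has_sum S) UNIV"
  shows "((\<lambda>n. G (Suc n)) has_sum (S - G 0)) UNIV"
proof -
  have "((\<lambda>n. - (if n = 0 then G 0 else 0)) has_sum - G 0) UNIV"
    by (rule has_sum_finite_neutralI[of "{0}"]) auto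
  from has_sum_add[OF assms this] have "((\<lambda>n. if n = 0 then 0 else G n) has_sum (S - G 0)) UNIV"
    by (simp add: if_distrib cong: if_cong)
  then have "(G has_sum (S - G 0)) (range Suc)"
    by (subst (asm) has_sum_cong_neutral[of "range Suc" UNIV G]) (auto simp: image_iff gr0_conv_Suc)
  then show ?thesis by (subst (asm) has_sum_reindex) (auto simp: o_def)
qed

lemma conj_sum_step: "conj_sum (int j + 1) = - (fls_X ^ (2 * j + 1) * conj_sum (int j))"
proof -
  define c where "c = qpow (2 * int j + 1)"
  have c: "c = fls_X ^ (2 * j + 1)" unfolding c_def qpow_of_nat[symmetric] by (simp add: add.commute)
  \<comment> \<open>a telescoping certificate\<close>
  define G where "G n = - (1 + c) * (delta n * (bailey n (int j) * (1 - qpow (2 * (int n - int j)))))" for n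
  have tele: "delta n * bailey n (int j + 1) + c * (delta n * bailey n (int j)) = G (Suc n) - G n" for n
  proof -
    define a b d w where "a = qpow (2 * (int n - int j))" and "b = qpow (2 * (int n + int j + 1))"
      and "d = qpow (2 * int n + 1)" and "w = bailey (Suc n) (int j) * (1 - qpow (2 * (int (Suc n) - int j)))"
    have d: "d = a * c" and b: "b = a * c * c"
      unfolding a_def b_def c_def d_def qpow_add[symmetric] by (simp_all add: algebra_simps)
    have d': "d = fls_X ^ (2 * n + 1)" unfolding d_def qpow_of_nat[symmetric] by (simp add: add.commute)
    have "2 * (int n + int j + 1) = int (2 * (n + j + 1))" by simp
    then have b': "b = fls_X ^ (2 * (n + j + 1))" unfolding b_def by (simp only: qpow_of_nat)
    have b0: "1 - b \<noteq> 0" unfolding b' by (rule one_minus_X_power_neq_0) simp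
    have e: "int (Suc n) + int j = int n + int j + 1" by simp
    have B0: "bailey n (int j) = w * (1 - b)"
      using bailey_Suc_n[of "Suc n" "int j"] unfolding w_def b_def e by simp
    have "bailey n (int j + 1) * (1 - b) = w * (1 - a) * (1 - b)"
    proof -
      have "bailey n (int j + 1) * (1 - b) = bailey n (int j) * (1 - a)"
        unfolding a_def b_def by (rule bailey_Suc_j[symmetric])
      also have "\<dots> = w * (1 - a) * (1 - b)" unfolding B0 by (simp only: mult_ac)
      finally show ?thesis .
    qed
    then have B1: "bailey n (int j + 1) = w * (1 - a)" using b0 by simp
    have G1: "G (Suc n) = (1 + c) * (delta n * d * (1 - d) * w)"
      unfolding G_def delta_Suc d'[symmetric] w_def[symmetric] by (simp add: algebra_simps)
    have G0: "G n = - (1 + c) * (delta n * (w * (1 - b) * (1 - a)))"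
      unfolding G_def B0 a_def[symmetric] ..
    show ?thesis unfolding B0 B1 G1 G0 b d by algebra
  qed
  have "null_family G"
  proof (rule null_family_natI)
    fix n
    have bb: "ord_ge 0 (bailey n (int j) * (1 - qpow (2 * (int n - int j))))"
    proof (cases "n \<ge> j")
      case True
      then have "ord_ge 0 (qpow (2 * (int n - int j)))" by (intro ord_ge_mono[OF ord_ge_qpow]) simp
      then have "ord_ge (0 + 0) (bailey n (int j) * (1 - qpow (2 * (int n - int j))))"
        by (intro ord_ge_mult ord_ge_bailey ord_ge_diff) auto
      then show ?thesis by simp
    qed (simp add: bailey_def)
    have "ord_ge 0 c" unfolding c by (rule ord_ge_mono[OF ord_ge_X_power]) simp
    then have "ord_ge (0 + int n) (- (1 + c) * (delta n * (bailey n (int j) * (1 - qpow (2 * (int n - int j))))))"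
      by (intro ord_ge_mult ord_ge_uminus ord_ge_add ord_ge_delta_mult bb) auto
    then show "ord_ge (int n) (G n)" by (simp add: G_def)
  qed
  then obtain S where S: "(G has_sum S) UNIV" using has_sum_ex by blast
  \<comment> \<open>For j = 0 the factor 1 - q^0 vanishes, for j > 0 the kernel does.\<close>
  have G0: "G 0 = 0" by (cases "j = 0") (auto simp: G_def bailey_def)
  have "((\<lambda>n. G (Suc n) + - G n) has_sum ((S - G 0) + - S)) UNIV"
    by (intro has_sum_add has_sum_nat_Suc S) (use S in \<open>simp add: has_sum_uminus\<close>)
  then have "((\<lambda>n. delta n * bailey n (int j + 1) + c * (delta n * bailey n (int j))) has_sum 0) UNIV"
    unfolding tele using G0 by simp
  moreover have "((\<lambda>n. delta n * bailey n (int j + 1) + c * (delta n * bailey n (int j))) has_sum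
      (conj_sum (int j + 1) + c * conj_sum (int j))) UNIV"
    by (intro has_sum_add has_sum_cmult_right conj_sum_has_sum)
  ultimately have "conj_sum (int j + 1) + c * conj_sum (int j) = 0" by (rule has_sum_unique[rotated])
  then show ?thesis unfolding c by (simp add: eq_neg_iff_add_eq_0)
qed

lemma conj_sum_nat: "conj_sum (int j) = (- 1) ^ j * fls_X ^ (j\<^sup>2) * conj_sum 0"
proof (induction j)
  case (Suc j)
  have "(Suc j)\<^sup>2 = j\<^sup>2 + (2 * j + 1)" by (simp add: power2_eq_square)
  then have "fls_X ^ (Suc j)\<^sup>2 = (fls_X ^ j\<^sup>2 * fls_X ^ (2 * j + 1) :: rat fls)" by (simp only: power_add)
  note pw = this
  have e: "int (Suc j) = int j + 1" by simp
  show ?case unfolding e conj_sum_step Suc pw by (simp add: mult_ac)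
qed simp

definition conj_const :: "rat fls" where
  "conj_const = qpoch_inf fls_X (fls_X ^ 2) / qpoch_inf (fls_X ^ 2) (fls_X ^ 2)"

text \<open>By \<open>conj_sum_nat\<close>, gamma_j divided by (-1)^j q^(j^2) does not depend on j.
  As j tends to infinity only the term n = j survives in it, so the constant is the limit of
  (q;q^2)_j / (q^2;q^2)_(2j).\<close>

lemma conj_sum_0: "conj_sum 0 = conj_const"
proof -
  \<comment> \<open>The term n = m + j of gamma_j, with the factor (-1)^j q^(j^2) removed.\<close>
  define f where "f j m = (- 1) ^ m * fls_X ^ (m\<^sup>2 + 2 * m * j) * (qpoch fls_X (fls_X ^ 2) (m + j) * inverse (qs m * qs (m + 2 * j)))"
    for j m :: nat
  have u: "unit0 (qpoch fls_X (fls_X ^ 2) n :: rat fls)" for n using unit0_qpoch[of 1 2 n] by simp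
  have sg: "unit0 ((- 1) ^ m :: rat fls)" for m
    by (cases "even m") (auto simp: unit0_def ord_ge_def)
  have ordf: "ord_ge (int (m\<^sup>2 + 2 * m * j)) (f j m)" for j m
  proof -
    have "ord_ge (0 + int (m\<^sup>2 + 2 * m * j) + 0) (f j m)" unfolding f_def
      by (intro ord_ge_mult ord_ge_X_power unit0_ord_ge unit0_mult unit0_inverse u unit0_qs sg)
    then show ?thesis by simp
  qed
  have "((\<lambda>m. f j m) has_sum conj_sum 0) UNIV" for j
  proof -
    have "((\<lambda>n. delta n * bailey n (int j)) has_sum conj_sum (int j)) (range (\<lambda>m. m + j))"
    proof (subst has_sum_cong_neutral[of UNIV "range (\<lambda>m. m + j)" "\<lambda>n. delta n * bailey n (int j)"])
      show "delta n * bailey n (int j) = 0" if "n \<in> UNIV - range (\<lambda>m. m + j)" for n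
      proof -
        have "n < j" using that by (metis DiffD2 le_add_diff_inverse2 linorder_not_less rangeI)
        then show ?thesis by (simp add: bailey_def)
      qed
    qed (use conj_sum_has_sum in auto)
    then have "((\<lambda>m. delta (m + j) * bailey (m + j) (int j)) has_sum conj_sum (int j)) UNIV"
      by (subst (asm) has_sum_reindex) (auto simp: o_def inj_def)
    moreover have "delta (m + j) * bailey (m + j) (int j) = ((- 1) ^ j * fls_X ^ (j\<^sup>2)) * f j m" for m
    proof -
      have "\<bar>int j\<bar> \<le> int (m + j)" "nat (int (m + j) - int j) = m" "nat (int (m + j) + int j) = m + 2 * j" by simp_all
      moreover have "(m + j)\<^sup>2 = j\<^sup>2 + (m\<^sup>2 + 2 * m * j)" by (simp add: power2_eq_square algebra_simps)
      then have "fls_X ^ (m + j)\<^sup>2 = (fls_X ^ (j\<^sup>2) * fls_X ^ (m\<^sup>2 + 2 * m * j) :: rat fls)" by (simp only: power_add)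
      ultimately show ?thesis unfolding delta_def bailey_def f_def by (simp add: power_add mult_ac)
    qed
    ultimately have "((\<lambda>m. ((- 1) ^ j * fls_X ^ (j\<^sup>2)) * f j m) has_sum ((- 1) ^ j * fls_X ^ (j\<^sup>2)) * conj_sum 0) UNIV"
      by (simp add: conj_sum_nat)
    then show ?thesis by (subst (asm) has_sum_cmult_right_iff) auto
  qed
  note sums = this
  define g where "g m = (if m = 0 then conj_const else 0)" for m :: nat
  have lim: "(\<lambda>j. f j m) \<longlonglongrightarrow> g m" for m
  proof (cases "m = 0")
    case True
    have l1: "(\<lambda>j. qpoch fls_X (fls_X ^ 2) j :: rat fls) \<longlonglongrightarrow> qpoch_inf fls_X (fls_X ^ 2)"
      using qpoch_tendsto(1)[of 1 2] by simp
    have "(\<lambda>n. inverse (qs n)) \<longlonglongrightarrow> inverse (qpoch_inf (fls_X ^ 2) (fls_X ^ 2))"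
      unfolding qs_def by (intro tendsto_inverse_unit0 qpoch_tendsto unit0_qpoch) auto
    moreover have "filterlim (\<lambda>j. 2 * j) sequentially (sequentially :: nat filter)"
      by (rule filterlim_subseq) (auto simp: strict_mono_def)
    ultimately have l2: "(\<lambda>j. inverse (qs (2 * j))) \<longlonglongrightarrow> inverse (qpoch_inf (fls_X ^ 2) (fls_X ^ 2))"
      by (rule filterlim_compose)
    have "(\<lambda>j. qpoch fls_X (fls_X ^ 2) j * inverse (qs (2 * j))) \<longlonglongrightarrow> conj_const"
      unfolding conj_const_def divide_inverse by (intro tendsto_mult l1 l2)
    then show ?thesis using True by (simp add: f_def g_def)
  next
    case False
    show ?thesis unfolding tendsto_fls_iff
    proof
      fix N
      have "ord_ge N (f j m - g m)" if "j \<ge> nat N" for j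
      proof -
        have "j \<le> m * j" using False by simp
        then have "nat N \<le> m\<^sup>2 + 2 * m * j" using that by linarith
        then have "N \<le> int (m\<^sup>2 + 2 * m * j)" by linarith
        from ord_ge_mono[OF ordf this] show ?thesis using False by (simp add: g_def)
      qed
      then show "eventually (\<lambda>j. ord_ge N (f j m - g m)) sequentially"
        by (auto simp: eventually_sequentially)
    qed
  qed
  have fin: "finite {m. \<exists>j. \<not> ord_ge N (f j m)}" for N
  proof (rule finite_subset)
    show "{m. \<exists>j. \<not> ord_ge N (f j m)} \<subseteq> {..nat N}"
    proof safe
      fix m j assume *: "\<not> ord_ge N (f j m)"
      have "int m \<le> int (m\<^sup>2 + 2 * m * j)" by (cases m) (auto simp: power2_eq_square)
      moreover have "\<not> N \<le> int (m\<^sup>2 + 2 * m * j)" using * ord_ge_mono[OF ordf] by blast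
      ultimately show "m \<le> nat N" by linarith
    qed
  qed simp
  obtain S where S: "(g has_sum S) UNIV" "(\<lambda>j. conj_sum 0) \<longlonglongrightarrow> S"
    using tannery_has_sum[OF fin sums lim] by blast
  have "S = conj_sum 0" using S(2) by (simp add: LIMSEQ_const_iff)
  moreover have "(g has_sum conj_const) UNIV"
    by (rule has_sum_finite_neutralI[of "{0}"]) (auto simp: g_def)
  ultimately show ?thesis using S(1) has_sum_unique by blast
qed

definition sg :: "int \<Rightarrow> rat fls" where
  "sg k = (if even k then 1 else - 1)"

lemma conj_sum_eq: "conj_sum j = conj_const * sg j * qpow (j\<^sup>2)"
proof -
  have nat: "conj_sum (int m) = conj_const * sg (int m) * qpow ((int m)\<^sup>2)" for m
  proof -
    have "qpow ((int m)\<^sup>2) = fls_X ^ (m\<^sup>2)" unfolding qpow_of_nat[symmetric] by simp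
    then show ?thesis unfolding conj_sum_nat conj_sum_0 sg_def by (cases "even m") (auto simp: mult_ac)
  qed
  have minus: "conj_sum (- j) = conj_sum j" for j
    by (simp add: conj_sum_def bailey_minus)
  show ?thesis
  proof (cases "j \<ge> 0")
    case True
    then show ?thesis using nat[of "nat j"] by simp
  next
    case False
    then show ?thesis using nat[of "nat (- j)"] minus[of j] by (simp add: sg_def)
  qed
qed

text \<open>The double sum over n and k is evaluated in both orders; summing over n first gives
  gamma_(3k) and gamma_(3k+1). The kernel index adds 9 k^2 to the exponent 12 k^2, and the opposite
  signs of gamma at 3k and 3k + 1 turn the minus into a plus. The assumptions exclude negative
  powers of q, so that the double family tends to zero.\<close>

lemma bailey_lemma:
  assumes "\<And>k. 6 * k\<^sup>2 + c * k \<ge> 0" "\<And>k. r + 6 * k\<^sup>2 + (4 + c) * k \<ge> 0"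
  shows "\<exists>S. ((\<lambda>n. delta n * (Xsum c n - qpow (2 * r) * Ysum c n)) has_sum conj_const * S) UNIV \<and>
    ((\<lambda>k. sg k * (qpow (21 * k\<^sup>2 + 2 * c * k) + qpow (21 * k\<^sup>2 + (14 + 2 * c) * k + (1 + 2 * r)))) has_sum S) UNIV"
proof -
  define t where "t n k = delta n * (qpow (2 * (6 * k\<^sup>2 + c * k)) * bailey n (3 * k)
     - qpow (2 * r) * (qpow (2 * (6 * k\<^sup>2 + (4 + c) * k)) * bailey n (3 * k + 1)))" for n k
  have ordt: "ord_ge (int n) (t n k)" for n k
    unfolding t_def
  proof (intro ord_ge_delta_mult ord_ge_diff)
    have "ord_ge (0 + 0) (qpow (2 * (6 * k\<^sup>2 + c * k)) * bailey n (3 * k))"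
      by (intro ord_ge_mult ord_ge_bailey ord_ge_mono[OF ord_ge_qpow]) (use assms(1)[of k] in simp)
    then show "ord_ge 0 (qpow (2 * (6 * k\<^sup>2 + c * k)) * bailey n (3 * k))" by simp
    have "ord_ge (0 + 0) (qpow (2 * r + 2 * (6 * k\<^sup>2 + (4 + c) * k)) * bailey n (3 * k + 1))"
      by (intro ord_ge_mult ord_ge_bailey ord_ge_mono[OF ord_ge_qpow]) (use assms(2)[of k] in simp)
    then show "ord_ge 0 (qpow (2 * r) * (qpow (2 * (6 * k\<^sup>2 + (4 + c) * k)) * bailey n (3 * k + 1)))"
      unfolding qpow_add by (simp add: mult.assoc)
  qed
  have out: "t n k = 0" if "k \<notin> {- int n - 1..int n}" for n k
    using that by (auto simp: t_def bailey_def)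
  have null: "null_family (\<lambda>(n, k). t n k)"
    unfolding null_family_def
  proof
    fix N
    have "{z. \<not> ord_ge N (case z of (n, k) \<Rightarrow> t n k)} \<subseteq> (SIGMA n:{..nat N}. {- int n - 1..int n})"
    proof safe
      fix n k assume *: "\<not> ord_ge N (t n k)"
      then have "\<not> N \<le> int n" using ord_ge_mono[OF ordt] by blast
      then show "n \<le> nat N" by simp
      show "k \<in> {- int n - 1..int n}" using * out by fastforce
    qed
    then show "finite {z. \<not> ord_ge N (case z of (n, k) \<Rightarrow> t n k)}" by (rule finite_subset) auto
  qed
  obtain T where T: "((\<lambda>(n, k). t n k) has_sum T) (UNIV \<times> UNIV)" using has_sum_ex[OF null] by blast
  have row: "((\<lambda>k. t n k) has_sum delta n * (Xsum c n - qpow (2 * r) * Ysum c n)) UNIV" for n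
  proof (rule has_sum_finite_neutralI[of "{- int n - 1..int n}"])
    show "delta n * (Xsum c n - qpow (2 * r) * Ysum c n) = (\<Sum>k\<in>{- int n - 1..int n}. t n k)"
      unfolding t_def Xsum_def Ysum_def sum_distrib_left sum_subtractf[symmetric] ..
  qed (use out in auto)
  have 1: "((\<lambda>n. delta n * (Xsum c n - qpow (2 * r) * Ysum c n)) has_sum T) UNIV"
    using has_sum_SigmaD[OF T[unfolded case_prod_unfold], of "\<lambda>n. delta n * (Xsum c n - qpow (2 * r) * Ysum c n)"] row
    by simp
  have T': "((\<lambda>(k, n). t n k) has_sum T) (UNIV \<times> UNIV)"
    using T by (subst (asm) has_sum_swap) (simp add: case_prod_unfold)
  define b where "b k = sg k * (qpow (21 * k\<^sup>2 + 2 * c * k) + qpow (21 * k\<^sup>2 + (14 + 2 * c) * k + (1 + 2 * r)))" for k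
  have col: "((\<lambda>n. t n k) has_sum conj_const * b k) UNIV" for k
  proof -
    have "((\<lambda>n. qpow (2 * (6 * k\<^sup>2 + c * k)) * (delta n * bailey n (3 * k))
      + - (qpow (2 * r) * qpow (2 * (6 * k\<^sup>2 + (4 + c) * k))) * (delta n * bailey n (3 * k + 1))) has_sum
      (qpow (2 * (6 * k\<^sup>2 + c * k)) * conj_sum (3 * k)
      + - (qpow (2 * r) * qpow (2 * (6 * k\<^sup>2 + (4 + c) * k))) * conj_sum (3 * k + 1))) UNIV"
      by (intro has_sum_add has_sum_cmult_right conj_sum_has_sum)
    moreover have "qpow (2 * (6 * k\<^sup>2 + c * k)) * (delta n * bailey n (3 * k))
      + - (qpow (2 * r) * qpow (2 * (6 * k\<^sup>2 + (4 + c) * k))) * (delta n * bailey n (3 * k + 1)) = t n k" for n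
      by (simp add: t_def algebra_simps)
    moreover have "qpow (2 * (6 * k\<^sup>2 + c * k)) * conj_sum (3 * k)
      + - (qpow (2 * r) * qpow (2 * (6 * k\<^sup>2 + (4 + c) * k))) * conj_sum (3 * k + 1) = conj_const * b k"
    proof -
      have s: "sg (3 * k) = sg k" "sg (3 * k + 1) = - sg k" by (auto simp: sg_def)
      have q: "qpow (2 * (6 * k\<^sup>2 + c * k)) * qpow ((3 * k)\<^sup>2) = qpow (21 * k\<^sup>2 + 2 * c * k)"
        "qpow (2 * r) * qpow (2 * (6 * k\<^sup>2 + (4 + c) * k)) * qpow ((3 * k + 1)\<^sup>2) = qpow (21 * k\<^sup>2 + (14 + 2 * c) * k + (1 + 2 * r))"
        unfolding qpow_add[symmetric] by (simp_all add: power2_eq_square algebra_simps)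
      show ?thesis unfolding conj_sum_eq s b_def q[symmetric] by (simp add: algebra_simps)
    qed
    ultimately show ?thesis by simp
  qed
  have 2: "((\<lambda>k. conj_const * b k) has_sum T) UNIV"
    using has_sum_SigmaD[OF T'[unfolded case_prod_unfold], of "\<lambda>k. conj_const * b k"] col by simp
  have "unit0 (qpoch_inf fls_X (fls_X ^ 2))" using qpoch_tendsto(2)[of 1 2] by simp
  moreover have "unit0 (qpoch_inf (fls_X ^ 2) (fls_X ^ 2))" by (rule qpoch_tendsto) auto
  ultimately have cc: "conj_const \<noteq> 0" using unit0_neq_0 by (auto simp: conj_const_def)
  then have "(b has_sum T / conj_const) UNIV" using 2 by (subst (asm) has_sum_cmult_right_iff) auto
  then show ?thesis using 1 cc unfolding b_def by (intro exI[of _ "T / conj_const"]) simp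
qed

section \<open>The quintuple product\<close>

lemma qpoch_0 [simp]: "qpoch a q 0 = 1"
  by (simp add: qpoch_def)

lemma qpoch_Suc_left: "qpoch a q (Suc n) = (1 - a) * qpoch (a * q) q n"
  by (induction n) (simp_all add: qpoch_Suc mult_ac)

lemma qpoch_add: "qpoch a q (m + n) = qpoch a q m * qpoch (a * q ^ m) q n"
  by (induction n) (simp_all add: qpoch_Suc power_add mult_ac)

lemma qpoch_neq_0:
  assumes "\<And>i. 1 - a * q ^ i \<noteq> (0 :: 'a::idom)"
  shows "qpoch a q n \<noteq> 0"
  using assms by (simp add: qpoch_def)

text \<open>The Wilf-Zeilberger equation of \<open>finite_quintuple_product\<close> after extraction
  of the common factor \<open>T\<close>, with K = p^k and M = p^(n+1-k).\<close>

lemma quintuple_aux: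
  fixes T :: "'a::field"
  assumes "1 - M \<noteq> 0" "1 - K * x^2 \<noteq> 0" "1 - x^2 * K * (K * M) \<noteq> 0"
  shows "T * ((1 + x * K) * (1 - K * M) * (1 - x * (K * M))) / ((1 - M) * (1 - K * x^2) * (1 - x^2 * K * (K * M))) -
    T * (1 + x * K) / (1 - K * x^2) =
    - (T * (x * K * (K * M))) / (1 - x^2 * K * (K * M)) - - (T * (M * (1 - K))) / ((1 - M) * (1 - K * x^2))"
proof -
  define a b c where "a = 1 - M" and "b = 1 - K * x^2" and "c = 1 - x^2 * K * (K * M)"
  have ne: "a \<noteq> 0" "b \<noteq> 0" "c \<noteq> 0" using assms by (simp_all add: a_def b_def c_def)
  have key: "(1 + x * K) * (1 - K * M) * (1 - x * (K * M)) - (1 + x * K) * a * c =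
     - (x * K * (K * M)) * a * b + M * (1 - K) * c"
    unfolding a_def b_def c_def by algebra
  have "T * ((1 + x * K) * (1 - K * M) * (1 - x * (K * M))) / (a * b * c) - T * (1 + x * K) / b =
    T * ((1 + x * K) * (1 - K * M) * (1 - x * (K * M)) - (1 + x * K) * a * c) / (a * b * c)"
    using ne by (simp add: field_simps)
  also have "\<dots> = - (T * (x * K * (K * M))) / c - - (T * (M * (1 - K))) / (a * b)"
    unfolding key using ne by (simp add: field_simps)
  finally show ?thesis by (simp only: a_def b_def c_def)
qed

text \<open>A terminating quintuple product with the product side divided into the summand. The
  value 1 is constant in n, so a telescoping difference F (n+1) k - F n k proves it by
  induction.\<close>

lemma finite_quintuple_product:
  fixes p x :: "'a::field"
  assumes ne1: "\<And>i. 1 - p * p ^ i \<noteq> 0" and ne2: "\<And>i. 1 - x^2 * p ^ i \<noteq> 0"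
  defines "F \<equiv> \<lambda>n k. (1 + x * p ^ k) * (x ^ k * p ^ (k\<^sup>2)) * (qpoch p p n / (qpoch p p k * qpoch p p (n - k))) *
     (qpoch x p (Suc n) / qpoch (p ^ k * x^2) p (Suc n))"
  shows "(\<Sum>k\<le>n. F n k) = 1"
proof -
  \<comment> \<open>the Wilf-Zeilberger mate of \<open>F\<close>\<close>
  define G where "G n k = - (x ^ k * p ^ (k\<^sup>2) * (p ^ (Suc n - k) * (1 - p ^ k)) * qpoch p p n * qpoch x p (Suc n)) /
     (qpoch p p k * qpoch p p (Suc n - k) * qpoch (p ^ k * x^2) p (Suc n))" for n k
  have pp: "qpoch p p i \<noteq> 0" for i by (rule qpoch_neq_0) (rule ne1)
  have nx: "1 - p ^ k * x^2 * p ^ i \<noteq> 0" for k i using ne2[of "k + i"] by (simp add: power_add mult_ac)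
  have px: "qpoch (p ^ k * x^2) p i \<noteq> 0" for k i by (rule qpoch_neq_0) (rule nx)
  have step: "F (Suc n) k - F n k = G n (Suc k) - G n k" if "k \<le> n" for n k
  proof -
    define K M where "K = p ^ k" and "M = p ^ (Suc n - k)"
    have KM: "p ^ Suc n = K * M" unfolding K_def M_def power_add[symmetric] using that by simp
    define A B W P1 X1 where "A = qpoch p p k" and "B = qpoch p p (n - k)" and "W = qpoch (p ^ Suc k * x^2) p n"
      and "P1 = qpoch p p n" and "X1 = qpoch x p (Suc n)"
    have nk: "Suc n - k = Suc (n - k)" "Suc n - Suc k = n - k" using that by auto
    have e1: "qpoch p p (Suc n - k) = B * (1 - M)"
      unfolding nk B_def M_def qpoch_Suc by simp
    have first: "p ^ k * x^2 * p = p ^ Suc k * x^2" by simp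
    have e2: "qpoch (p ^ k * x^2) p (Suc n) = (1 - K * x^2) * W"
      unfolding qpoch_Suc_left first W_def K_def ..
    have e3: "qpoch (p ^ Suc k * x^2) p (Suc n) = W * (1 - x^2 * K * (K * M))"
    proof -
      have "p ^ Suc k * x^2 * p ^ n = x^2 * K * p ^ Suc n" unfolding K_def by (simp add: mult_ac)
      then have "p ^ Suc k * x^2 * p ^ n = x^2 * K * (K * M)" unfolding KM .
      then show ?thesis unfolding qpoch_Suc W_def by simp
    qed
    have e4: "qpoch (p ^ k * x^2) p (Suc (Suc n)) = (1 - K * x^2) * (W * (1 - x^2 * K * (K * M)))"
      unfolding qpoch_Suc_left[of "p ^ k * x^2"] first e3 K_def ..
    have e5: "qpoch p p (Suc n) = P1 * (1 - K * M)" unfolding KM[symmetric] qpoch_Suc P1_def by simp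
    have e6: "qpoch x p (Suc (Suc n)) = X1 * (1 - x * (K * M))" unfolding KM[symmetric] qpoch_Suc[of x p "Suc n"] X1_def ..
    have e7: "qpoch p p (Suc k) = A * (1 - p ^ Suc k)" unfolding qpoch_Suc A_def by simp
    have ne: "A \<noteq> 0" "B \<noteq> 0" "1 - M \<noteq> 0" "1 - K * x^2 \<noteq> 0" "W \<noteq> 0" "1 - x^2 * K * (K * M) \<noteq> 0" "1 - p ^ Suc k \<noteq> 0"
      using pp[of k] pp[of "n - k"] pp[of "Suc n - k"] px[of k "Suc n"] px[of "Suc k" "Suc n"] pp[of "Suc k"]
      unfolding e1 e2 e3 e7 A_def[symmetric] B_def[symmetric] by auto
    define T where "T = x ^ k * p ^ (k\<^sup>2) * P1 * X1 / (A * B * W)"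
    have F1: "F (Suc n) k = T * ((1 + x * K) * (1 - K * M) * (1 - x * (K * M))) / ((1 - M) * (1 - K * x^2) * (1 - x^2 * K * (K * M)))"
      unfolding F_def e1 e4 e5 e6
      unfolding T_def K_def[symmetric] A_def[symmetric] by (simp add: mult_ac)
    have F0: "F n k = T * (1 + x * K) / (1 - K * x^2)"
      unfolding F_def e2
      unfolding T_def K_def[symmetric] A_def[symmetric] B_def[symmetric] P1_def[symmetric] X1_def[symmetric]
      by (simp add: mult_ac)
    have pk: "p ^ (Suc k)\<^sup>2 * p ^ (n - k) = p ^ (k\<^sup>2) * (K * (K * M))"
    proof -
      have "(Suc k)\<^sup>2 + (n - k) = k\<^sup>2 + (k + Suc n)" using that by (simp add: power2_eq_square)
      then show ?thesis unfolding KM[symmetric] unfolding K_def power_add[symmetric] by (rule arg_cong)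
    qed
    have G1: "G n (Suc k) = - (T * (x * K * (K * M))) / (1 - x^2 * K * (K * M))"
    proof -
      have "G n (Suc k) = - (x ^ Suc k * (p ^ (Suc k)\<^sup>2 * p ^ (n - k)) * (1 - p ^ Suc k) * P1 * X1) /
        (A * (1 - p ^ Suc k) * B * (W * (1 - x^2 * K * (K * M))))"
        unfolding G_def e3 e7 nk(2) P1_def X1_def B_def by (simp add: mult_ac)
      also have "\<dots> = - (T * (x * K * (K * M))) / (1 - x^2 * K * (K * M))"
        unfolding pk T_def using ne by (simp add: mult_ac)
      finally show ?thesis .
    qed
    have G0: "G n k = - (T * (M * (1 - K))) / ((1 - M) * (1 - K * x^2))"
      unfolding G_def e1 e2
      unfolding T_def P1_def[symmetric] X1_def[symmetric] A_def[symmetric] M_def[symmetric] K_def[symmetric]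
      by (simp add: mult_ac)
    show ?thesis unfolding F1 F0 G1 G0 by (rule quintuple_aux) (use ne in auto)
  qed
  show ?thesis
  proof (induction n)
    case 0
    have "1 - x^2 \<noteq> 0" using ne2[of 0] by simp
    moreover have "1 - x^2 = (1 + x) * (1 - x)" by (simp add: algebra_simps power2_eq_square)
    ultimately have "1 + x \<noteq> 0" "1 - x \<noteq> 0" by auto
    then show ?case using \<open>1 - x^2 \<noteq> 0\<close> by (simp add: F_def qpoch_Suc field_simps power2_eq_square)
  next
    case (Suc n)
    have "(\<Sum>k\<le>Suc n. F (Suc n) k) = (\<Sum>k\<le>n. F n k + (G n (Suc k) - G n k)) + F (Suc n) (Suc n)"
    proof -
      have "F (Suc n) k = F n k + (G n (Suc k) - G n k)" if "k \<le> n" for k using step[OF that] by (simp add: algebra_simps)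
      then show ?thesis by simp
    qed
    also have "\<dots> = 1 + (\<Sum>k\<le>n. G n (Suc k) - G n k) + F (Suc n) (Suc n)"
      using Suc.IH by (simp add: sum.distrib)
    also have "(\<Sum>k\<le>n. G n (Suc k) - G n k) = G n (Suc n) - G n 0"
      using sum_lessThan_telescope[of "G n" "Suc n"] by (simp add: lessThan_Suc_atMost)
    also have "G n 0 = 0" by (simp add: G_def)
    \<comment> \<open>The telescoping relation is available for k <= n, since n - k is truncated
      subtraction; the new top term cancels against the boundary value of \<open>G\<close>.\<close>
    also have "F (Suc n) (Suc n) = - G n (Suc n)"
    proof -
      define Y where "Y = p ^ Suc n"
      have n1: "1 - x * Y \<noteq> 0" "1 + x * Y \<noteq> 0"
      proof -
        have "1 - x^2 * (Y * Y) \<noteq> 0" using ne2[of "Suc n + Suc n"] unfolding Y_def power_add by simp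
        moreover have "1 - x^2 * (Y * Y) = (1 - x * Y) * (1 + x * Y)" by algebra
        ultimately show "1 - x * Y \<noteq> 0" "1 + x * Y \<noteq> 0" by auto
      qed
      have y: "1 - Y \<noteq> 0" using ne1[of n] by (simp add: Y_def)
      have e1: "qpoch x p (Suc (Suc n)) = qpoch x p (Suc n) * (1 - x * Y)" unfolding qpoch_Suc[of x p "Suc n"] Y_def ..
      have e2: "qpoch (Y * x^2) p (Suc (Suc n)) = qpoch (Y * x^2) p (Suc n) * ((1 - x * Y) * (1 + x * Y))"
      proof -
        have "1 - Y * x^2 * p ^ Suc n = (1 - x * Y) * (1 + x * Y)" unfolding Y_def[symmetric] by algebra
        then show ?thesis unfolding qpoch_Suc[of "Y * x^2" p "Suc n"] by simp
      qed
      have e3: "qpoch p p (Suc n) = qpoch p p n * (1 - Y)" by (simp add: qpoch_Suc Y_def)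
      have aux: "b * Z * (P * c / (P * c)) * (X * a / (W * (a * b))) = - (- (Z * c * P * X) / (P * c * W))"
        if "a \<noteq> 0" "b \<noteq> 0" "c \<noteq> 0" "P \<noteq> 0" "W \<noteq> 0" for a b c P W X Z :: 'a
        using that by (simp add: field_simps)
      have "qpoch (Y * x^2) p (Suc n) \<noteq> 0" unfolding Y_def by (rule px)
      from aux[OF n1 y pp this] show ?thesis
        unfolding F_def G_def Y_def[symmetric] e1 e2 e3 by simp
    qed
    finally show ?case by simp
  qed
qed

text \<open>Each factor 1 - q^(-b) equals -q^(-b) (1 - q^b). Extracting the monomials leaves a
  product with positive exponents, which converges as m grows.\<close>

lemma qpoch_reflect:
  "qpoch (qpow (a - 14 * int m)) (fls_X ^ 14) m =
    (- 1) ^ m * qpow (a * int m - 7 * (int m * (int m + 1))) * qpoch (qpow (14 - a)) (fls_X ^ 14) m"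
proof (induction m)
  case (Suc m)
  have p14: "fls_X ^ 14 = qpow 14" using qpow_of_nat[of 14] by simp
  define b where "b = a - 14 * int (Suc m)"
  have e: "qpow b * fls_X ^ 14 = qpow (a - 14 * int m)" unfolding p14 b_def qpow_add[symmetric] by simp
  have p: "(fls_X ^ 14) ^ m = qpow (14 * int m)"
    using qpow_of_nat[of "14 * m"] by (simp add: power_mult)
  have l: "qpow (14 - a) * (fls_X ^ 14) ^ m = qpow (- b)" unfolding p b_def qpow_add[symmetric] by (simp add: algebra_simps)
  have "qpow b * qpow (- b) = 1" unfolding qpow_add[symmetric] by simp
  then have f: "1 - qpow b = - qpow b * (1 - qpow (- b))" by (simp add: algebra_simps)
  have g: "qpow b * qpow (a * int m - 7 * (int m * (int m + 1))) = qpow (a * int (Suc m) - 7 * (int (Suc m) * (int (Suc m) + 1)))"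
    unfolding b_def qpow_add[symmetric] by (simp add: algebra_simps)
  have "qpoch (qpow b) (fls_X ^ 14) (Suc m) =
     - qpow b * (1 - qpow (- b)) * ((- 1) ^ m * qpow (a * int m - 7 * (int m * (int m + 1))) * qpoch (qpow (14 - a)) (fls_X ^ 14) m)"
    unfolding qpoch_Suc_left e Suc.IH f ..
  also have "\<dots> = (- 1) ^ Suc m * (qpow b * qpow (a * int m - 7 * (int m * (int m + 1)))) *
     (qpoch (qpow (14 - a)) (fls_X ^ 14) m * (1 - qpow (14 - a) * (fls_X ^ 14) ^ m))"
    unfolding l by (simp add: mult_ac)
  finally show ?case unfolding g b_def[symmetric] qpoch_Suc .
qed simp

section \<open>From the finite to the infinite quintuple product\<close>

lemma qpow_neq_1: "e \<noteq> 0 \<Longrightarrow> qpow e \<noteq> 1"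
proof
  assume "e \<noteq> 0" "qpow e = 1"
  then have "fls_subdegree (qpow e) = 0" by simp
  then show False using \<open>e \<noteq> 0\<close> by (simp add: qpow_def)
qed

context
  fixes s :: nat
  assumes s: "0 < s" "s < 7"
begin

text \<open>The product part of the finite identity at x = q^s in base q^14; s < 7 keeps all
  exponents positive. For a = m - k and b = m + k its limit in m does not depend on k and is the
  reciprocal of the product in \<open>quintuple_product\<close>.\<close>

definition quintuple_ratio :: "nat \<Rightarrow> nat \<Rightarrow> nat \<Rightarrow> rat fls" where
  "quintuple_ratio m a b = qpoch (fls_X ^ 14) (fls_X ^ 14) (2 * m) * qpoch (fls_X ^ (14 - s)) (fls_X ^ 14) m *
     qpoch (fls_X ^ s) (fls_X ^ 14) (Suc m) *
     inverse (qpoch (fls_X ^ 14) (fls_X ^ 14) a * qpoch (fls_X ^ 14) (fls_X ^ 14) b *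
       qpoch (fls_X ^ (14 - 2 * s)) (fls_X ^ 14) a * qpoch (fls_X ^ (2 * s)) (fls_X ^ 14) (Suc b))"

text \<open>The finite identity with p = q^14, n = 2m and x = q^(s - 14m), recentred by j = k + m so
  that the range becomes symmetric; then x p^j = q^(s + 14k).\<close>

lemma bilateral_quintuple_finite:
  "(\<Sum>k\<in>{- int m..int m}. sg k * qpow (21 * k\<^sup>2 + (3 * int s - 7) * k) * (1 + qpow (int s + 14 * k)) *
      quintuple_ratio m (nat (int m - k)) (nat (int m + k))) = 1"
proof -
  let ?p = "fls_X ^ 14 :: rat fls"
  define x where "x = qpow (int s - 14 * int m)"
  have pq: "?p ^ i = qpow (14 * int i)" for i using qpow_of_nat[of "14 * i"] by (simp add: power_mult)
  have xq: "x ^ i = qpow ((int s - 14 * int m) * int i)" for i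
    by (induction i) (simp_all add: x_def qpow_add[symmetric] algebra_simps)
  have ne1: "1 - ?p * ?p ^ i \<noteq> 0" for i
    using one_minus_X_power_neq_0[of "14 * Suc i"] by (simp only: power_mult power_Suc) simp
  have ne2: "1 - x^2 * ?p ^ i \<noteq> 0" for i
  proof -
    have "x^2 * ?p ^ i = qpow (2 * (int s - 14 * int m) + 14 * int i)"
      unfolding xq pq qpow_add[symmetric] by (simp add: algebra_simps)
    moreover have "2 * (int s - 14 * int m) + 14 * int i \<noteq> 0" using s by presburger
    ultimately show ?thesis using qpow_neq_1 by simp
  qed
  have "(\<Sum>k\<le>2 * m. (1 + x * ?p ^ k) * (x ^ k * ?p ^ (k\<^sup>2)) * (qpoch ?p ?p (2 * m) / (qpoch ?p ?p k * qpoch ?p ?p (2 * m - k))) *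
     (qpoch x ?p (Suc (2 * m)) / qpoch (?p ^ k * x^2) ?p (Suc (2 * m)))) = 1"
    by (rule finite_quintuple_product[OF ne1 ne2])
  also have "(\<Sum>k\<le>2 * m. (1 + x * ?p ^ k) * (x ^ k * ?p ^ (k\<^sup>2)) * (qpoch ?p ?p (2 * m) / (qpoch ?p ?p k * qpoch ?p ?p (2 * m - k))) *
     (qpoch x ?p (Suc (2 * m)) / qpoch (?p ^ k * x^2) ?p (Suc (2 * m)))) =
   (\<Sum>k\<in>{- int m..int m}. sg k * qpow (21 * k\<^sup>2 + (3 * int s - 7) * k) * (1 + qpow (int s + 14 * k)) *
      quintuple_ratio m (nat (int m - k)) (nat (int m + k)))"
  proof (rule sum.reindex_bij_witness[of _ "\<lambda>k. nat (int m + k)" "\<lambda>k. int k - int m"])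
    fix j assume j: "j \<in> {..2 * m}"
    define k where "k = int j - int m"
    define a where "a = 2 * m - j"
    have ka: "nat (int m - k) = a" "nat (int m + k) = j" "int a = int m - k" "int j = int m + k"
      using j by (auto simp: k_def a_def)
    have c1: "x * ?p ^ j = qpow (int s + 14 * k)" unfolding x_def pq qpow_add[symmetric] k_def by (simp add: algebra_simps)
    have c2: "qpoch x ?p (Suc (2 * m)) = (- 1) ^ m * qpow (int s * int m - 7 * (int m * (int m + 1))) *
       qpoch (fls_X ^ (14 - s)) ?p m * qpoch (fls_X ^ s) ?p (Suc m)"
    proof -
      have "x * ?p ^ m = qpow (int s)" unfolding x_def pq qpow_add[symmetric] by simp
      then have "x * ?p ^ m = fls_X ^ s" unfolding qpow_of_nat .
      moreover have "qpow (14 - int s) = fls_X ^ (14 - s)" unfolding qpow_of_nat[symmetric] using s by (simp add: of_nat_diff)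
      moreover have "Suc (2 * m) = m + Suc m" by simp
      ultimately show ?thesis by (simp only: qpoch_add[of x] qpoch_reflect[of "int s" m, folded x_def])
    qed
    have c3: "qpoch (?p ^ j * x^2) ?p (Suc (2 * m)) = (- 1) ^ a * qpow (2 * int s * int a - 7 * (int a * (int a + 1))) *
       qpoch (fls_X ^ (14 - 2 * s)) ?p a * qpoch (fls_X ^ (2 * s)) ?p (Suc j)"
    proof -
      have 1: "?p ^ j * x^2 = qpow (2 * int s - 14 * int a)"
        unfolding pq xq qpow_add[symmetric] ka(3,4) by (simp add: algebra_simps)
      have "qpow (2 * int s - 14 * int a) * ?p ^ a = qpow (int (2 * s))"
        unfolding pq qpow_add[symmetric] by simp
      then have 2: "qpow (2 * int s - 14 * int a) * ?p ^ a = fls_X ^ (2 * s)" unfolding qpow_of_nat .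
      have 3: "qpow (14 - 2 * int s) = fls_X ^ (14 - 2 * s)" unfolding qpow_of_nat[symmetric] using s by (simp add: of_nat_diff)
      have 4: "Suc (2 * m) = a + Suc j" using j by (simp add: a_def)
      show ?thesis unfolding 1 4 qpoch_add qpoch_reflect 2 3 ..
    qed
    have c4: "x ^ j * ?p ^ (j\<^sup>2) = qpow ((int s - 14 * int m) * int j + 14 * (int j)\<^sup>2)"
      unfolding xq pq qpow_add[symmetric] by simp
    define e1 e2 e3 where "e1 = (int s - 14 * int m) * int j + 14 * (int j)\<^sup>2" and
      "e2 = int s * int m - 7 * (int m * (int m + 1))" and "e3 = 2 * int s * int a - 7 * (int a * (int a + 1))"
    have ee: "e1 + e2 - e3 = 21 * k\<^sup>2 + (3 * int s - 7) * k"
      unfolding e1_def e2_def e3_def ka(3,4) by (simp add: algebra_simps power2_eq_square)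
    have qe: "qpow e1 * qpow e2 = qpow (21 * k\<^sup>2 + (3 * int s - 7) * k) * qpow e3"
      unfolding qpow_add[symmetric] ee[symmetric] by simp
    have sgn: "(- 1) ^ m = sg k * (- 1) ^ a"
    proof -
      have "even m = (even k = even a)" using ka(3) by presburger
      then show ?thesis by (cases "even a"; cases "even k"; simp add: sg_def)
    qed
    have nz: "(- 1) ^ a \<noteq> (0 :: rat fls)" "qpow e3 \<noteq> 0" by simp_all
    have "(1 + x * ?p ^ j) * (x ^ j * ?p ^ (j\<^sup>2)) * (qpoch ?p ?p (2 * m) / (qpoch ?p ?p j * qpoch ?p ?p (2 * m - j))) *
     (qpoch x ?p (Suc (2 * m)) / qpoch (?p ^ j * x^2) ?p (Suc (2 * m))) =
     ((qpow e1 * qpow e2) * (- 1) ^ m) / ((- 1) ^ a * qpow e3) * (1 + qpow (int s + 14 * k)) * quintuple_ratio m a j"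
      unfolding c1 c2 c3 c4 e1_def[symmetric] e2_def[symmetric] e3_def[symmetric] a_def[symmetric] quintuple_ratio_def
      by (simp add: divide_inverse mult_ac)
    also have "\<dots> = sg k * qpow (21 * k\<^sup>2 + (3 * int s - 7) * k) * (1 + qpow (int s + 14 * k)) * quintuple_ratio m a j"
      unfolding qe sgn using nz by (simp add: mult_ac)
    finally show "sg (int j - int m) * qpow (21 * (int j - int m)\<^sup>2 + (3 * int s - 7) * (int j - int m)) * (1 + qpow (int s + 14 * (int j - int m))) *
      quintuple_ratio m (nat (int m - (int j - int m))) (nat (int m + (int j - int m))) =
      (1 + x * ?p ^ j) * (x ^ j * ?p ^ (j\<^sup>2)) * (qpoch ?p ?p (2 * m) / (qpoch ?p ?p j * qpoch ?p ?p (2 * m - j))) *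
     (qpoch x ?p (Suc (2 * m)) / qpoch (?p ^ j * x^2) ?p (Suc (2 * m)))"
      unfolding k_def[symmetric] ka(1,2) by simp
  qed auto
  finally show ?thesis .
qed

lemma quintuple_product:
  "((\<lambda>k. sg k * qpow (21 * k\<^sup>2 + (3 * int s - 7) * k) * (1 + qpow (int s + 14 * k))) has_sum
     (qpoch_inf (fls_X ^ 14) (fls_X ^ 14) * qpoch_inf (fls_X ^ (14 - 2 * s)) (fls_X ^ 14) * qpoch_inf (fls_X ^ (2 * s)) (fls_X ^ 14) /
      (qpoch_inf (fls_X ^ (14 - s)) (fls_X ^ 14) * qpoch_inf (fls_X ^ s) (fls_X ^ 14)))) UNIV"
proof -
  define w where "w k = sg k * qpow (21 * k\<^sup>2 + (3 * int s - 7) * k) * (1 + qpow (int s + 14 * k))" for k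
  define f where "f m k = (if k \<in> {- int m..int m} then w k * quintuple_ratio m (nat (int m - k)) (nat (int m + k)) else 0)" for m k
  define R where "R = qpoch_inf (fls_X ^ 14) (fls_X ^ 14) * qpoch_inf (fls_X ^ (14 - s)) (fls_X ^ 14) *
     qpoch_inf (fls_X ^ s) (fls_X ^ 14) *
     inverse (qpoch_inf (fls_X ^ 14) (fls_X ^ 14) * qpoch_inf (fls_X ^ 14) (fls_X ^ 14) *
       qpoch_inf (fls_X ^ (14 - 2 * s)) (fls_X ^ 14) * qpoch_inf (fls_X ^ (2 * s)) (fls_X ^ 14))"
  have pos: "14 - s > 0" "14 - 2 * s > 0" "2 * s > 0" using s by auto
  have unit: "unit0 (quintuple_ratio m a b)" for m a b
    unfolding quintuple_ratio_def using s pos by (intro unit0_mult unit0_inverse unit0_qpoch) auto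
  have sums: "(f m has_sum 1) UNIV" for m
    by (rule has_sum_finite_neutralI[of "{- int m..int m}"])
      (auto simp: f_def w_def bilateral_quintuple_finite)
  have lim1: "filterlim (\<lambda>m. nat (int m - k)) sequentially sequentially"
    "filterlim (\<lambda>m. nat (int m + k)) sequentially sequentially"
    "filterlim (\<lambda>m. Suc (nat (int m + k))) sequentially sequentially" for k
  proof -
    have "N \<le> nat (int m - k) \<and> N \<le> nat (int m + k) \<and> N \<le> Suc (nat (int m + k))" if "m \<ge> nat \<bar>k\<bar> + N" for N m
      using that by linarith
    then show "filterlim (\<lambda>m. nat (int m - k)) sequentially sequentially"
      "filterlim (\<lambda>m. nat (int m + k)) sequentially sequentially"
      "filterlim (\<lambda>m. Suc (nat (int m + k))) sequentially sequentially"
      unfolding filterlim_at_top eventually_sequentially by blast+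
  qed
  have lim2: "filterlim (\<lambda>m. 2 * m) sequentially (sequentially :: nat filter)"
    by (rule filterlim_subseq) (auto simp: strict_mono_def)
  have lim3: "(\<lambda>m. quintuple_ratio m (nat (int m - k)) (nat (int m + k))) \<longlonglongrightarrow> R" for k
    unfolding quintuple_ratio_def R_def using s pos
    by (intro tendsto_mult tendsto_inverse_unit0 unit0_mult unit0_qpoch qpoch_tendsto(1)
        filterlim_compose[OF qpoch_tendsto(1) lim1(1)] filterlim_compose[OF qpoch_tendsto(1) lim1(2)]
        filterlim_compose[OF qpoch_tendsto(1) lim1(3)] filterlim_compose[OF qpoch_tendsto(1) lim2]
        filterlim_compose[OF qpoch_tendsto(1) filterlim_Suc]) auto
  have lim: "(\<lambda>m. f m k) \<longlonglongrightarrow> w k * R" for k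
  proof (rule Lim_transform_eventually)
    show "(\<lambda>m. w k * quintuple_ratio m (nat (int m - k)) (nat (int m + k))) \<longlonglongrightarrow> w k * R"
      by (intro tendsto_mult tendsto_const lim3)
    show "\<forall>\<^sub>F m in sequentially. w k * quintuple_ratio m (nat (int m - k)) (nat (int m + k)) = f m k"
      unfolding eventually_sequentially by (intro exI[of _ "nat \<bar>k\<bar>"]) (auto simp: f_def)
  qed
  \<comment> \<open>A generous bound: 21 k^2 >= 42 |k| - 21 outweighs the linear terms, of size at
    most 11 |k| and 14 |k|. Linear growth in |k| is all that domination requires.\<close>
  have ordw: "ord_ge (\<bar>k\<bar> - 50) (w k)" for k
  proof -
    have sgu: "ord_ge 0 (sg k)" by (auto simp: sg_def ord_ge_def)
    have bound: "21 * k\<^sup>2 \<ge> 42 * \<bar>k\<bar> - 21"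
    proof -
      have "0 \<le> (\<bar>k\<bar> - 1)\<^sup>2" by simp
      then show ?thesis by (simp add: power2_eq_square algebra_simps)
    qed
    have sk: "\<bar>(3 * int s - 7) * k\<bar> \<le> 11 * \<bar>k\<bar>"
      unfolding abs_mult using s by (intro mult_right_mono) auto
    have "ord_ge (0 + (\<bar>k\<bar> - 50 + 14 * \<bar>k\<bar>) + (- 14 * \<bar>k\<bar>)) (w k)"
      unfolding w_def
    proof (intro ord_ge_mult sgu ord_ge_add)
      show "ord_ge (\<bar>k\<bar> - 50 + 14 * \<bar>k\<bar>) (qpow (21 * k\<^sup>2 + (3 * int s - 7) * k))"
        by (rule ord_ge_mono[OF ord_ge_qpow]) (use bound sk in linarith)
      show "ord_ge (- 14 * \<bar>k\<bar>) (1 :: rat fls)" by (rule ord_ge_mono[OF ord_ge_1]) simp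
      show "ord_ge (- 14 * \<bar>k\<bar>) (qpow (int s + 14 * k))" by (rule ord_ge_mono[OF ord_ge_qpow]) linarith
    qed
    then show ?thesis by simp
  qed
  have ordf: "ord_ge (\<bar>k\<bar> - 50) (f m k)" for m k
  proof -
    have "ord_ge (\<bar>k\<bar> - 50 + 0) (w k * quintuple_ratio m (nat (int m - k)) (nat (int m + k)))"
      by (intro ord_ge_mult ordw unit0_ord_ge unit)
    then show ?thesis by (simp add: f_def)
  qed
  have fin: "finite {k. \<exists>m. \<not> ord_ge N (f m k)}" for N
  proof (rule finite_subset)
    show "{k. \<exists>m. \<not> ord_ge N (f m k)} \<subseteq> {- \<bar>N\<bar> - 50..\<bar>N\<bar> + 50}"
    proof safe
      fix k m assume "\<not> ord_ge N (f m k)"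
      then have "\<not> N \<le> \<bar>k\<bar> - 50" using ord_ge_mono[OF ordf] by blast
      then show "k \<in> {- \<bar>N\<bar> - 50..\<bar>N\<bar> + 50}" by auto
    qed
  qed simp
  obtain S where S: "((\<lambda>k. w k * R) has_sum S) UNIV" "(\<lambda>m. 1) \<longlonglongrightarrow> S"
    using tannery_has_sum[OF fin sums lim] by blast
  have S1: "S = 1" using S(2) by (simp add: LIMSEQ_const_iff)
  have u: "unit0 (qpoch_inf (fls_X ^ 14) (fls_X ^ 14))" "unit0 (qpoch_inf (fls_X ^ (14 - s)) (fls_X ^ 14))"
    "unit0 (qpoch_inf (fls_X ^ s) (fls_X ^ 14))" "unit0 (qpoch_inf (fls_X ^ (14 - 2 * s)) (fls_X ^ 14))"
    "unit0 (qpoch_inf (fls_X ^ (2 * s)) (fls_X ^ 14))"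
    using s pos by (intro qpoch_tendsto(2); simp)+
  note nz = u[THEN unit0_neq_0]
  have R0: "R \<noteq> 0" unfolding R_def using nz by simp
  have "((\<lambda>k. R * w k) has_sum 1) UNIV" using S(1) S1 by (simp add: mult.commute)
  then have "(w has_sum 1 / R) UNIV" by (subst (asm) has_sum_cmult_right_iff) (use R0 in auto)
  moreover have "1 / R = qpoch_inf (fls_X ^ 14) (fls_X ^ 14) * qpoch_inf (fls_X ^ (14 - 2 * s)) (fls_X ^ 14) * qpoch_inf (fls_X ^ (2 * s)) (fls_X ^ 14) /
      (qpoch_inf (fls_X ^ (14 - s)) (fls_X ^ 14) * qpoch_inf (fls_X ^ s) (fls_X ^ 14))"
    unfolding R_def using nz by (simp add: field_simps)
  ultimately show ?thesis unfolding w_def by simp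
qed

end

section \<open>Evaluation at one\<close>

lemma F_system_unique:
  assumes "F_system F" "F_system F'" "F 7 \<in> S_space" "F' 7 \<in> S_space" "i \<in> {0, 1, 2, 3, 4, 5, 7}"
  shows "F i = F' i"
proof -
  have "fps_nth (lift_xq (F 7)) 0 = fps_nth (lift_xq (F' 7)) 0"
    using assms(3,4) by (simp add: S_space_def lift_xq_nth)
  note u = reduced_system_unique[OF F_system_reduced[OF assms(1)] F_system_reduced[OF assms(2)] this]
  have u4: "lift_xq (F 4) = lift_xq (F' 4)" using u(3) by simp
  have "lift_xq (F i) = lift_xq (F' i)"
    using assms(5) u(1,2) u4 F_system_elim(1-4)[OF assms(1)] F_system_elim(1-4)[OF assms(2)] by auto
  then show ?thesis by (simp only: lift_xq_inject)
qed

lemma F_series_eq: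
  assumes "i \<in> {0, 1, 2, 3, 4, 5, 7}"
  shows "F_series i = gen_series (nandi_class i)"
proof -
  let ?I = "{0, 1, 2, 3, 4, 5, 7 :: nat}"
  define G where "G = restrict (\<lambda>i. gen_series (nandi_class i)) ?I"
  have G: "F_system G"
    using gen_series_nandi_system by (simp add: F_system_def G_def)
  have GE: "G \<in> ?I \<rightarrow>\<^sub>E S_space"
    using gen_series_nandi_S_space by (simp add: G_def PiE_def)
  have "F_series = G"
    unfolding F_series_def
  proof (rule the_equality)
    fix F assume F: "F \<in> ?I \<rightarrow>\<^sub>E S_space \<and> F_system F"
    then have "F 7 \<in> S_space" "G 7 \<in> S_space" using GE by (blast intro: PiE_mem)+
    then have "F i = G i" if "i \<in> ?I" for i using F_system_unique[OF _ G _ _ that] F by blast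
    then show "F = G" using F GE by (blast intro: PiE_ext)
  qed (use G GE in blast)
  show ?thesis unfolding \<open>F_series = G\<close> G_def using assms by (rule restrict_apply')
qed

text \<open>Parts are positive, so the weight is at least the number of parts. This makes the
  specialisation x = 1 meaningful.\<close>

lemma ord_ge_gen_series:
  assumes "C \<subseteq> N_set"
  shows "ord_ge (int n) (fps_nth (lift_xq (gen_series C)) n)"
proof -
  have len: "length p \<le> sum_list p" if "p \<in> C" for p
  proof -
    have "length p \<le> sum_list p" if "0 \<notin> set p" for p :: "nat list" using that by (induction p) auto
    then show ?thesis using that assms N_set_0 by blast
  qed
  have "{p \<in> C. length p = n \<and> sum_list p = k} = {}" if "k < n" for k
    using len that by fastforce
  then have "fps_nth (fps_nth (gen_series C) n) k = 0" if "k < n" for k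
    using that by (simp only: gen_series_nth card.empty of_nat_0)
  then show ?thesis by (auto simp: ord_ge_def lift_xq_nth lift_q_def)
qed

text \<open>The coefficient is the sum over n <= m of f_n times qs m / qs (m - n), and each of these
  weights tends to 1. The order bound provides the domination for
  \<open>tannery_has_sum\<close>.\<close>

lemma expq_limit:
  assumes "\<And>n. ord_ge (int n) (fps_nth f n)"
  shows "\<exists>S. (fps_nth f has_sum S) UNIV \<and> (\<lambda>m. qs m * fps_nth (expq * f) m) \<longlonglongrightarrow> S"
proof -
  define t where "t m n = (if n \<le> m then fps_nth f n * (qs m * inverse (qs (m - n))) else 0)" for m n
  have ord: "ord_ge (int n) (t m n)" for m n
  proof -
    have "ord_ge (int n + 0) (fps_nth f n * (qs m * inverse (qs (m - n))))"
      by (intro ord_ge_mult assms unit0_ord_ge unit0_mult unit0_inverse unit0_qs)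
    then show ?thesis by (simp add: t_def)
  qed
  have fin: "finite {n. \<exists>m. \<not> ord_ge N (t m n)}" for N
  proof (rule finite_subset)
    show "{n. \<exists>m. \<not> ord_ge N (t m n)} \<subseteq> {..nat N}"
    proof safe
      fix n m assume "\<not> ord_ge N (t m n)"
      then have "\<not> N \<le> int n" using ord_ge_mono[OF ord] by blast
      then show "n \<le> nat N" by simp
    qed
  qed simp
  have sums: "(t m has_sum qs m * fps_nth (expq * f) m) UNIV" for m
  proof (rule has_sum_finite_neutralI[of "{0..m}"])
    show "qs m * fps_nth (expq * f) m = (\<Sum>n\<in>{0..m}. t m n)"
      unfolding mult.commute[of expq] fps_mult_nth sum_distrib_left expq_nth
      by (intro sum.cong) (auto simp: t_def)
  qed (auto simp: t_def)
  have lim: "(\<lambda>m. t m n) \<longlonglongrightarrow> fps_nth f n" for n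
  proof -
    let ?Q = "qpoch_inf (fls_X ^ 2) (fls_X ^ 2)"
    have Q: "qs \<longlonglongrightarrow> ?Q" unfolding qs_def using qpoch_tendsto(1)[of 2 2] by simp
    have "(\<lambda>m. inverse (qs (m - n))) \<longlonglongrightarrow> inverse ?Q"
      by (rule tendsto_inverse_unit0) (use filterlim_compose[OF Q filterlim_minus_const_nat_at_top] unit0_qs in auto)
    then have "(\<lambda>m. fps_nth f n * (qs m * inverse (qs (m - n)))) \<longlonglongrightarrow> fps_nth f n * (?Q * inverse ?Q)"
      by (intro tendsto_mult tendsto_const Q)
    moreover have "?Q \<noteq> 0" using qpoch_tendsto(2)[of 2 2] unit0_neq_0 by auto
    ultimately have "(\<lambda>m. fps_nth f n * (qs m * inverse (qs (m - n)))) \<longlonglongrightarrow> fps_nth f n" by simp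
    then show ?thesis
      by (rule Lim_transform_eventually) (auto simp: eventually_sequentially t_def intro!: exI[of _ n])
  qed
  show ?thesis using tannery_has_sum[OF fin sums lim] by blast
qed

lemma poch_neg_eq: "poch_neg m * (qpoch fls_X (fls_X ^ 2) m * qs m) = qs (2 * m)"
proof (induction m)
  case (Suc m)
  define u v where "u = (fls_X :: rat fls) ^ (2 * m + 1)" and "v = (fls_X :: rat fls) ^ (2 * m + 2)"
  have uu: "fls_X ^ (2 * Suc (2 * m)) = u * u" and vv: "fls_X ^ (2 * Suc (Suc (2 * m))) = v * v"
    unfolding u_def v_def power_add[symmetric] by (rule arg_cong[of _ _ "power fls_X"], simp)+
  have u: "fls_X * (fls_X ^ 2) ^ m = u" and v: "fls_X ^ (2 * Suc m) = v"
    by (simp_all add: u_def v_def power_mult)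
  have d: "2 * Suc m = Suc (Suc (2 * m))" by simp
  have "poch_neg (Suc m) * (qpoch fls_X (fls_X ^ 2) (Suc m) * qs (Suc m)) =
    poch_neg m * (qpoch fls_X (fls_X ^ 2) m * qs m) * ((1 + u) * (1 - u)) * ((1 + v) * (1 - v))"
    unfolding poch_neg_Suc qpoch_Suc qs_Suc u v u_def[symmetric] v_def[symmetric] by (simp only: mult_ac)
  also have "\<dots> = qs (2 * m) * (1 - u * u) * (1 - v * v)" unfolding Suc.IH by algebra
  also have "\<dots> = qs (2 * Suc m)" unfolding d qs_Suc uu vv ..
  finally show ?case .
qed (simp add: poch_neg_def qpoch_def)

text \<open>\<open>poch_neg_eq\<close> says that (-q;q)_(2m) (q;q)_(2m) = (q^2;q^2)_(2m). The limit
  is Euler's identity between distinct and odd parts.\<close>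

lemma poch_neg_tendsto: "poch_neg \<longlonglongrightarrow> inverse (qpoch_inf fls_X (fls_X ^ 2))"
proof -
  let ?Q = "qpoch_inf (fls_X ^ 2) (fls_X ^ 2)" and ?P = "qpoch_inf fls_X (fls_X ^ 2)"
  have Q: "qs \<longlonglongrightarrow> ?Q" unfolding qs_def using qpoch_tendsto(1)[of 2 2] by simp
  have P: "qpoch fls_X (fls_X ^ 2) \<longlonglongrightarrow> ?P" using qpoch_tendsto(1)[of 1 2] by simp
  have uP: "unit0 (qpoch fls_X (fls_X ^ 2) m :: rat fls)" for m using unit0_qpoch[of 1 2 m] by simp
  have "filterlim (\<lambda>m. 2 * m) sequentially (sequentially :: nat filter)"
    by (rule filterlim_subseq) (auto simp: strict_mono_def)
  from filterlim_compose[OF Q this] have Q2: "(\<lambda>m. qs (2 * m)) \<longlonglongrightarrow> ?Q" .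
  have "(\<lambda>m. qs (2 * m) * inverse (qpoch fls_X (fls_X ^ 2) m * qs m)) \<longlonglongrightarrow> ?Q * inverse (?P * ?Q)"
    by (intro tendsto_mult tendsto_inverse_unit0 Q2 P Q unit0_mult uP unit0_qs)
  moreover have "qs (2 * m) * inverse (qpoch fls_X (fls_X ^ 2) m * qs m) = poch_neg m" for m
    unfolding poch_neg_eq[symmetric] using unit0_neq_0[OF uP[of m]] qs_neq_0[of m] by (simp add: field_simps)
  moreover have "?Q \<noteq> 0" using qpoch_tendsto(2)[of 2 2] unit0_neq_0 by auto
  ultimately show ?thesis by (simp add: field_simps)
qed

lemma ord_ge_useq: "ord_ge 0 a \<Longrightarrow> ord_ge (int n) (a * useq n)"
proof -
  assume a: "ord_ge 0 a"
  have "ord_ge (0 + 0) (a * inverse (qs (2 * n)))"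
    by (rule ord_ge_mult[OF a unit0_ord_ge[OF unit0_inverse[OF unit0_qs]]])
  then have "ord_ge (int n) (delta n * (a * inverse (qs (2 * n))))" by (intro ord_ge_delta_mult) simp
  then show ?thesis by (simp add: useq_def divide_inverse mult_ac)
qed

text \<open>The damped series and the explicit ones obey the same recurrences with the same initial
  values. Hence the coefficients of \<open>expq * f\<close> are \<open>poch_neg\<close> times those
  of \<open>expq * Useries\<close>, and \<open>expq_limit\<close> on both sides relates the sums by
  the limit of \<open>poch_neg\<close>; likewise for g and h.\<close>

lemma specialize_at_one:
  assumes h: "h = fps_X * qf^2 * E h + E f"
    and g: "g = (fps_X * qf + fps_X * qf^2) * E g + fps_X * qf^3 * (1 - fps_X * qf^2) * E (E g) + E f"
    and f: "f - E f - fps_X * qf^2 * (E g - fps_X * qf^3 * E (E g)) - fps_X^2 * qf^4 * E (E f)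
       - fps_X * qf^3 * E (E g) = fps_X^2 * qf^6 * E (E h)"
    and f0: "fps_nth f 0 = 1"
    and ord: "\<And>n. ord_ge (int n) (fps_nth f n)" "\<And>n. ord_ge (int n) (fps_nth g n)" "\<And>n. ord_ge (int n) (fps_nth h n)"
  shows "(useq has_sum S) UNIV \<Longrightarrow> (fps_nth f has_sum S / qpoch_inf fls_X (fls_X ^ 2)) UNIV"
    "((\<lambda>n. qpow (2 * int n) * useq n) has_sum S) UNIV \<Longrightarrow> (fps_nth g has_sum S / qpoch_inf fls_X (fls_X ^ 2)) UNIV"
    "(vseq has_sum S) UNIV \<Longrightarrow> (fps_nth h has_sum S / qpoch_inf fls_X (fls_X ^ 2)) UNIV"
proof -
  note rec = damped_recurrence[OF damped_system[OF h g f]]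
  note rec' = explicit_recurrence
  have q0: "fps_nth (expq * k) 0 = fps_nth k 0" for k by (simp add: expq_nth)
  have p0: "poch_neg 0 = 1" by (simp add: poch_neg_def)
  have u0: "useq 0 = 1" by (simp add: useq_def delta_def qpoch_def)
  have init: "fps_nth (expq * f) 0 = poch_neg 0 * fps_nth (expq * Useries) 0"
    "fps_nth (expq * g) 0 = poch_neg 0 * fps_nth (expq * E Useries) 0"
    "fps_nth (expq * h) 0 = poch_neg 0 * fps_nth (expq * Vseries) 0"
    using f0 rec(4,5)[unfolded q0] unfolding q0 p0 by (simp_all add: Useries_def Vseries_def vseq_def u0)
  have eq: "fps_nth (expq * f) m = poch_neg m * fps_nth (expq * Useries) m \<and>
      fps_nth (expq * g) m = poch_neg m * fps_nth (expq * E Useries) m \<and>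
      fps_nth (expq * h) m = poch_neg m * fps_nth (expq * Vseries) m" for m
    by (rule coupled_recurrence_unique[of "fps_nth (expq * f)" "fps_nth (expq * g)" "fps_nth (expq * h)"
          "\<lambda>m. poch_neg m * fps_nth (expq * Useries) m" "\<lambda>m. poch_neg m * fps_nth (expq * E Useries) m"
          "\<lambda>m. poch_neg m * fps_nth (expq * Vseries) m", OF _ _ init]) (use rec rec' in blast)+
  have EU: "fps_nth (E Useries) n = qpow (2 * int n) * useq n" for n
    using qpow_of_nat[of "2 * n"] by (simp add: Useries_def power_mult)
  have ordU: "ord_ge (int n) (fps_nth Useries n)" for n
    using ord_ge_useq[of 1 n] by (simp add: Useries_def)
  have ordEU: "ord_ge (int n) (fps_nth (E Useries) n)" for n
    unfolding EU by (intro ord_ge_useq ord_ge_mono[OF ord_ge_qpow]) simp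
  \<comment> \<open>At n = 0 the exponents 2n - 2 and 6n - 2 are negative but these powers cancel,
    so this index is treated separately.\<close>
  have ordV: "ord_ge (int n) (fps_nth Vseries n)" for n
  proof (cases "n = 0")
    case True
    then show ?thesis by (simp add: Vseries_def vseq_def u0)
  next
    case False
    then have "ord_ge 0 (qpow (2 * int n) + qpow (2 * int n - 2) - qpow (6 * int n - 2))"
      by (intro ord_ge_add ord_ge_diff ord_ge_mono[OF ord_ge_qpow]) auto
    then show ?thesis unfolding Vseries_def vseq_def by (simp add: ord_ge_useq)
  qed
  have main: "(fps_nth k has_sum S / qpoch_inf fls_X (fls_X ^ 2)) UNIV"
    if k: "\<And>m. fps_nth (expq * k) m = poch_neg m * fps_nth (expq * u) m"
      and ordk: "\<And>n. ord_ge (int n) (fps_nth k n)" and ordu: "\<And>n. ord_ge (int n) (fps_nth u n)"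
      and S: "(fps_nth u has_sum S) UNIV" for k u S
  proof -
    obtain K where K: "(fps_nth k has_sum K) UNIV" "(\<lambda>m. qs m * fps_nth (expq * k) m) \<longlonglongrightarrow> K"
      using expq_limit[OF ordk] by blast
    obtain S' where S': "(fps_nth u has_sum S') UNIV" "(\<lambda>m. qs m * fps_nth (expq * u) m) \<longlonglongrightarrow> S'"
      using expq_limit[OF ordu] by blast
    have "S' = S" using has_sum_unique[OF S'(1) S] .
    then have "(\<lambda>m. poch_neg m * (qs m * fps_nth (expq * u) m)) \<longlonglongrightarrow> inverse (qpoch_inf fls_X (fls_X ^ 2)) * S"
      using S'(2) by (intro tendsto_mult poch_neg_tendsto) simp
    then have "(\<lambda>m. qs m * fps_nth (expq * k) m) \<longlonglongrightarrow> S / qpoch_inf fls_X (fls_X ^ 2)"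
      unfolding k by (simp add: mult_ac divide_inverse)
    then have "K = S / qpoch_inf fls_X (fls_X ^ 2)" using K(2) by (rule LIMSEQ_unique[rotated])
    then show ?thesis using K(1) by simp
  qed
  have nths: "fps_nth Useries = useq" "fps_nth Vseries = vseq" "fps_nth (E Useries) = (\<lambda>n. qpow (2 * int n) * useq n)"
    using EU by (auto simp: Useries_def Vseries_def)
  show "(useq has_sum S) UNIV \<Longrightarrow> (fps_nth f has_sum S / qpoch_inf fls_X (fls_X ^ 2)) UNIV"
    using main[of f Useries S] eq ord(1) ordU nths by simp
  show "((\<lambda>n. qpow (2 * int n) * useq n) has_sum S) UNIV \<Longrightarrow> (fps_nth g has_sum S / qpoch_inf fls_X (fls_X ^ 2)) UNIV"
    using main[of g "E Useries" S] eq ord(2) ordEU nths(3) by simp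
  show "(vseq has_sum S) UNIV \<Longrightarrow> (fps_nth h has_sum S / qpoch_inf fls_X (fls_X ^ 2)) UNIV"
    using main[of h Vseries S] eq ord(3) ordV nths by simp
qed

text \<open>The even exponents sorted by residue modulo 14: one step of the finite version consumes
  seven consecutive factors.\<close>

lemma qpoch_inf_split:
  "qpoch_inf (fls_X ^ 2) (fls_X ^ 2) = (\<Prod>r\<in>{1..7}. qpoch_inf (fls_X ^ (2 * r)) (fls_X ^ 14))"
proof -
  have fin: "qpoch (fls_X ^ 2) (fls_X ^ 2) (7 * n) = (\<Prod>r\<in>{1..7}. qpoch (fls_X ^ (2 * r)) (fls_X ^ 14) n :: rat fls)" for n
  proof (induction n)
    case (Suc n)
    have f: "fls_X ^ 2 * (fls_X ^ 2) ^ (7 * n) * (fls_X ^ 2) ^ k = fls_X ^ (2 * Suc k) * ((fls_X :: rat fls) ^ 14) ^ n" for k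
      unfolding power_mult[symmetric] power_add[symmetric] by (rule arg_cong[of _ _ "power fls_X"]) simp
    have "7 * Suc n = 7 * n + 7" by simp
    then have "qpoch (fls_X ^ 2) (fls_X ^ 2) (7 * Suc n) = (qpoch (fls_X ^ 2) (fls_X ^ 2) (7 * n) :: rat fls) *
      (\<Prod>k<7. 1 - fls_X ^ (2 * Suc k) * (fls_X ^ 14) ^ n)"
      unfolding f[symmetric] by (simp only: qpoch_add) (simp only: qpoch_def)
    also have "(\<Prod>k<7. 1 - fls_X ^ (2 * Suc k) * (fls_X ^ 14) ^ n) = (\<Prod>r\<in>{1..7}. 1 - fls_X ^ (2 * r) * ((fls_X :: rat fls) ^ 14) ^ n)"
      by (rule prod.reindex_bij_witness[of _ "\<lambda>r. r - 1" Suc]) auto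
    finally show ?case unfolding Suc.IH qpoch_Suc prod.distrib .
  qed (simp add: qpoch_def)
  have "filterlim (\<lambda>m. 7 * m) sequentially (sequentially :: nat filter)"
    by (rule filterlim_subseq) (auto simp: strict_mono_def)
  then have "(\<lambda>n. qpoch (fls_X ^ 2) (fls_X ^ 2) (7 * n)) \<longlonglongrightarrow> qpoch_inf (fls_X ^ 2) (fls_X ^ 2)"
    using filterlim_compose[OF qpoch_tendsto(1)[of 2 2]] by simp
  moreover have "(\<lambda>n. qpoch (fls_X ^ 2) (fls_X ^ 2) (7 * n)) \<longlonglongrightarrow> (\<Prod>r\<in>{1..7}. qpoch_inf (fls_X ^ (2 * r)) (fls_X ^ 14))"
    unfolding fin by (simp add: numeral_eq_Suc prod.atLeast1_atMost_eq lessThan_Suc flip: power_Suc) (intro tendsto_mult qpoch_tendsto(1); simp)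
  ultimately show ?thesis by (rule LIMSEQ_unique)
qed

section \<open>Evaluation as theta quotients\<close>

lemma theta_X: "a \<le> 14 \<Longrightarrow> theta (fls_X ^ a) (fls_X ^ 14) = qpoch_inf (fls_X ^ a) (fls_X ^ 14) * qpoch_inf (fls_X ^ (14 - a)) (fls_X ^ 14)"
  by (simp add: theta_def power_diff)

text \<open>The equations 2c = 3s - 7 and 1 + 2r = s match the Bailey pairs c = 1, -2, 4 with s = 3,
  1, 5. In the quotient (q^2;q^2)_inf supplies the thetas of q^2, q^4, q^6; the quintuple product
  removes the one belonging to q^(2s) and adds that of q^s.\<close>

lemma has_sum_products:
  shows "(useq has_sum qpoch_inf fls_X (fls_X ^ 2) / thetas [fls_X ^ 2, fls_X ^ 3, fls_X ^ 4] (fls_X ^ 14)) UNIV"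
    and "((\<lambda>n. qpow (2 * int n) * useq n) has_sum qpoch_inf fls_X (fls_X ^ 2) / thetas [fls_X, fls_X ^ 4, fls_X ^ 6] (fls_X ^ 14)) UNIV"
    and "(vseq has_sum qpoch_inf fls_X (fls_X ^ 2) / thetas [fls_X ^ 2, fls_X ^ 5, fls_X ^ 6] (fls_X ^ 14)) UNIV"
proof -
  let ?b = "\<lambda>a. qpoch_inf (fls_X ^ a) (fls_X ^ 14)" and ?P = "qpoch_inf fls_X (fls_X ^ 2)"
  have sq: "k\<^sup>2 \<ge> \<bar>k\<bar>" for k :: int
    using mult_right_mono[of 1 "\<bar>k\<bar>" "\<bar>k\<bar>"] by (cases "k = 0") (auto simp: power2_eq_square)
  \<comment> \<open>Rewrites the second exponent for c = 4, r = 2 around k + 1, where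
    \<open>sq\<close> shows that it is nonnegative.\<close>
  have shift: "6 * k\<^sup>2 + 8 * k + 2 = 6 * (k + 1)\<^sup>2 - 4 * (k + 1)" for k :: int
    by (simp add: power2_eq_square algebra_simps)
  have b0: "?b a \<noteq> 0" if "a > 0" for a using qpoch_tendsto(2)[OF that, of 14] unit0_neq_0 by auto
  have Q: "qpoch_inf (fls_X ^ 2) (fls_X ^ 2) = ?b 2 * ?b 4 * ?b 6 * ?b 8 * ?b 10 * ?b 12 * ?b 14"
    unfolding qpoch_inf_split by (simp add: numeral_eq_Suc prod.atLeast1_atMost_eq lessThan_Suc mult_ac flip: power_Suc)
  have transfer: "(u has_sum ?P / T) UNIV"
    if u: "\<And>n. delta n * (Xsum c n - qpow (2 * r) * Ysum c n) = u n"
      and c: "2 * c = 3 * int s - 7" "1 + 2 * r = int s" and s: "0 < s" "s < 7"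
      and pos: "\<And>k. 6 * k\<^sup>2 + c * k \<ge> 0" "\<And>k. r + 6 * k\<^sup>2 + (4 + c) * k \<ge> 0"
      and T: "T * (?b 14 * ?b (14 - 2 * s) * ?b (2 * s)) = qpoch_inf (fls_X ^ 2) (fls_X ^ 2) * (?b (14 - s) * ?b s)"
      and T0: "T \<noteq> 0" for u c r s T
  proof -
    obtain S where S: "((\<lambda>n. delta n * (Xsum c n - qpow (2 * r) * Ysum c n)) has_sum conj_const * S) UNIV"
      "((\<lambda>k. sg k * (qpow (21 * k\<^sup>2 + 2 * c * k) + qpow (21 * k\<^sup>2 + (14 + 2 * c) * k + (1 + 2 * r)))) has_sum S) UNIV"
      using bailey_lemma[OF pos] by blast
    have "qpow (21 * k\<^sup>2 + (14 + 2 * c) * k + (1 + 2 * r)) = qpow (21 * k\<^sup>2 + 2 * c * k) * qpow (int s + 14 * k)" for k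
      unfolding c qpow_add[symmetric] by (simp add: algebra_simps)
    then have "((\<lambda>k. sg k * qpow (21 * k\<^sup>2 + (3 * int s - 7) * k) * (1 + qpow (int s + 14 * k))) has_sum S) UNIV"
      using S(2) unfolding c(1)[symmetric] by (simp add: algebra_simps)
    from has_sum_unique[OF this quintuple_product[OF s]]
    have S_eq: "S = ?b 14 * ?b (14 - 2 * s) * ?b (2 * s) / (?b (14 - s) * ?b s)" .
    have nz: "?b 14 \<noteq> 0" "?b (14 - 2 * s) \<noteq> 0" "?b (2 * s) \<noteq> 0" "?b (14 - s) \<noteq> 0" "?b s \<noteq> 0"
      "qpoch_inf (fls_X ^ 2) (fls_X ^ 2) \<noteq> 0"
      using s b0 qpoch_tendsto(2)[of 2 2] unit0_neq_0 by auto
    have "conj_const * S = ?P / T"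
    proof -
      have "p / Q * (n / d) = p / t" if "t * n = Q * d" "Q \<noteq> 0" "d \<noteq> 0" "t \<noteq> 0" for p Q n d t :: "rat fls"
        using that by (simp add: field_simps)
      from this[OF T nz(6) _ T0] show ?thesis unfolding conj_const_def S_eq using nz by simp
    qed
    then show ?thesis using S(1) unfolding u by simp
  qed
  show "(useq has_sum ?P / thetas [fls_X ^ 2, fls_X ^ 3, fls_X ^ 4] (fls_X ^ 14)) UNIV"
  proof (rule transfer[of 1 1 _ 3])
    show "delta n * (Xsum 1 n - qpow (2 * 1) * Ysum 1 n) = useq n" for n
      using bailey_pair(1)[of n] by (simp add: useq_def divide_inverse)
    show "6 * k\<^sup>2 + 1 * k \<ge> 0" "1 + 6 * k\<^sup>2 + (4 + 1) * k \<ge> 0" for k :: int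
      using sq[of k] unfolding distrib_right by linarith+
  qed (auto simp: thetas_def theta_X Q b0 mult_ac)
  show "((\<lambda>n. qpow (2 * int n) * useq n) has_sum ?P / thetas [fls_X, fls_X ^ 4, fls_X ^ 6] (fls_X ^ 14)) UNIV"
  proof (rule transfer[of "- 2" 0 _ 1])
    show "delta n * (Xsum (- 2) n - qpow (2 * 0) * Ysum (- 2) n) = qpow (2 * int n) * useq n" for n
      using bailey_pair(2)[of n] by (simp add: useq_def divide_inverse)
    show "6 * k\<^sup>2 + - 2 * k \<ge> 0" "0 + 6 * k\<^sup>2 + (4 + - 2) * k \<ge> 0" for k :: int
      using sq[of k] unfolding distrib_right by linarith+
  qed (use theta_X[of 1] b0[of 1] in \<open>auto simp: thetas_def theta_X Q b0 mult_ac\<close>)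
  show "(vseq has_sum ?P / thetas [fls_X ^ 2, fls_X ^ 5, fls_X ^ 6] (fls_X ^ 14)) UNIV"
  proof (rule transfer[of 4 2 _ 5])
    show "delta n * (Xsum 4 n - qpow (2 * 2) * Ysum 4 n) = vseq n" for n
      using bailey_pair(3)[of n] by (simp add: useq_def vseq_def divide_inverse)
    show "6 * k\<^sup>2 + 4 * k \<ge> 0" for k :: int using sq[of k] by linarith
    show "2 + 6 * k\<^sup>2 + (4 + 4) * k \<ge> 0" for k :: int using sq[of "k + 1"] shift[of k] by simp
  qed (auto simp: thetas_def theta_X Q b0 mult_ac)
qed

section \<open>Quadruple sums at x = 1\<close>

lemma null_family_quad_term:
  assumes "A \<ge> - 12" "B \<ge> - 12" "C \<ge> - 12" "D \<ge> - 12"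
  shows "null_family (quad_term A B C D)"
  unfolding null_family_def
proof
  fix N
  let ?M = "{..nat (N + 100)}"
  have "{z. \<not> ord_ge N (quad_term A B C D z)} \<subseteq> ?M \<times> ?M \<times> ?M \<times> ?M"
  proof
    fix z assume "z \<in> {z. \<not> ord_ge N (quad_term A B C D z)}"
    moreover obtain i j k l where z: "z = (i, j, k, l)" by (cases z)
    ultimately have n: "\<not> ord_ge N (quad_term A B C D (i, j, k, l))" by simp
    define e where "e = int (Qform i j k l) + A * int i + B * int j + C * int k + D * int l"
    have "unit0 (quad_denom fls_X i j k l :: rat fls)"
      unfolding quad_denom_def using unit0_qpoch[of 2 2] unit0_qpoch[of 1 1] by (auto intro!: unit0_mult)
    then have "ord_ge (e + 0) (qpow e * inverse (quad_denom fls_X i j k l))"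
      by (intro ord_ge_mult ord_ge_qpow unit0_ord_ge unit0_inverse)
    then have "ord_ge e (quad_term A B C D (i, j, k, l))"
      by (simp add: quad_term_def e_def divide_inverse)
    then have eN: "e < N" using n ord_ge_mono by (meson linorder_not_less)
    \<comment> \<open>The square of 4x - 13 gives the bound for the coefficient -12, the most
      negative one allowed; four copies of 25 make up the constant 100.\<close>
    have lin: "2 * (int x)\<^sup>2 + a * int x \<ge> int x - 25" if "a \<ge> - 12" for a and x :: nat
    proof -
      have "0 \<le> (4 * int x - 13)\<^sup>2" by simp
      then have "2 * (int x)\<^sup>2 - 12 * int x \<ge> int x - 25" by (simp add: power2_eq_square algebra_simps)
      moreover have "a * int x \<ge> - 12 * int x" using that by (intro mult_right_mono) auto
      ultimately show ?thesis by simp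
    qed
    have "int (2 * i\<^sup>2 + 2 * j\<^sup>2 + 2 * k\<^sup>2 + 2 * l\<^sup>2) \<le> int (Qform i j k l)"
      unfolding of_nat_le_iff Qform_def by simp
    then have "e \<ge> int i + int j + int k + int l - 100"
      unfolding e_def using lin[OF assms(1), of i] lin[OF assms(2), of j] lin[OF assms(3), of k] lin[OF assms(4), of l]
      by simp
    then show "z \<in> ?M \<times> ?M \<times> ?M \<times> ?M" using eN unfolding z by auto
  qed
  then show "finite {z. \<not> ord_ge N (quad_term A B C D z)}" by (rule finite_subset) auto
qed

text \<open>Grouping the quadruples by their x-exponent identifies the unrestricted sum with the sum
  of the coefficients of \<open>S_fps\<close>, its value at x = 1.\<close>

lemma quad_term_has_sum:
  assumes "A \<ge> - 12" "B \<ge> - 12" "C \<ge> - 12" "D \<ge> - 12"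
  shows "\<exists>S. (quad_term A B C D has_sum S) UNIV \<and> (fps_nth (S_fps A B C D) has_sum S) UNIV"
proof -
  obtain S where S: "(quad_term A B C D has_sum S) UNIV"
    using has_sum_ex[OF null_family_quad_term[OF assms]] by blast
  have "bij_betw snd (Sigma UNIV quads) UNIV"
    unfolding bij_betw_def inj_on_def by (force simp: quads_def image_iff)
  from has_sum_reindex_bij_betw[OF this, of "quad_term A B C D" S] S
  have "((\<lambda>z. quad_term A B C D (snd z)) has_sum S) (Sigma UNIV quads)" by simp
  then have "(fps_nth (S_fps A B C D) has_sum S) UNIV"
    by (rule has_sum_SigmaD) (simp add: S_fps_def has_sum_finite)
  then show ?thesis using S by blast
qed

text \<open>Multiplication by x only shifts the coefficients, so the value at x = 1 stays the
  same.\<close>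

lemma has_sum_X_mult:
  fixes f :: "'a::idom fls fps"
  assumes "(fps_nth f has_sum S) UNIV"
  shows "(fps_nth (fps_X * f) has_sum S) UNIV"
proof -
  have "((\<lambda>n. fps_nth (fps_X * f) (Suc n)) has_sum S) UNIV" using assms by simp
  then have "(fps_nth (fps_X * f) has_sum S) (range Suc)"
    by (subst has_sum_reindex) (auto simp: o_def)
  then show ?thesis
    by (subst has_sum_cong_neutral[where T = "range Suc" and g = "fps_nth (fps_X * f)"]) (auto simp: image_iff gr0_conv_Suc)
qed

lemma has_sum_qf_mult:
  assumes "(fps_nth f has_sum S) UNIV"
  shows "(fps_nth (qf ^ n * f) has_sum fls_X ^ n * S) UNIV"
  using has_sum_cmult_right[OF assms, of "fls_X ^ n"] by (simp add: fps_const_power cong: has_sum_cong)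

lemma has_sum_fls_diff:
  fixes f g :: "'b \<Rightarrow> 'a::ab_group_add fls"
  assumes "(f has_sum S) A" "(g has_sum T) A"
  shows "((\<lambda>x. f x - g x) has_sum (S - T)) A"
  using has_sum_add[OF assms(1), of "\<lambda>x. - g x" "- T"] assms(2) by (simp add: has_sum_uminus)

lemma has_sum_fps_add:
  "(fps_nth f has_sum S) UNIV \<Longrightarrow> (fps_nth g has_sum T) UNIV \<Longrightarrow> (fps_nth (f + g) has_sum (S + T :: 'a::ab_group_add fls)) UNIV"
  using has_sum_add[of "fps_nth f"] by (simp cong: has_sum_cong)

lemma has_sum_fps_diff:
  "(fps_nth f has_sum S) UNIV \<Longrightarrow> (fps_nth g has_sum T) UNIV \<Longrightarrow> (fps_nth (f - g) has_sum (S - T :: 'a::ab_group_add fls)) UNIV"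
  using has_sum_fls_diff[of "fps_nth f"] by (simp cong: has_sum_cong)

section \<open>The final identities\<close>

lemma F_series_lift:
  shows "lift_xq (F_series 7) = S_f" "lift_xq (F_series 3) = S_g"
    "fps_X^2 * qf^2 * lift_xq (F_series 4) = S_h"
proof -
  have F: "F_series 7 = gen_series (nandi_class 7)" "F_series 3 = gen_series (nandi_class 3)"
    "F_series 4 = gen_series (nandi_class 4)"
    by (rule F_series_eq, simp)+
  have "quads 0 = {(0, 0, 0, 0)}" by (auto simp: quads_def)
  then have "fps_nth (lift_xq (F_series 7)) 0 = fps_nth S_f 0"
    using gen_series_nandi_S_space[of 7]
    by (simp add: F S_space_def lift_xq_nth lift_q_1 S_f_def S_fps_def quad_term_def Qform_def quad_denom_def qpoch_def)
  note u = reduced_system_unique[OF F_system_reduced[OF gen_series_nandi_system] S_reduced this[unfolded F]]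
  show "lift_xq (F_series 7) = S_f" "lift_xq (F_series 3) = S_g"
    "fps_X^2 * qf^2 * lift_xq (F_series 4) = S_h"
    using u by (simp_all only: F)
qed

lemma F_series_at_one:
  shows "(fps_nth S_f has_sum 1 / thetas [fls_X ^ 2, fls_X ^ 3, fls_X ^ 4] (fls_X ^ 14)) UNIV"
    and "(fps_nth S_g has_sum 1 / thetas [fls_X, fls_X ^ 4, fls_X ^ 6] (fls_X ^ 14)) UNIV"
    and "(fps_nth S_h has_sum fls_X ^ 2 / thetas [fls_X ^ 2, fls_X ^ 5, fls_X ^ 6] (fls_X ^ 14)) UNIV"
proof -
  let ?L = "\<lambda>i. lift_xq (gen_series (nandi_class i))"
  note e = F_system_elim(5-7)[OF gen_series_nandi_system]
  have F: "F_series 7 = gen_series (nandi_class 7)" "F_series 3 = gen_series (nandi_class 3)"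
    "F_series 4 = gen_series (nandi_class 4)"
    by (rule F_series_eq, simp)+
  have 0: "fps_nth (?L 7) 0 = 1"
    using gen_series_nandi_S_space[of 7] by (simp add: S_space_def lift_xq_nth lift_q_1)
  note ord = ord_ge_gen_series[OF nandi_class_subset]
  note s = specialize_at_one[OF e 0 ord ord ord]
  have P: "qpoch_inf fls_X (fls_X ^ 2) \<noteq> 0" using qpoch_tendsto(2)[of 1 2] unit0_neq_0 by simp
  show "(fps_nth S_f has_sum 1 / thetas [fls_X ^ 2, fls_X ^ 3, fls_X ^ 4] (fls_X ^ 14)) UNIV"
    using s(1)[OF has_sum_products(1)] P unfolding F_series_lift(1)[symmetric] F by simp
  show "(fps_nth S_g has_sum 1 / thetas [fls_X, fls_X ^ 4, fls_X ^ 6] (fls_X ^ 14)) UNIV"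
    using s(2)[OF has_sum_products(2)] P unfolding F_series_lift(2)[symmetric] F by simp
  have "(fps_nth (?L 4) has_sum 1 / thetas [fls_X ^ 2, fls_X ^ 5, fls_X ^ 6] (fls_X ^ 14)) UNIV"
    using s(3)[OF has_sum_products(3)] P by simp
  \<comment> \<open>Of the factor x^2 q^2 in \<open>S_h\<close> only q^2 is seen at x = 1.\<close>
  from has_sum_qf_mult[OF this, of 2]
  have "(fps_nth (fps_X * (fps_X * (qf^2 * ?L 4))) has_sum
      fls_X ^ 2 * (1 / thetas [fls_X ^ 2, fls_X ^ 5, fls_X ^ 6] (fls_X ^ 14))) UNIV"
    by (intro has_sum_X_mult)
  then show "(fps_nth S_h has_sum fls_X ^ 2 / thetas [fls_X ^ 2, fls_X ^ 5, fls_X ^ 6] (fls_X ^ 14)) UNIV"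
    unfolding F_series_lift(3)[symmetric] F by (simp add: power2_eq_square mult.assoc)
qed

lemma quadruple_sum_1:
  "(\<Sum>\<^sub>\<infinity>(i, j, k, l)\<in>UNIV. q_uni ^ Qform i j k l / quad_denom q_uni i j k l)
      = 1 / thetas [q_uni^2, q_uni^3, q_uni^4] (q_uni^14)"
proof (rule infsumI)
  obtain S where S: "(quad_term 0 0 0 0 has_sum S) UNIV" "(fps_nth (S_fps 0 0 0 0) has_sum S) UNIV"
    using quad_term_has_sum[of 0 0 0 0] by auto
  have "S = 1 / thetas [q_uni^2, q_uni^3, q_uni^4] (q_uni^14)"
    by (rule has_sum_unique[OF S(2) F_series_at_one(1)[unfolded S_f_def]])
  moreover have "quad_term 0 0 0 0 = (\<lambda>(i, j, k, l). q_uni ^ Qform i j k l / quad_denom q_uni i j k l)"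
    by (auto simp: quad_term_def qpow_of_nat)
  ultimately show "((\<lambda>(i, j, k, l). q_uni ^ Qform i j k l / quad_denom q_uni i j k l) has_sum
      1 / thetas [q_uni^2, q_uni^3, q_uni^4] (q_uni^14)) UNIV" using S(1) by simp
qed

lemma quad_term_eq:
  "quad_term A B C D (i, j, k, l) = q_uni ^ Qform i j k l / quad_denom q_uni i j k l *
     q_uni powi (A * int i + B * int j + C * int k + D * int l)"
  unfolding quad_term_def prod.case qpow_of_nat[symmetric] qpow_def[symmetric]
  by (simp add: qpow_add mult_ac add.assoc)

lemma quadruple_sum_2:
  "(\<Sum>\<^sub>\<infinity>(i, j, k, l)\<in>UNIV. q_uni ^ Qform i j k l / quad_denom q_uni i j k l
        * (q_uni ^ (2 * i + 2 * j + k)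
           + q_uni powi (- 2 * int j - 2 * int k - int l) - 1))
      = 1 / thetas [q_uni, q_uni^4, q_uni^6] (q_uni^14)" (is "infsum ?t UNIV = ?R")
proof (rule infsumI)
  obtain S1 where S1: "(quad_term 0 (- 2) (- 2) (- 1) has_sum S1) UNIV" "(fps_nth (S_fps 0 (- 2) (- 2) (- 1)) has_sum S1) UNIV"
    using quad_term_has_sum[of 0 "- 2" "- 2" "- 1"] by auto
  obtain S2 where S2: "(quad_term 0 0 0 0 has_sum S2) UNIV" "(fps_nth (S_fps 0 0 0 0) has_sum S2) UNIV"
    using quad_term_has_sum[of 0 0 0 0] by auto
  obtain S3 where S3: "(quad_term 2 2 1 0 has_sum S3) UNIV" "(fps_nth (S_fps 2 2 1 0) has_sum S3) UNIV"
    using quad_term_has_sum[of 2 2 1 0] by auto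
  have "(fps_nth S_g has_sum S1 - S2 + S3) UNIV"
    unfolding S_g_def by (intro has_sum_fps_add has_sum_fps_diff S1 S2 S3)
  then have R: "S1 - S2 + S3 = ?R" by (rule has_sum_unique[OF _ F_series_at_one(2)])
  have "((\<lambda>z. quad_term 0 (- 2) (- 2) (- 1) z - quad_term 0 0 0 0 z + quad_term 2 2 1 0 z) has_sum S1 - S2 + S3) UNIV"
    by (intro has_sum_add has_sum_fls_diff S1 S2 S3)
  moreover have "?t z = quad_term 0 (- 2) (- 2) (- 1) z - quad_term 0 0 0 0 z + quad_term 2 2 1 0 z" for z
  proof -
    obtain i j k l where z: "z = (i, j, k, l)" by (cases z)
    have "q_uni ^ (2 * i + 2 * j + k) = q_uni powi (2 * int i + 2 * int j + 1 * int k + 0 * int l)"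
      unfolding power_int_of_nat[symmetric] by simp
    then show ?thesis unfolding z prod.case quad_term_eq by (simp add: algebra_simps)
  qed
  ultimately show "(?t has_sum ?R) UNIV" unfolding R by (simp only: cong: has_sum_cong)
qed

lemma quadruple_sum_3:
  "(\<Sum>\<^sub>\<infinity>(i, j, k, l)\<in>UNIV. q_uni ^ Qform i j k l / quad_denom q_uni i j k l
        * (q_uni powi (- 8 * int i - 12 * int j - 8 * int k - 4 * int l + 2)
           - q_uni powi (- 2 * int i - 4 * int j - 3 * int k - 2 * int l)
           - q_uni powi (- 4 * int i - 8 * int j - 6 * int k - 3 * int l + 2)
           - q_uni powi (- 2)))
      = 1 / thetas [q_uni^2, q_uni^5, q_uni^6] (q_uni^14)" (is "infsum ?t UNIV = ?R")
proof (rule infsumI)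
  obtain S1 where S1: "(quad_term (- 8) (- 12) (- 8) (- 4) has_sum S1) UNIV" "(fps_nth (S_fps (- 8) (- 12) (- 8) (- 4)) has_sum S1) UNIV"
    using quad_term_has_sum[of "- 8" "- 12" "- 8" "- 4"] by auto
  obtain S2 where S2: "(quad_term (- 2) (- 4) (- 3) (- 2) has_sum S2) UNIV" "(fps_nth (S_fps (- 2) (- 4) (- 3) (- 2)) has_sum S2) UNIV"
    using quad_term_has_sum[of "- 2" "- 4" "- 3" "- 2"] by auto
  obtain S3 where S3: "(quad_term 0 0 0 0 has_sum S3) UNIV" "(fps_nth (S_fps 0 0 0 0) has_sum S3) UNIV"
    using quad_term_has_sum[of 0 0 0 0] by auto
  obtain S4 where S4: "(quad_term (- 4) (- 8) (- 6) (- 3) has_sum S4) UNIV" "(fps_nth (S_fps (- 4) (- 8) (- 6) (- 3)) has_sum S4) UNIV"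
    using quad_term_has_sum[of "- 4" "- 8" "- 6" "- 3"] by auto
  have "(fps_nth S_h has_sum fls_X^4 * S1 - fls_X^2 * S2 - S3 - fls_X^4 * S4) UNIV"
    unfolding S_h_def power2_eq_square[of fps_X] mult.assoc
    by (intro has_sum_fps_diff has_sum_X_mult has_sum_qf_mult S1 S2 S3 S4)
  then have "fls_X^4 * S1 - fls_X^2 * S2 - S3 - fls_X^4 * S4 = fls_X^2 * ?R"
    using has_sum_unique[OF _ F_series_at_one(3)] by fastforce
  \<comment> \<open>Removes the factor q^2 carried by \<open>S_h\<close>.\<close>
  then have "qpow (- 2) * (fls_X^4 * S1 - fls_X^2 * S2 - S3 - fls_X^4 * S4) = qpow (- 2) * (qpow 2 * ?R)"
    using qpow_of_nat[of 2] by simp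
  moreover have q: "qpow (- 2) * (qpow 2 * a) = a" for a
    unfolding mult.assoc[symmetric] qpow_add[symmetric] by simp
  moreover have "fls_X^4 = qpow 2 * qpow 2" "fls_X^2 = qpow 2"
    using qpow_of_nat[of 4] qpow_of_nat[of 2] qpow_add[of 2 2] by simp_all
  ultimately have R: "qpow 2 * S1 - S2 - qpow (- 2) * S3 - qpow 2 * S4 = ?R"
    by (simp only: right_diff_distrib mult.assoc q)
  have "((\<lambda>z. qpow 2 * quad_term (- 8) (- 12) (- 8) (- 4) z - quad_term (- 2) (- 4) (- 3) (- 2) z
      - qpow (- 2) * quad_term 0 0 0 0 z - qpow 2 * quad_term (- 4) (- 8) (- 6) (- 3) z) has_sum
      qpow 2 * S1 - S2 - qpow (- 2) * S3 - qpow 2 * S4) UNIV"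
    by (intro has_sum_fls_diff has_sum_cmult_right S1 S2 S3 S4)
  moreover have "?t z = qpow 2 * quad_term (- 8) (- 12) (- 8) (- 4) z - quad_term (- 2) (- 4) (- 3) (- 2) z
      - qpow (- 2) * quad_term 0 0 0 0 z - qpow 2 * quad_term (- 4) (- 8) (- 6) (- 3) z" for z
  proof -
    obtain i j k l where z: "z = (i, j, k, l)" by (cases z)
    have "q_uni powi (- 8 * int i - 12 * int j - 8 * int k - 4 * int l + 2) =
        qpow 2 * q_uni powi (- 8 * int i + - 12 * int j + - 8 * int k + - 4 * int l)"
      "q_uni powi (- 4 * int i - 8 * int j - 6 * int k - 3 * int l + 2) =
        qpow 2 * q_uni powi (- 4 * int i + - 8 * int j + - 6 * int k + - 3 * int l)"
      unfolding qpow_def[symmetric] qpow_add[symmetric] by (simp_all add: add.commute)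
    then show ?thesis unfolding z prod.case quad_term_eq qpow_def[of "- 2"] by (simp add: algebra_simps)
  qed
  ultimately show "(?t has_sum ?R) UNIV" unfolding R by (simp only: cong: has_sum_cong)
qed

theorem theorem12:
  shows
   "(gen_series N1_set = F_series 7
      \<and> to_laurent (F_series 7) = S_series 0 0 0 0)
  \<and> (gen_series N2_set = F_series 3
      \<and> to_laurent (F_series 3) =
          S_series 0 (-2) (-2) (-1) - S_series 0 0 0 0 + S_series 2 2 1 0)
  \<and> (gen_series N3_set = F_series 4
      \<and> to_laurent (F_series 4) =
          q_ls^2 / x_ls^2 * S_series (-8) (-12) (-8) (-4)
          - 1 / x_ls * S_series (-2) (-4) (-3) (-2)
          - 1 / q_ls^2 * S_series 0 0 0 0
          - q_ls^2 / x_ls^2 * S_series (-4) (-8) (-6) (-3))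
  \<and> (\<Sum>\<^sub>\<infinity>(i, j, k, l)\<in>UNIV. q_uni ^ Qform i j k l / quad_denom q_uni i j k l)
      = 1 / thetas [q_uni^2, q_uni^3, q_uni^4] (q_uni^14)
  \<and> (\<Sum>\<^sub>\<infinity>(i, j, k, l)\<in>UNIV. q_uni ^ Qform i j k l / quad_denom q_uni i j k l
        * (q_uni ^ (2 * i + 2 * j + k)
           + q_uni powi (- 2 * int j - 2 * int k - int l) - 1))
      = 1 / thetas [q_uni, q_uni^4, q_uni^6] (q_uni^14)
  \<and> (\<Sum>\<^sub>\<infinity>(i, j, k, l)\<in>UNIV. q_uni ^ Qform i j k l / quad_denom q_uni i j k l
        * (q_uni powi (- 8 * int i - 12 * int j - 8 * int k - 4 * int l + 2)
           - q_uni powi (- 2 * int i - 4 * int j - 3 * int k - 2 * int l)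
           - q_uni powi (- 4 * int i - 8 * int j - 6 * int k - 3 * int l + 2)
           - q_uni powi (- 2)))
      = 1 / thetas [q_uni^2, q_uni^5, q_uni^6] (q_uni^14)"
proof (intro conjI quadruple_sum_1 quadruple_sum_2 quadruple_sum_3)
  show "gen_series N1_set = F_series 7" "gen_series N2_set = F_series 3" "gen_series N3_set = F_series 4"
    by (subst F_series_eq; simp add: nandi_class_def)+
  show "to_laurent (F_series 7) = S_series 0 0 0 0"
    by (simp add: to_laurent_eq F_series_lift S_f_def S_series_eq)
  show "to_laurent (F_series 3) = S_series 0 (-2) (-2) (-1) - S_series 0 0 0 0 + S_series 2 2 1 0"
    by (simp add: to_laurent_eq F_series_lift S_g_def S_series_eq)
  have hom: "fps_to_fls (fps_X^2 * qf^2 * lift_xq (F_series 4)) = x_ls^2 * q_ls^2 * to_laurent (F_series 4)"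
    by (simp add: to_laurent_eq fls_times_fps_to_fls fps_to_fls_power fls_const_power)
  have "x_ls^2 * q_ls^2 * to_laurent (F_series 4) = q_ls^4 * S_series (-8) (-12) (-8) (-4)
      - x_ls * q_ls^2 * S_series (-2) (-4) (-3) (-2) - x_ls^2 * S_series 0 0 0 0
      - q_ls^4 * S_series (-4) (-8) (-6) (-3)"
    unfolding hom[symmetric] F_series_lift S_h_def S_series_eq
    by (simp add: fls_times_fps_to_fls fps_to_fls_power fls_const_power)
  moreover have "q_ls \<noteq> 0" "x_ls \<noteq> 0" by simp_all
  moreover have "t = q^2 / x^2 * a - 1 / x * b - 1 / q^2 * c - q^2 / x^2 * d"
    if "x^2 * q^2 * t = q^4 * a - x * q^2 * b - x^2 * c - q^4 * d" "q \<noteq> 0" "x \<noteq> 0" for t a b c d x q :: "rat fls fls"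
  proof -
    have "t = (q^4 * a - x * q^2 * b - x^2 * c - q^4 * d) / (x^2 * q^2)"
      unfolding that(1)[symmetric] using that(2,3) by simp
    also have "\<dots> = q^2 / x^2 * a - 1 / x * b - 1 / q^2 * c - q^2 / x^2 * d"
      using that(2,3) by (simp add: field_simps power2_eq_square power4_eq_xxxx)
    finally show ?thesis .
  qed
  ultimately show "to_laurent (F_series 4) = q_ls^2 / x_ls^2 * S_series (-8) (-12) (-8) (-4)
          - 1 / x_ls * S_series (-2) (-4) (-3) (-2) - 1 / q_ls^2 * S_series 0 0 0 0
          - q_ls^2 / x_ls^2 * S_series (-4) (-8) (-6) (-3)"
    by blast
qed

end
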